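(* Let $d>0$ and let $\gamma\in\mathbb C$ with $\mathrm{Re}\,\gamma>\tfrac12$. Let $b_0=1$ and, for $n\ge1$, $$b_n\sim B[2\,\mathrm{Re}\,\gamma+nd-1,\;nd],$$ and for $n\ge0$ let $c_n$ be a real random variable with the (generalized) Cauchy density $$\frac{\Gamma(\gamma+nd)\,\Gamma(\bar\gamma+nd)}{\pi\,2^{2(1-nd-\mathrm{Re}\,\gamma)}\,\Gamma(2(\mathrm{Re}\,\gamma+nd)-1)}\,(1+ic)^{-(\gamma+nd)}(1-ic)^{-(\bar\gamma+nd)},\qquad c\in\mathbb R,$$ all the $b_n,c_n$ being independent. Then the random polynomials $p_n(z;\gamma+(n-1)d;d)$ satisfy the random three term recurrence $$p_{n+1}(z;\gamma+nd;d)=\frac{z-c_n}{b_n}\,p_n(z;\gamma+(n-1)d;d)+\Big(1-\frac1{b_n}\Big)(1+z^2)\,p_{n-1}(z;\gamma+(n-2)d;d),\qquad n=0,1,2,\dots,$$ with $p_0:=1$ (for $n=0$ the last term is zero). That is, the polynomials $P_n$ defined recursively by $P_0=1$ and $P_{n+1}(z)=\frac{z-c_n}{b_n}P_n(z)+(1-\frac1{b_n})(1+z^2)P_{n-1}(z)$ are such that, for every $n\ge1$, $P_n$ has the distribution of $p_n(z;\gamma+(n-1)d;d)$.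
   Context: $B[\alpha,\beta]$ is the beta distribution on $(0,1)$, with density proportional to $x^{\alpha-1}(1-x)^{\beta-1}$. For $n\ge1$ and a complex parameter $\gamma'$, $p_n(z;\gamma';d)$ denotes the random monic polynomial $\prod_{j=1}^n(z-x_j)$ of degree $n$ whose zeros $x_1>\cdots>x_n$ are real with joint density $$\frac1{I_n(\gamma';d)}\prod_{j=1}^n(1+ix_j)^{-\gamma'}(1-ix_j)^{-\bar{\gamma'}}\prod_{1\le j<k\le n}|x_j-x_k|^{2d},$$ where $I_n(\gamma';d)$ is the normalization constant. Complex powers use the principal branch. *)

theory Defs
  imports "HOL-Probability.Probability" "HOL-Computational_Algebra.Polynomial"
begin

text \<open>
  The two factors are complex conjugates of each other (both bases have positive real part,
  so the principal branch commutes with conjugation); hence the product is a positive real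
  and taking \<open>Re\<close> loses nothing.
\<close>

definition cauchy_weight :: "complex \<Rightarrow> real \<Rightarrow> real" where
  "cauchy_weight a x =
     Re ((1 + \<i> * of_real x) powr (- a) * (1 - \<i> * of_real x) powr (- cnj a))"

text \<open>
  \<open>Gamma a * Gamma (cnj a)\<close> is likewise real.
\<close>

definition cauchy_density :: "complex \<Rightarrow> real \<Rightarrow> real" where
  "cauchy_density a x =
     Re (Gamma a * Gamma (cnj a)) / (pi * 2 powr (2 * (1 - Re a)) * Gamma (2 * Re a - 1))
       * cauchy_weight a x"

definition beta_density :: "real \<Rightarrow> real \<Rightarrow> real \<Rightarrow> real" where
  "beta_density \<alpha> \<beta> x =
     (if 0 < x \<and> x < 1 then x powr (\<alpha> - 1) * (1 - x) powr (\<beta> - 1) / Beta \<alpha> \<beta> else 0)"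

text \<open>
  The unnormalized joint density of the ordered zeros \<open>x 1 > \<dots> > x n\<close>; it vanishes off the
  ordered region.
\<close>

definition zeros_weight :: "nat \<Rightarrow> complex \<Rightarrow> real \<Rightarrow> (nat \<Rightarrow> real) \<Rightarrow> real" where
  "zeros_weight n a d x =
     (if \<forall>j\<in>{1..n}. \<forall>k\<in>{1..n}. j < k \<longrightarrow> x k < x j
      then (\<Prod>j\<in>{1..n}. cauchy_weight a (x j)) *
           (\<Prod>k\<in>{1..n}. \<Prod>j\<in>{1..<k}. \<bar>x j - x k\<bar> powr (2 * d))
      else 0)"

definition zeros_norm :: "nat \<Rightarrow> complex \<Rightarrow> real \<Rightarrow> ennreal" where
  "zeros_norm n a d = (\<integral>\<^sup>+ x. ennreal (zeros_weight n a d x) \<partial>(\<Pi>\<^sub>M j\<in>{1..n}. lborel))"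

definition zeros_measure :: "nat \<Rightarrow> complex \<Rightarrow> real \<Rightarrow> (nat \<Rightarrow> real) measure" where
  "zeros_measure n a d =
     density (\<Pi>\<^sub>M j\<in>{1..n}. lborel) (\<lambda>x. ennreal (zeros_weight n a d x) / zeros_norm n a d)"

text \<open>
  Polynomials carry the sigma-algebra generated by all coefficient maps.
\<close>

definition poly_borel :: "real poly measure" where
  "poly_borel = vimage_algebra UNIV coeff (\<Pi>\<^sub>M i\<in>UNIV. borel)"

text \<open>
  The law of \<open>p\<^sub>n(z; a; d)\<close>.
\<close>

definition rand_poly_law :: "nat \<Rightarrow> complex \<Rightarrow> real \<Rightarrow> real poly measure" where
  "rand_poly_law n a d =
     distr (zeros_measure n a d) poly_borel (\<lambda>x. \<Prod>j\<in>{1..n}. [:- x j, 1:])"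

text \<open>
  In the second equation the term with \<open>P\<^sub>-\<^sub>1\<close> is dropped; its coefficient \<open>1 - 1 / b 0\<close>
  is zero when \<open>b 0 = 1\<close>.
\<close>

fun rec_poly :: "(nat \<Rightarrow> real) \<Rightarrow> (nat \<Rightarrow> real) \<Rightarrow> nat \<Rightarrow> real poly" where
  "rec_poly b c 0 = 1"
| "rec_poly b c (Suc 0) = smult (1 / b 0) ([:- c 0, 1:] * rec_poly b c 0)"
| "rec_poly b c (Suc (Suc n)) =
     smult (1 / b (Suc n)) ([:- c (Suc n), 1:] * rec_poly b c (Suc n)) +
     smult (1 - 1 / b (Suc n)) ([:1, 0, 1:] * rec_poly b c n)"

end

theory Submission
  imports Defs
begin

text \<open>
  The pair \<open>(P\<^sub>n, P\<^bsub>n-1\<^esub>)\<close> is followed instead of \<open>P\<^sub>n\<close> alone: by induction on \<open>n\<close> the zeros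
  \<open>x\<close> of \<open>P\<^sub>n\<close> and \<open>y\<close> of \<open>P\<^bsub>n-1\<^esub>\<close> have a joint density proportional to
  \<open>\<Prod>\<bar>x\<^sub>i - y\<^sub>j\<bar> powr (d - 1) \<cdot> \<Delta>(x) \<cdot> \<Delta>(y) \<cdot> \<Prod> w(x\<^sub>j)\<close> on interlacing configurations.
  For fixed \<open>x\<close>, the residues of \<open>(1/b - 1) P\<^bsub>n-1\<^esub> / P\<^sub>n\<close> at \<open>x\<close> are coordinates for
  \<open>(y, b)\<close> in which the density is \<open>\<Prod>v\<^sub>i powr (d - 1)\<close> times a function of the sum \<open>\<Sum>v\<^sub>i = 1/b - 1\<close>.
  Since \<open>P\<^bsub>n+1\<^esub> / P\<^sub>n\<close> is again given by partial fractions, the same change of variables run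
  backwards leads from \<open>(v, c)\<close> to the zeros of \<open>P\<^bsub>n+1\<^esub>\<close>; its value at \<open>z = \<i>\<close> shows how the
  Cauchy weights transform. All Jacobians come from one-dimensional substitutions, adding one
  pole and one zero at a time. Integrating out \<open>y\<close> in residue coordinates gives the law of \<open>P\<^sub>n\<close>;
  the normalization is determined by the total mass.
\<close>

section \<open>Integration tools\<close>

lemma nn_integral_substitution_open_interval:
  fixes f :: "real \<Rightarrow> ennreal" and g g' :: "real \<Rightarrow> real" and a b :: ereal
  assumes f [measurable]: "f \<in> borel_measurable borel" and "a < b"
    and deriv: "\<And>x. x \<in> einterval a b \<Longrightarrow> (g has_real_derivative g' x) (at x)"
    and cont: "continuous_on (einterval a b) g'"
    and nonneg: "\<And>x. x \<in> einterval a b \<Longrightarrow> 0 \<le> g' x"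
    and meas [measurable]: "g \<in> borel_measurable borel" "g' \<in> borel_measurable borel"
  shows "(\<integral>\<^sup>+x. f x * indicator (g ` einterval a b) x \<partial>lborel) =
         (\<integral>\<^sup>+x. f (g x) * ennreal (g' x) * indicator (einterval a b) x \<partial>lborel)"
proof -
  \<comment> \<open>Closed intervals exhaust the open one. The substitution rule holds on each of
    them, and monotone convergence then covers infinite endpoints and endpoints where
    \<open>g\<close> has a pole.\<close>
  obtain u l :: "nat \<Rightarrow> real" where
    I: "einterval a b = (\<Union>i. {l i .. u i})" and "incseq u" "decseq l" and lu: "\<And>i. l i < u i"
    by (blast intro: einterval_Icc_approximation[OF \<open>a < b\<close>])
  have sub: "{l i..u i} \<subseteq> einterval a b" for i unfolding I by auto
  have mono: "g x \<le> g y" if "l i \<le> x" "x \<le> y" "y \<le> u i" for i x y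
  proof (rule DERIV_nonneg_imp_nondecreasing[OF \<open>x \<le> y\<close>])
    fix t assume "x \<le> t" "t \<le> y"
    then have "t \<in> einterval a b" using that sub[of i] by auto
    then show "\<exists>D. (g has_real_derivative D) (at t) \<and> 0 \<le> D" using deriv nonneg by blast
  qed
  have img: "g ` {l i..u i} = {g (l i)..g (u i)}" for i
  proof (intro subset_antisym subsetI)
    fix y assume "y \<in> g ` {l i..u i}"
    then obtain x where "y = g x" "l i \<le> x" "x \<le> u i" by auto
    then show "y \<in> {g (l i)..g (u i)}" using mono[of i "l i" x] mono[of i x "u i"] by simp
  next
    fix y assume y: "y \<in> {g (l i)..g (u i)}"
    have "continuous_on {l i..u i} g"
      using sub[of i] deriv by (intro continuous_at_imp_continuous_on ballI DERIV_isCont) (rule deriv, rule subsetD)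
    then obtain x where "l i \<le> x" "x \<le> u i" "g x = y"
      using IVT'[of g "l i" y "u i"] lu[of i] y by auto
    then show "y \<in> g ` {l i..u i}" by (intro image_eqI[of _ _ x]) auto
  qed
  have inc1: "incseq (\<lambda>i. {l i..u i})"
    using \<open>incseq u\<close> \<open>decseq l\<close> unfolding incseq_def decseq_def by simp
  have inc2: "incseq (\<lambda>i. {g (l i)..g (u i)})"
    unfolding img[symmetric] using inc1 unfolding incseq_def by (blast intro: image_mono)
  \<comment> \<open>Continuity from below of the measure with density \<open>h\<close>.\<close>
  have *: "(\<integral>\<^sup>+x. h x * indicator (\<Union>i. S i) x \<partial>lborel) = (SUP i. \<integral>\<^sup>+x. h x * indicator (S i) x \<partial>lborel)"
    if [measurable]: "h \<in> borel_measurable borel" "\<And>i. S i \<in> sets borel" and inc: "incseq S" for h :: "real \<Rightarrow> ennreal" and S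
  proof -
    have "(\<integral>\<^sup>+x. indicator (S i) x \<partial>density lborel h) = (\<integral>\<^sup>+x. h x * indicator (S i) x \<partial>lborel)" for i
      by (subst nn_integral_density) auto
    moreover have "(\<integral>\<^sup>+x. indicator (\<Union>i. S i) x \<partial>density lborel h) = (\<integral>\<^sup>+x. h x * indicator (\<Union>i. S i) x \<partial>lborel)"
      by (subst nn_integral_density) auto
    moreover have "range S \<subseteq> sets (density lborel h)" by auto
    ultimately show ?thesis using SUP_emeasure_incseq[OF _ inc, of "density lborel h"] by simp
  qed
  have "(\<integral>\<^sup>+x. f x * indicator {g (l i)..g (u i)} x \<partial>lborel) =
      (\<integral>\<^sup>+x. f (g x) * ennreal (g' x) * indicator {l i..u i} x \<partial>lborel)" for i
    using sub[of i] by (intro nn_integral_substitution_aux lu)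
      (auto intro: deriv nonneg continuous_on_subset[OF cont])
  then show ?thesis
    unfolding I image_UN img by (subst (1 2) *) (use inc1 inc2 in auto)
qed

abbreviation LB :: "nat set \<Rightarrow> (nat \<Rightarrow> real) measure"
  where "LB A \<equiv> (\<Pi>\<^sub>M i\<in>A. lborel)"

interpretation LB: product_sigma_finite "\<lambda>_::nat. lborel :: real measure"
  by standard

lemma sigma_finite_LB: "finite A \<Longrightarrow> sigma_finite_measure (LB A)"
  by (simp add: LB.sigma_finite)

lemma nn_integral_LB_swap:
  fixes N :: "'a measure"
  assumes "finite A" "sigma_finite_measure N" and "case_prod f \<in> borel_measurable (N \<Otimes>\<^sub>M LB A)"
  shows "(\<integral>\<^sup>+v. (\<integral>\<^sup>+s. f s v \<partial>N) \<partial>LB A) = (\<integral>\<^sup>+s. (\<integral>\<^sup>+v. f s v \<partial>LB A) \<partial>N)"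
  using assms by (intro pair_sigma_finite.Fubini' pair_sigma_finite.intro sigma_finite_LB)

text \<open>A diagonal linear map is a product of affine substitutions on the line, one for each
  coordinate. Restricting the scaled point to \<open>A\<close> keeps it in the space of the product
  measure.\<close>

lemma nn_integral_LB_scale:
  assumes "finite A" and "\<And>i. i \<in> A \<Longrightarrow> 0 < r i"
    and "F \<in> borel_measurable (LB A)"
  shows "(\<integral>\<^sup>+v. F v \<partial>LB A) = (\<integral>\<^sup>+v. F (\<lambda>i\<in>A. r i * v i) * ennreal (\<Prod>i\<in>A. r i) \<partial>LB A)"
  using assms
proof (induction A arbitrary: F rule: finite_induct)
  case empty
  have "(\<lambda>i\<in>{}. r i * v i) = (\<lambda>k. undefined)" for v :: "nat \<Rightarrow> real" by (simp add: restrict_def)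
  then show ?case by (simp add: PiM_empty nn_integral_count_space_finite)
next
  case (insert k A)
  note [measurable] = insert.prems(2)
  have [simp]: "finite A" by fact
  interpret sigma_finite_measure "LB A" by (rule sigma_finite_LB) fact
  have k: "0 < r k" "k \<notin> A" using insert by auto
  have upd: "(\<lambda>i\<in>A. r i * v i)(k := r k * s) = (\<lambda>i\<in>insert k A. r i * (v(k := s)) i)" for v s
    using k by (auto simp: fun_eq_iff)
  have pr: "(\<Prod>i\<in>A. r i) \<ge> 0" using insert.prems by (intro prod_nonneg) (auto simp: less_imp_le)
  define G where "G w = F (\<lambda>i\<in>insert k A. r i * w i)" for w
  have [measurable]: "G \<in> borel_measurable (LB (insert k A))" unfolding G_def by measurable
  have scaled: "(\<integral>\<^sup>+v. F (v(k := r k * s)) \<partial>LB A) = (\<integral>\<^sup>+v. G (v(k := s)) \<partial>LB A) * ennreal (\<Prod>i\<in>A. r i)" for s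
  proof -
    have m: "(\<lambda>v. F (v(k := r k * s))) \<in> borel_measurable (LB A)" by measurable
    have "(\<integral>\<^sup>+v. F (v(k := r k * s)) \<partial>LB A) = (\<integral>\<^sup>+v. G (v(k := s)) * ennreal (\<Prod>i\<in>A. r i) \<partial>LB A)"
      using insert.IH[OF insert.prems(1) m] by (simp only: upd G_def insertI2)
    then show ?thesis by (simp add: nn_integral_multc)
  qed
  have r: "ennreal (\<Prod>i\<in>insert k A. r i) = ennreal \<bar>r k\<bar> * ennreal (\<Prod>i\<in>A. r i)"
    using k pr by (simp add: ennreal_mult)
  have "(\<integral>\<^sup>+v. F v \<partial>LB (insert k A)) = (\<integral>\<^sup>+s. \<integral>\<^sup>+v. F (v(k := s)) \<partial>LB A \<partial>lborel)"
    using k by (intro LB.product_nn_integral_insert_rev) auto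
  also have "\<dots> = ennreal \<bar>r k\<bar> * (\<integral>\<^sup>+s. \<integral>\<^sup>+v. F (v(k := 0 + r k * s)) \<partial>LB A \<partial>lborel)"
    using k by (intro nn_integral_real_affine) auto
  also have "\<dots> = (\<integral>\<^sup>+s. \<integral>\<^sup>+v. G (v(k := s)) \<partial>LB A \<partial>lborel) * ennreal (\<Prod>i\<in>insert k A. r i)"
    by (simp only: add_0 scaled, subst nn_integral_multc) (measurable, simp only: r mult_ac)
  also have "\<dots> = (\<integral>\<^sup>+w. G w \<partial>LB (insert k A)) * ennreal (\<Prod>i\<in>insert k A. r i)"
    using k by (subst LB.product_nn_integral_insert_rev) auto
  also have "\<dots> = (\<integral>\<^sup>+w. G w * ennreal (\<Prod>i\<in>insert k A. r i) \<partial>LB (insert k A))"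
    by (simp add: nn_integral_multc)
  also have "\<dots> = (\<integral>\<^sup>+v. F (\<lambda>i\<in>insert k A. r i * v i) * ennreal (\<Prod>i\<in>insert k A. r i) \<partial>LB (insert k A))"
    by (simp only: G_def)
  finally show ?case .
qed

section \<open>Partial fractions\<close>

text \<open>
  For \<open>e = 1\<close> the \<open>y j\<close> are the \<open>n\<close> zeros of the numerator of the ratio; for \<open>e = 0\<close> the
  numerator has only the zeros \<open>y 2, \<dots>, y n\<close>, and \<open>y 1\<close> is its leading coefficient up to sign.
\<close>

definition ratio :: "'a::field \<Rightarrow> nat \<Rightarrow> (nat \<Rightarrow> 'a) \<Rightarrow> (nat \<Rightarrow> 'a) \<Rightarrow> 'a \<Rightarrow> 'a" where
  "ratio e n x y z = (y 1 - e * z) * (\<Prod>j\<in>{2..n}. y j - z) / (\<Prod>j\<in>{1..n}. x j - z)"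

text \<open>The coefficient of \<open>1 / (x i - z)\<close> in the partial fractions of
  \<open>ratio\<close>. Writing \<open>x i - z\<close> instead of \<open>z - x i\<close> makes all
  coefficients positive for interlacing zeros.\<close>

definition resid :: "'a::field \<Rightarrow> nat \<Rightarrow> (nat \<Rightarrow> 'a) \<Rightarrow> (nat \<Rightarrow> 'a) \<Rightarrow> nat \<Rightarrow> 'a" where
  "resid e n x y i =
     (y 1 - e * x i) * (\<Prod>j\<in>{2..n}. y j - x i) / (\<Prod>j\<in>{1..n} - {i}. x j - x i)"

lemma ratio_Suc:
  "1 \<le> n \<Longrightarrow> ratio e (Suc n) x y z = ratio e n x y z * (y (Suc n) - z) / (x (Suc n) - z)"
  by (simp add: ratio_def prod.nat_ivl_Suc')

lemma resid_Suc:
  assumes "1 \<le> n" "i \<in> {1..n}"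
  shows "resid e (Suc n) x y i = (y (Suc n) - x i) / (x (Suc n) - x i) * resid e n x y i"
proof -
  have "{1..Suc n} - {i} = insert (Suc n) ({1..n} - {i})" using assms by auto
  then show ?thesis using assms by (simp add: resid_def prod.nat_ivl_Suc')
qed

lemma resid_Suc_last:
  assumes "1 \<le> n"
  shows "resid e (Suc n) x y (Suc n) = (y (Suc n) - x (Suc n)) * ratio e n x y (x (Suc n))"
proof -
  have "{1..Suc n} - {Suc n} = {1..n}" by auto
  then show ?thesis using assms by (simp add: resid_def ratio_def prod.nat_ivl_Suc')
qed

text \<open>Induction over the poles: a new pole \<open>X\<close> and a new zero \<open>s\<close>
  multiply the ratio by \<open>(s - z) / (X - z)\<close>, which rescales the old residues and adds
  one. The constant \<open>e\<close> is the value of the ratio at infinity.\<close>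

lemma partial_fractions:
  assumes "1 \<le> n" "inj_on x {1..n}" "z \<notin> x ` {1..n}"
  shows "e + (\<Sum>i\<in>{1..n}. resid e n x y i / (x i - z)) = ratio e n x y z"
  using assms
proof (induction n arbitrary: z rule: nat_induct_at_least)
  case base
  then show ?case by (auto simp: resid_def ratio_def field_simps)
next
  case (Suc n)
  define s X v where "s = y (Suc n)" and "X = x (Suc n)" and "v = resid e n x y"
  have inj: "inj_on x {1..n}" using Suc.prems by (auto simp: inj_on_def)
  have X: "X \<notin> x ` {1..n}" by (auto simp: X_def dest!: inj_onD[OF Suc.prems(1)])
  have z: "X \<noteq> z" "z \<notin> x ` {1..n}" using Suc.prems(2) by (auto simp: X_def)
  \<comment> \<open>Partial fractions of \<open>(s - z) / ((X - z) * (x i - z))\<close> as a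
    function of \<open>z\<close>.\<close>
  have summand: "(s - x i) / (X - x i) * v i / (x i - z) + (s - X) / (X - z) * (v i / (x i - X)) =
      (s - z) / (X - z) * (v i / (x i - z))" if "i \<in> {1..n}" for i
  proof -
    have "x i - X \<noteq> 0" "x i - z \<noteq> 0" "X - z \<noteq> 0" "X - x i \<noteq> 0" using that X z by auto
    then show ?thesis by (simp add: divide_simps) (simp add: algebra_simps)
  qed
  have "e + (\<Sum>i\<in>{1..Suc n}. resid e (Suc n) x y i / (x i - z)) =
      e + (\<Sum>i\<in>{1..n}. (s - x i) / (X - x i) * v i / (x i - z)) +
      (s - X) * (e + (\<Sum>i\<in>{1..n}. v i / (x i - X))) / (X - z)"
    using Suc.IH[OF inj X] Suc.hyps by (simp add: resid_Suc resid_Suc_last s_def X_def v_def)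
  also have "\<dots> = (s - z) / (X - z) * e +
      (\<Sum>i\<in>{1..n}. (s - x i) / (X - x i) * v i / (x i - z) + (s - X) / (X - z) * (v i / (x i - X)))"
  proof -
    have "e + T + (s - X) * (e + U) / (X - z) = (s - z) / (X - z) * e + (T + (s - X) / (X - z) * U)" for T U
      using z by (simp add: divide_simps) (simp add: algebra_simps)
    then show ?thesis by (simp only: sum.distrib sum_distrib_left[symmetric])
  qed
  also have "\<dots> = (s - z) / (X - z) * (e + (\<Sum>i\<in>{1..n}. v i / (x i - z)))"
    using summand by (simp add: sum_distrib_left algebra_simps)
  also have "\<dots> = ratio e (Suc n) x y z"
    using Suc.IH[OF inj z(2)] Suc.hyps by (simp add: ratio_Suc s_def X_def v_def)
  finally show ?case .
qed

lemma recurrence_ratio: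
  fixes x y :: "nat \<Rightarrow> 'a::field"
  assumes n: "1 \<le> n" and inj: "inj_on x {1..n}" and z: "z \<notin> x ` {1..n}" and s: "s \<notin> x ` {1..n}"
    and sq: "\<And>i. i \<in> {1..n} \<Longrightarrow> 1 + x i ^ 2 \<noteq> 0"
    and v: "\<And>i. i \<in> {1..n} \<Longrightarrow> v i = (x i - s) / (1 + x i ^ 2) * resid 1 n x y i"
    and S: "S = (\<Sum>i\<in>{1..n}. v i)"
    and c: "c * (1 + S) = s + (\<Sum>i\<in>{1..n}. v i * (1 + x i ^ 2) / (x i - s)) - (\<Sum>i\<in>{1..n}. v i * x i)"
  shows "(1 + S) * (z - c) + (1 + z ^ 2) * (\<Sum>i\<in>{1..n}. v i / (x i - z)) = (z - s) * ratio 1 n x y z"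
proof -
  define r where "r = resid 1 n x y"
  have a: "v i * (1 + x i ^ 2) / (x i - s) = r i" if "i \<in> {1..n}" for i
    using sq[OF that] s that unfolding v[OF that] r_def by (auto simp: image_iff)
  have b: "S * z + (1 + z ^ 2) * (v i / (x i - z)) + v i * x i - r i = S * z - v i * z + (z - s) * (r i / (x i - z))"
    if "i \<in> {1..n}" for i
  proof -
    have ne: "x i - z \<noteq> 0" "x i - s \<noteq> 0" using z s that by auto
    have vi: "v i * (1 + x i ^ 2) = (x i - s) * r i" unfolding v[OF that] r_def using sq[OF that] by simp
    have "(1 + z ^ 2) * v i + v i * x i * (x i - z) - r i * (x i - z) + v i * z * (x i - z)
      = v i * (1 + x i ^ 2) - r i * (x i - z)" by algebra
    also have "\<dots> = (z - s) * r i" unfolding vi by algebra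
    finally show ?thesis using ne by (simp add: divide_simps) (simp add: algebra_simps)
  qed
  have "(1 + S) * (z - c) + (1 + z ^ 2) * (\<Sum>i\<in>{1..n}. v i / (x i - z)) =
    z - s + S * z + (\<Sum>i\<in>{1..n}. (1 + z ^ 2) * (v i / (x i - z)) + v i * x i - r i)"
    using c a by (simp add: sum.distrib sum_subtractf sum_distrib_left algebra_simps)
  also have "(\<Sum>i\<in>{1..n}. (1 + z ^ 2) * (v i / (x i - z)) + v i * x i - r i) =
    (\<Sum>i\<in>{1..n}. (z - s) * (r i / (x i - z)) - v i * z)"
    using b by (intro sum.cong) (auto simp: algebra_simps)
  also have "\<dots> = (z - s) * (\<Sum>i\<in>{1..n}. r i / (x i - z)) - S * z"
    by (simp add: sum_subtractf sum_distrib_left sum_distrib_right S)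
  finally have "(1 + S) * (z - c) + (1 + z ^ 2) * (\<Sum>i\<in>{1..n}. v i / (x i - z)) =
    (z - s) * (1 + (\<Sum>i\<in>{1..n}. r i / (x i - z)))"
    by (simp add: algebra_simps)
  then show ?thesis unfolding r_def using partial_fractions[OF n inj z, of 1 y] by simp
qed

section \<open>Exchanging a single real variable for a zero\<close>

lemma decreasing_less:
  fixes x :: "nat \<Rightarrow> real"
  assumes dec: "\<forall>i\<in>{1..<n}. x (Suc i) < x i" and "1 \<le> i" "i < j" "j \<le> n"
  shows "x j < x i"
  using assms(3,4)
proof (induction j rule: nat_less_induct)
  case (1 j)
  then obtain m where m: "j = Suc m" "i \<le> m" by (cases j) auto
  have "x (Suc m) < x m" using dec 1(3) m assms(2) by auto
  then show ?case using 1 m by (cases "i = m") fastforce+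
qed

lemma inj_on_decreasing:
  fixes x :: "nat \<Rightarrow> real"
  assumes "\<forall>i\<in>{1..<n}. x (Suc i) < x i"
  shows "inj_on x {1..n}"
proof (rule inj_onI)
  fix i j assume "i \<in> {1..n}" "j \<in> {1..n}" "x i = x j"
  then show "i = j" using decreasing_less[OF assms, of i j] decreasing_less[OF assms, of j i]
    by (cases i j rule: linorder_cases) auto
qed

text \<open>For fixed \<open>v\<close>, the argument of \<open>f\<close> on the right is the residue
  \<open>r\<close> at a new lowest pole \<open>X\<close> for which
  \<open>e + (\<Sum>i. v i / (x i - z)) + r / (X - z)\<close> vanishes at \<open>z = s\<close>. It
  increases from 0 at \<open>X\<close> to infinity at \<open>x n\<close>, so \<open>r\<close> can be
  exchanged for the zero between these two poles.\<close>

lemma nn_integral_new_residue: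
  fixes x v :: "nat \<Rightarrow> real" and f :: "real \<Rightarrow> ennreal" and e X :: real
  assumes n: "1 \<le> n" and e: "0 \<le> e" and X: "X < x n" and x: "\<And>i. i \<in> {1..n} \<Longrightarrow> x n \<le> x i"
    and v: "\<And>i. i \<in> {1..n} \<Longrightarrow> 0 < v i" and [measurable]: "f \<in> borel_measurable borel"
  shows "(\<integral>\<^sup>+r. f r * indicator {0<..} r \<partial>lborel) =
    (\<integral>\<^sup>+s. f ((s - X) * (e + (\<Sum>i\<in>{1..n}. v i / (x i - s)))) *
      ennreal (e + (\<Sum>i\<in>{1..n}. v i * (x i - X) / (x i - s)^2)) * indicator {X<..<x n} s \<partial>lborel)"
proof -
  define g where "g s = (s - X) * (e + (\<Sum>i\<in>{1..n}. v i / (x i - s)))" for s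
  define g' where "g' s = e + (\<Sum>i\<in>{1..n}. v i * (x i - X) / (x i - s)^2)" for s
  have [measurable]: "g \<in> borel_measurable borel" "g' \<in> borel_measurable borel"
    unfolding g_def g'_def by measurable
  have pos: "0 < x i - s" if "i \<in> {1..n}" "s < x n" for i s using x[OF that(1)] that(2) by simp
  have cont: "isCont g s" if "s < x n" for s
    unfolding g_def using pos[OF _ that] by (intro continuous_intros) force
  have vpos: "0 < e + (\<Sum>i\<in>{1..n}. v i / (x i - s))" if "s < x n" for s
    using n e v pos[OF _ that] by (intro add_nonneg_pos sum_pos divide_pos_pos) auto
  have "g ` einterval X (x n) = {0<..}"
  proof (intro subset_antisym subsetI)
    fix r assume "r \<in> g ` einterval X (x n)"
    then obtain s where "r = g s" "X < s" "s < x n" by (auto simp: einterval_def)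
    then show "r \<in> {0<..}" using vpos[of s] by (simp add: g_def)
  next
    fix r :: real assume "r \<in> {0<..}"
    then have r: "0 < r" by simp
    have vn: "0 < v n" using v n by simp
    \<comment> \<open>At relative distance \<open>\<delta>\<close> from \<open>x n\<close> the last
      summand alone already gives the value \<open>r\<close>; the other summands only increase
      \<open>g\<close>.\<close>
    define \<delta> where "\<delta> = v n / (v n + r)"
    have \<delta>: "0 < \<delta>" "\<delta> < 1" using r vn by (auto simp: \<delta>_def)
    define s where "s = x n - \<delta> * (x n - X)"
    have L: "0 < x n - X" using X by simp
    have sX: "s - X = (1 - \<delta>) * (x n - X)" and xs: "x n - s = \<delta> * (x n - X)"
      unfolding s_def by (simp_all add: algebra_simps)
    have "0 < s - X" "0 < x n - s" unfolding sX xs using \<delta> L by (auto intro: mult_pos_pos)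
    then have s: "X < s" "s < x n" by simp_all
    have "1 - \<delta> = r / (v n + r)" "v n / \<delta> = v n + r" using r vn by (simp_all add: \<delta>_def field_simps)
    then have "r = (1 - \<delta>) * (v n / \<delta>)" using r vn by simp
    also have "\<dots> = (s - X) * (v n / (x n - s))"
      using L \<delta> unfolding sX xs by simp
    also have "\<dots> \<le> g s" unfolding g_def
    proof (intro mult_left_mono)
      have "v n / (x n - s) \<le> (\<Sum>i\<in>{1..n}. v i / (x i - s))"
        using n v pos[OF _ s(2)] by (intro member_le_sum) (auto simp: less_imp_le)
      then show "v n / (x n - s) \<le> e + (\<Sum>i\<in>{1..n}. v i / (x i - s))" using e by simp
    qed (use s in simp)
    finally have "r \<le> g s" .
    moreover have "g X \<le> r" using r by (simp add: g_def)
    moreover have "continuous_on {X..s} g"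
      using cont s by (intro continuous_at_imp_continuous_on) auto
    ultimately obtain t where t: "X \<le> t" "t \<le> s" "g t = r" using IVT'[of g X r s] s by auto
    then have "t \<noteq> X" using r by (auto simp: g_def)
    then show "r \<in> g ` einterval X (x n)" using t s by (intro image_eqI[of _ _ t]) (auto simp: einterval_def)
  qed
  moreover have "(\<integral>\<^sup>+r. f r * indicator (g ` einterval X (x n)) r \<partial>lborel) =
    (\<integral>\<^sup>+s. f (g s) * ennreal (g' s) * indicator (einterval X (x n)) s \<partial>lborel)"
  proof (rule nn_integral_substitution_open_interval)
    fix s assume "s \<in> einterval X (x n)"
    then have s: "s < x n" by (simp add: einterval_def)
    have "X \<le> x i" if "i \<in> {1..n}" for i using X x[OF that] by simp
    then show "0 \<le> g' s" unfolding g'_def using e v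
      by (intro add_nonneg_nonneg sum_nonneg divide_nonneg_nonneg mult_nonneg_nonneg) (auto simp: less_imp_le)
    have ne: "x i - s \<noteq> 0" if "i \<in> {1..n}" for i using pos[OF that s] by simp
    have "(g has_real_derivative (e + (\<Sum>i\<in>{1..n}. v i / (x i - s))) +
      (\<Sum>i\<in>{1..n}. v i / (x i - s)^2) * (s - X)) (at s)"
      unfolding g_def using ne
      by (auto intro!: derivative_eq_intros sum.cong simp: power2_eq_square)
    \<comment> \<open>Combined over a common denominator, the derivative is visibly a sum of
      nonnegative terms.\<close>
    moreover have "(e + (\<Sum>i\<in>{1..n}. v i / (x i - s))) + (\<Sum>i\<in>{1..n}. v i / (x i - s)^2) * (s - X) = g' s"
    proof -
      have "v i / (x i - s) + v i / (x i - s)^2 * (s - X) = v i * (x i - X) / (x i - s)^2" if "i \<in> {1..n}" for i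
        using ne[OF that] by (simp add: divide_simps power2_eq_square) (simp add: algebra_simps)
      then show ?thesis unfolding g'_def by (simp add: sum_distrib_right add.assoc flip: sum.distrib)
    qed
    ultimately show "(g has_real_derivative g' s) (at s)" by simp
  next
    show "continuous_on (einterval X (x n)) g'"
      unfolding g'_def using pos by (intro continuous_intros) (force simp: einterval_def)
  qed (use X in auto)
  ultimately show ?thesis by (simp add: g_def g'_def einterval_eq)
qed

lemma nn_integral_shift:
  fixes x w :: "nat \<Rightarrow> real" and f :: "real \<Rightarrow> ennreal" and K S :: real
  assumes n: "1 \<le> n" and S: "0 < S" and x: "\<And>i. i \<in> {1..n} \<Longrightarrow> x n \<le> x i"
    and w: "\<And>i. i \<in> {1..n} \<Longrightarrow> 0 < w i" and [measurable]: "f \<in> borel_measurable borel"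
  shows "(\<integral>\<^sup>+c. f c \<partial>lborel) =
    (\<integral>\<^sup>+s. f ((s + (\<Sum>i\<in>{1..n}. w i / (x i - s)) - K) / S) *
      ennreal ((1 + (\<Sum>i\<in>{1..n}. w i / (x i - s)^2)) / S) * indicator {..<x n} s \<partial>lborel)"
proof -
  define g where "g s = (s + (\<Sum>i\<in>{1..n}. w i / (x i - s)) - K) / S" for s
  define g' where "g' s = (1 + (\<Sum>i\<in>{1..n}. w i / (x i - s)^2)) / S" for s
  have [measurable]: "g \<in> borel_measurable borel" "g' \<in> borel_measurable borel"
    unfolding g_def g'_def by measurable
  have pos: "0 < x i - s" if "i \<in> {1..n}" "s < x n" for i s using x[OF that(1)] that(2) by simp
  have cont: "isCont g s" if "s < x n" for s
    unfolding g_def using pos[OF _ that] S by (intro continuous_intros) force+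
  have "g ` einterval (-\<infinity>) (x n) = UNIV"
  proof (intro subset_antisym subsetI)
    fix r :: real
    define q where "q = r * S + K"
    have wn: "0 < w n" using w n by simp
    define W where "W = (\<Sum>i\<in>{1..n}. w i)"
    \<comment> \<open>At distance at least 1 from every pole the fractions sum to at most
      \<open>W\<close>, so \<open>s1 \<le> q - W\<close> makes the value at most
      \<open>r\<close>.\<close>
    define s1 where "s1 = min (x n - 1) (q - W)"
    \<comment> \<open>Close enough to \<open>x n\<close> for the last fraction to exceed
      \<open>\<bar>q\<bar> + \<bar>x n\<bar> + 1\<close>; the bound \<open>\<delta> \<le> 1\<close>
      limits how far the linear term drops below \<open>x n\<close>.\<close>
    define \<delta> where "\<delta> = min 1 (w n / (\<bar>q\<bar> + \<bar>x n\<bar> + 1))"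
    have \<delta>: "0 < \<delta>" "\<delta> \<le> 1" "\<delta> * (\<bar>q\<bar> + \<bar>x n\<bar> + 1) \<le> w n"
    proof -
      have D: "0 < \<bar>q\<bar> + \<bar>x n\<bar> + 1" by simp
      show "0 < \<delta>" "\<delta> \<le> 1" using wn D by (simp_all add: \<delta>_def)
      have "\<delta> \<le> w n / (\<bar>q\<bar> + \<bar>x n\<bar> + 1)" by (simp add: \<delta>_def)
      then show "\<delta> * (\<bar>q\<bar> + \<bar>x n\<bar> + 1) \<le> w n" using D by (simp only: pos_le_divide_eq)
    qed
    define s2 where "s2 = x n - \<delta>"
    have s: "s1 \<le> s2" "s2 < x n" "s1 < x n" using \<delta> by (auto simp: s1_def s2_def)
    have "(\<Sum>i\<in>{1..n}. w i / (x i - s1)) \<le> W" unfolding W_def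
    proof (rule sum_mono)
      fix i assume i: "i \<in> {1..n}"
      have "1 \<le> x i - s1" using x[OF i] by (simp add: s1_def)
      then show "w i / (x i - s1) \<le> w i" using w[OF i] by (simp add: divide_le_eq)
    qed
    then have "s1 + (\<Sum>i\<in>{1..n}. w i / (x i - s1)) \<le> q" by (simp add: s1_def)
    then have 1: "g s1 \<le> r" using S by (simp add: g_def q_def divide_le_eq)
    have "w n / \<delta> \<le> (\<Sum>i\<in>{1..n}. w i / (x i - s2))"
    proof -
      have "w n / (x n - s2) \<le> (\<Sum>i\<in>{1..n}. w i / (x i - s2))"
        using n w pos[OF _ s(2)] by (intro member_le_sum) (auto simp: less_imp_le)
      then show ?thesis by (simp add: s2_def)
    qed
    moreover have "\<bar>q\<bar> + \<bar>x n\<bar> + 1 \<le> w n / \<delta>" using \<delta> by (simp add: le_divide_eq mult.commute)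
    ultimately have "q \<le> s2 + (\<Sum>i\<in>{1..n}. w i / (x i - s2))" using \<delta> by (simp add: s2_def)
    then have 2: "r \<le> g s2" using S by (simp add: g_def q_def le_divide_eq)
    have "continuous_on {s1..s2} g"
      using cont s by (intro continuous_at_imp_continuous_on) auto
    then obtain t where t: "s1 \<le> t" "t \<le> s2" "g t = r" using IVT'[of g s1 r s2] s 1 2 by auto
    then show "r \<in> g ` einterval (-\<infinity>) (x n)" using s by (intro image_eqI[of _ _ t]) (auto simp: einterval_def)
  qed auto
  moreover have "(\<integral>\<^sup>+r. f r * indicator (g ` einterval (-\<infinity>) (x n)) r \<partial>lborel) =
    (\<integral>\<^sup>+s. f (g s) * ennreal (g' s) * indicator (einterval (-\<infinity>) (x n)) s \<partial>lborel)"
  proof (rule nn_integral_substitution_open_interval)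
    fix s assume "s \<in> einterval (-\<infinity>) (x n)"
    then have s: "s < x n" by (simp add: einterval_def)
    show "0 \<le> g' s" unfolding g'_def using S w
      by (intro add_nonneg_nonneg sum_nonneg divide_nonneg_nonneg) (auto simp: less_imp_le)
    have ne: "x i - s \<noteq> 0" if "i \<in> {1..n}" for i using pos[OF that s] by simp
    show "(g has_real_derivative g' s) (at s)"
      unfolding g_def g'_def using ne S
      by (auto intro!: derivative_eq_intros sum.cong simp: power2_eq_square)
  next
    show "continuous_on (einterval (-\<infinity>) (x n)) g'"
      unfolding g'_def using pos S by (intro continuous_intros) (force simp: einterval_def)+
  qed auto
  ultimately show ?thesis by (simp add: g_def g'_def einterval_eq)
qed

section \<open>Change of variables from residues to zeros\<close>

definition vand :: "nat \<Rightarrow> (nat \<Rightarrow> real) \<Rightarrow> real" where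
  "vand n x = (\<Prod>k\<in>{1..n}. \<Prod>j\<in>{1..<k}. \<bar>x j - x k\<bar>)"

text \<open>Interlacing in the form that an induction over the poles can extend, one pole and one
  zero at the lower end at a time. For \<open>e = 0\<close> the first condition says that the
  leading coefficient is positive.\<close>

definition slots :: "real \<Rightarrow> nat \<Rightarrow> (nat \<Rightarrow> real) \<Rightarrow> (nat \<Rightarrow> real) \<Rightarrow> bool" where
  "slots e n x y \<longleftrightarrow> e * x 1 < y 1 \<and> (\<forall>j\<in>{2..n}. x j < y j \<and> y j < x (j - 1))"

text \<open>Divided by \<open>vand n x\<close>, this is the Jacobian of the residues with respect to
  \<open>y\<close>. For \<open>e = 1\<close> it amounts to the Cauchy determinant: the derivative of
  residue \<open>i\<close> in \<open>y j\<close> is that residue divided by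
  \<open>y j - x i\<close>.\<close>

definition jac :: "real \<Rightarrow> nat \<Rightarrow> (nat \<Rightarrow> real) \<Rightarrow> real" where
  "jac e n y = (\<Prod>k\<in>{2..n}. (y 1 - e * y k) * (\<Prod>j\<in>{2..<k}. y j - y k))"

lemma ratio_cong: "(\<And>j. j \<in> {1..n} \<Longrightarrow> y j = y' j) \<Longrightarrow> 1 \<le> n \<Longrightarrow> ratio e n x y z = ratio e n x y' z"
  by (simp add: ratio_def)

lemma resid_cong: "(\<And>j. j \<in> {1..n} \<Longrightarrow> y j = y' j) \<Longrightarrow> 1 \<le> n \<Longrightarrow> resid e n x y i = resid e n x y' i"
  by (simp add: resid_def)

lemma jac_cong: "(\<And>j. j \<in> {1..n} \<Longrightarrow> y j = y' j) \<Longrightarrow> 1 \<le> n \<Longrightarrow> jac e n y = jac e n y'"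
  by (simp add: jac_def)

lemma slots_cong: "(\<And>j. j \<in> {1..n} \<Longrightarrow> y j = y' j) \<Longrightarrow> 1 \<le> n \<Longrightarrow> slots e n x y = slots e n x y'"
  by (simp add: slots_def)

lemma jac_Suc:
  "1 \<le> n \<Longrightarrow> jac e (Suc n) y = jac e n y * ((y 1 - e * y (Suc n)) * (\<Prod>j\<in>{2..n}. y j - y (Suc n)))"
  by (simp add: jac_def prod.nat_ivl_Suc' atLeastLessThanSuc_atLeastAtMost mult.commute)

lemma slots_Suc:
  "1 \<le> n \<Longrightarrow> slots e (Suc n) x y \<longleftrightarrow> slots e n x y \<and> x (Suc n) < y (Suc n) \<and> y (Suc n) < x n"
  by (auto simp: slots_def atLeastAtMostSuc_conv)

lemma vand_Suc: "vand (Suc n) x = vand n x * (\<Prod>j\<in>{1..n}. \<bar>x j - x (Suc n)\<bar>)"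
  by (simp add: vand_def prod.nat_ivl_Suc' atLeastLessThanSuc_atLeastAtMost mult.commute)

lemma vand_pos: "inj_on x {1..n} \<Longrightarrow> 0 < vand n x"
  unfolding vand_def by (intro prod_pos) (auto dest: inj_onD)

lemma slots_factor_pos:
  assumes dec: "\<forall>i\<in>{1..<n}. x (Suc i) < x i" and y: "slots e n x y" and e: "0 \<le> e" and s: "s < x n" and n: "1 \<le> n"
  shows "0 < y 1 - e * s" "\<And>j. j \<in> {2..n} \<Longrightarrow> 0 < y j - s" "\<And>j. j \<in> {1..n} \<Longrightarrow> 0 < x j - s"
proof -
  have le: "x n \<le> x j" if "j \<in> {1..n}" for j
    using decreasing_less[OF dec, of j n] that by (cases "j = n") auto
  then show x: "0 < x j - s" if "j \<in> {1..n}" for j using that s by force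
  have "e * s \<le> e * x 1" using x[of 1] n e by (intro mult_left_mono) auto
  then show "0 < y 1 - e * s" using y by (simp add: slots_def)
  fix j assume j: "j \<in> {2..n}"
  then have "x j < y j" using y by (simp add: slots_def)
  then show "0 < y j - s" using x[of j] j by simp
qed

lemma ratio_pos:
  assumes "\<forall>i\<in>{1..<n}. x (Suc i) < x i" "slots e n x y" "0 \<le> e" "s < x n" "1 \<le> n"
  shows "0 < ratio e n x y s"
  unfolding ratio_def using slots_factor_pos[OF assms] by (intro divide_pos_pos mult_pos_pos prod_pos)

lemma resid_pos:
  assumes "1 \<le> n" "\<forall>i\<in>{1..<n}. x (Suc i) < x i" "slots e n x y" "0 \<le> e" "i \<in> {1..n}"
  shows "0 < resid e n x y i"
  using assms
proof (induction n rule: nat_induct_at_least)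
  case base
  then show ?case by (simp add: resid_def slots_def)
next
  case (Suc n)
  have dec: "\<forall>i\<in>{1..<n}. x (Suc i) < x i" using Suc.prems by simp
  have sl: "slots e n x y" "x (Suc n) < y (Suc n)" "y (Suc n) < x n"
    using Suc.prems(2) Suc.hyps by (auto simp: slots_Suc)
  note pos = slots_factor_pos(3)[OF dec sl(1) Suc.prems(3) _ Suc.hyps]
  show ?case
  proof (cases "i = Suc n")
    case True
    then show ?thesis using sl Suc.hyps ratio_pos[OF dec sl(1) Suc.prems(3) _ Suc.hyps, of "x (Suc n)"]
      by (simp add: resid_Suc_last)
  next
    case False
    then have i: "i \<in> {1..n}" using Suc.prems(4) by auto
    have "0 < (y (Suc n) - x i) / (x (Suc n) - x i)"
      using pos[of "y (Suc n)" i] pos[of "x (Suc n)" i] i sl by (intro divide_neg_neg) auto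
    then show ?thesis
      using mult_pos_pos[OF _ Suc.IH[OF dec sl(1) Suc.prems(3) i]] i Suc.hyps by (simp only: resid_Suc)
  qed
qed

lemma jac_pos:
  assumes "1 \<le> n" "\<forall>i\<in>{1..<n}. x (Suc i) < x i" "slots e n x y" "0 \<le> e"
  shows "0 < jac e n y"
  using assms
proof (induction n rule: nat_induct_at_least)
  case base
  then show ?case by (simp add: jac_def)
next
  case (Suc n)
  have dec: "\<forall>i\<in>{1..<n}. x (Suc i) < x i" using Suc.prems by simp
  have sl: "slots e n x y" "y (Suc n) < x n"
    using Suc.prems(2) Suc.hyps by (auto simp: slots_Suc)
  show ?case unfolding jac_Suc[OF Suc.hyps]
    using slots_factor_pos(1,2)[OF dec sl(1) Suc.prems(3) sl(2) Suc.hyps] Suc.IH[OF dec sl(1) Suc.prems(3)]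
    by (intro mult_pos_pos prod_pos)
qed

lemma measurable_resid [measurable]:
  fixes x :: "nat \<Rightarrow> real"
  shows "(\<And>j. j \<in> {1..n} \<Longrightarrow> (\<lambda>w. Y w j) \<in> borel_measurable N) \<Longrightarrow> 1 \<le> n \<Longrightarrow>
    (\<lambda>w. resid e n x (Y w) i) \<in> borel_measurable N"
  unfolding resid_def by (intro borel_measurable_divide borel_measurable_times borel_measurable_prod
      borel_measurable_diff borel_measurable_const) auto

lemma measurable_jac [measurable]:
  "(\<And>j. j \<in> {1..n} \<Longrightarrow> (\<lambda>w. Y w j) \<in> borel_measurable N) \<Longrightarrow> 1 \<le> n \<Longrightarrow>
    (\<lambda>w. jac e n (Y w)) \<in> borel_measurable N"
  unfolding jac_def by (intro borel_measurable_times borel_measurable_prod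
      borel_measurable_diff borel_measurable_const) auto

lemma pred_slots [measurable]:
  "(\<And>j. j \<in> {1..n} \<Longrightarrow> (\<lambda>w. Y w j) \<in> borel_measurable N) \<Longrightarrow> 1 \<le> n \<Longrightarrow>
    Measurable.pred N (\<lambda>w. slots e n x (Y w))"
  unfolding slots_def by (intro pred_intros_logic pred_intros_finite borel_measurable_pred_less) auto

text \<open>
  The map \<open>\<sigma>\<close> only renames the coordinates of \<open>y\<close>; it is the identity for \<open>e = 1\<close> and
  \<open>j \<mapsto> j - 1\<close> for \<open>e = 0\<close>, where the leading coefficient gets index \<open>0\<close>. In the induction
  step the last residue is traded for the last zero \<open>s\<close>; the other residues are then rescaled
  by \<open>(s - x i) / (X - x i)\<close>, which removes the pole at \<open>X\<close> and the zero at \<open>s\<close>.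
\<close>

lemma nn_integral_residues:
  fixes x :: "nat \<Rightarrow> real" and \<sigma> :: "nat \<Rightarrow> nat"
  assumes "1 \<le> n" and "0 \<le> e" and "\<forall>i\<in>{1..<n}. x (Suc i) < x i" and "inj_on \<sigma> {1..n}"
    and "F \<in> borel_measurable (LB {1..n})"
  shows "(\<integral>\<^sup>+v. F v * indicator {v. \<forall>i\<in>{1..n}. 0 < v i} v \<partial>LB {1..n}) =
    (\<integral>\<^sup>+y. F (\<lambda>i\<in>{1..n}. resid e n x (y \<circ> \<sigma>) i) * ennreal (jac e n (y \<circ> \<sigma>) / vand n x) *
      indicator {y. slots e n x (y \<circ> \<sigma>)} y \<partial>LB (\<sigma> ` {1..n}))"
  using assms
proof (induction n arbitrary: F rule: nat_induct_at_least)
  case base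
  note [measurable] = base.prems(4)
  \<comment> \<open>With one pole the residue is \<open>y 1 - e * x 1\<close>, so the substitution
    is a translation.\<close>
  define f where "f r = F (\<lambda>i\<in>{1..1}. r)" for r :: real
  have [measurable]: "f \<in> borel_measurable borel" unfolding f_def by measurable
  have 1: "F v = f (v 1)" if "v \<in> space (LB {1..1})" for v
    unfolding f_def using that by (intro arg_cong[of _ _ F]) (auto simp: space_PiM PiE_def extensional_def fun_eq_iff)
  have "(\<integral>\<^sup>+v. F v * indicator {v. \<forall>i\<in>{1..1}. 0 < v i} v \<partial>LB {1..1}) =
    (\<integral>\<^sup>+v. (\<lambda>r. f r * indicator {0<..} r) (v 1) \<partial>LB {1})"
    unfolding atLeastAtMost_singleton using 1 by (intro nn_integral_cong) (auto split: split_indicator)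
  also have "\<dots> = (\<integral>\<^sup>+r. f r * indicator {0<..} r \<partial>lborel)"
    by (intro LB.product_nn_integral_singleton) auto
  also have "\<dots> = (\<integral>\<^sup>+t. f (- (e * x 1) + 1 * t) * indicator {0<..} (- (e * x 1) + 1 * t) \<partial>lborel)"
    by (subst nn_integral_real_affine[where c = 1 and t = "- (e * x 1)"]) auto
  also have "\<dots> = (\<integral>\<^sup>+y. (\<lambda>t. f (- (e * x 1) + 1 * t) * indicator {0<..} (- (e * x 1) + 1 * t)) (y (\<sigma> 1)) \<partial>LB {\<sigma> 1})"
    by (intro LB.product_nn_integral_singleton[symmetric]) auto
  also have "\<dots> = (\<integral>\<^sup>+y. F (\<lambda>i\<in>{1..1}. resid e 1 x (y \<circ> \<sigma>) i) * ennreal (jac e 1 (y \<circ> \<sigma>) / vand 1 x) *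
      indicator {y. slots e 1 x (y \<circ> \<sigma>)} y \<partial>LB (\<sigma> ` {1..1}))"
    unfolding f_def by (auto intro!: nn_integral_cong arg_cong[of _ _ F] simp: resid_def jac_def vand_def slots_def
      fun_eq_iff split: split_indicator)
  finally show ?case .
next
  case (Suc n)
  note n = \<open>1 \<le> n\<close>
  note [measurable] = Suc.prems(4)
  define X where "X = x (Suc n)"
  define k where "k = \<sigma> (Suc n)"
  have dec: "\<forall>i\<in>{1..<n}. x (Suc i) < x i" and X: "X < x n"
    using Suc.prems(2) n by (auto simp: X_def)
  have inj: "inj_on \<sigma> {1..n}" using Suc.prems(3) by (auto simp: inj_on_def)
  have k: "k \<notin> \<sigma> ` {1..n}" by (auto simp: k_def dest!: inj_onD[OF Suc.prems(3)])
  have ins: "{1..Suc n} = insert (Suc n) {1..n}" "\<sigma> ` {1..Suc n} = insert k (\<sigma> ` {1..n})"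
    by (auto simp: k_def atLeastAtMostSuc_conv)
  have Un_ins: "{1..Suc n} = {1..n} \<union> {Suc n}" by auto
  have xn: "x n \<le> x i" if "i \<in> {1..n}" for i
    using decreasing_less[OF dec, of i n] that by (cases "i = n") auto
  have inj_x: "inj_on x {1..n}" by (rule inj_on_decreasing[OF dec])
  define P where "P = {v :: nat \<Rightarrow> real. \<forall>i\<in>{1..n}. 0 < v i}"
  have indP: "indicator P = (\<lambda>v. if \<forall>i\<in>{1..n}. 0 < v i then 1 else 0 :: ennreal)"
    by (auto simp: P_def split: split_indicator)
  have [measurable]: "(indicator P :: _ \<Rightarrow> ennreal) \<in> borel_measurable (LB {1..n})" unfolding indP by measurable
  \<comment> \<open>\<open>G s v\<close> is the last residue that puts a zero at \<open>s\<close>,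
    given the other residues \<open>v\<close>; \<open>G'\<close> is its derivative in
    \<open>s\<close>.\<close>
  define G where "G s v = (s - X) * (e + (\<Sum>i\<in>{1..n}. v i / (x i - s)))" for s and v :: "nat \<Rightarrow> real"
  define G' where "G' s v = e + (\<Sum>i\<in>{1..n}. v i * (x i - X) / (x i - s)^2)" for s and v :: "nat \<Rightarrow> real"
  have [measurable]: "(\<lambda>p. G (fst p) (snd p)) \<in> borel_measurable (lborel \<Otimes>\<^sub>M LB {1..n})"
    "(\<lambda>p. G' (fst p) (snd p)) \<in> borel_measurable (lborel \<Otimes>\<^sub>M LB {1..n})"
    unfolding G_def G'_def by measurable
  define K where "K s v = F (v(Suc n := G s v)) * ennreal (G' s v) * indicator {X<..<x n} s * indicator P v" for s v
  have [measurable]: "(\<lambda>p. (snd p)(Suc n := G (fst p) (snd p))) \<in> measurable (lborel \<Otimes>\<^sub>M LB {1..n}) (LB {1..Suc n})"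
    by (rule measurable_fun_upd[OF Un_ins]) measurable
  have measK: "case_prod K \<in> borel_measurable (lborel \<Otimes>\<^sub>M LB {1..n})"
    unfolding K_def split_beta' by measurable
  have meas1: "(\<lambda>v. F v * indicator {v. \<forall>i\<in>{1..Suc n}. 0 < v i} v) \<in> borel_measurable (LB {1..Suc n})"
    by measurable
  have [measurable]: "(\<lambda>y. (y \<circ> \<sigma>) j) \<in> borel_measurable (LB (\<sigma> ` {1..Suc n}))" if "j \<in> {1..Suc n}" for j
    using that by simp
  have meas2: "(\<lambda>y. F (\<lambda>i\<in>{1..Suc n}. resid e (Suc n) x (y \<circ> \<sigma>) i) * ennreal (jac e (Suc n) (y \<circ> \<sigma>) / vand (Suc n) x) *
      indicator {y. slots e (Suc n) x (y \<circ> \<sigma>)} y) \<in> borel_measurable (LB (\<sigma> ` {1..Suc n}))"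
    by measurable
  have "(\<integral>\<^sup>+v. F v * indicator {v. \<forall>i\<in>{1..Suc n}. 0 < v i} v \<partial>LB {1..Suc n}) =
    (\<integral>\<^sup>+v. \<integral>\<^sup>+r. F (v(Suc n := r)) * indicator {v. \<forall>i\<in>{1..Suc n}. 0 < v i} (v(Suc n := r)) \<partial>lborel \<partial>LB {1..n})"
    unfolding ins(1) by (intro LB.product_nn_integral_insert meas1[unfolded ins(1)]) auto
  also have "\<dots> = (\<integral>\<^sup>+v. \<integral>\<^sup>+s. K s v \<partial>lborel \<partial>LB {1..n})"
  proof (rule nn_integral_cong)
    fix v :: "nat \<Rightarrow> real" assume v: "v \<in> space (LB {1..n})"
    have "(\<lambda>r. v(Suc n := r)) \<in> measurable lborel (LB {1..Suc n})"
      unfolding ins(1) by (rule measurable_component_update[OF v]) auto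
    then have fm: "(\<lambda>r. F (v(Suc n := r))) \<in> borel_measurable borel" by measurable
    show "(\<integral>\<^sup>+r. F (v(Suc n := r)) * indicator {v. \<forall>i\<in>{1..Suc n}. 0 < v i} (v(Suc n := r)) \<partial>lborel) = (\<integral>\<^sup>+s. K s v \<partial>lborel)"
    proof (cases "v \<in> P")
      case False
      then have z: "indicator {v. \<forall>i\<in>{1..Suc n}. 0 < v i} (v(Suc n := r)) = (0 :: ennreal)" for r
        unfolding ins(1) by (auto simp: P_def split: split_indicator)
      show ?thesis unfolding z K_def using False by simp
    next
      case True
      then have v: "0 < v i" if "i \<in> {1..n}" for i using that by (simp add: P_def)
      have "(\<integral>\<^sup>+r. F (v(Suc n := r)) * indicator {v. \<forall>i\<in>{1..Suc n}. 0 < v i} (v(Suc n := r)) \<partial>lborel) =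
        (\<integral>\<^sup>+r. F (v(Suc n := r)) * indicator {0<..} r \<partial>lborel)"
        unfolding ins(1) using v by (intro nn_integral_cong) (auto split: split_indicator)
      also have "\<dots> = (\<integral>\<^sup>+s. F (v(Suc n := G s v)) * ennreal (G' s v) * indicator {X<..<x n} s \<partial>lborel)"
        unfolding G_def G'_def using n Suc.prems(1) X xn v by (intro nn_integral_new_residue fm) auto
      finally show ?thesis using True by (simp add: K_def)
    qed
  qed
  also have "\<dots> = (\<integral>\<^sup>+s. \<integral>\<^sup>+v. K s v \<partial>LB {1..n} \<partial>lborel)"
    by (intro nn_integral_LB_swap lborel.sigma_finite_measure_axioms measK) simp
  also have "\<dots> = (\<integral>\<^sup>+s. \<integral>\<^sup>+y. (\<lambda>y. F (\<lambda>i\<in>{1..Suc n}. resid e (Suc n) x (y \<circ> \<sigma>) i) * ennreal (jac e (Suc n) (y \<circ> \<sigma>) / vand (Suc n) x) *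
      indicator {y. slots e (Suc n) x (y \<circ> \<sigma>)} y) (y(k := s)) \<partial>LB (\<sigma> ` {1..n}) \<partial>lborel)"
  proof (rule nn_integral_cong)
    fix s :: real
    have upd: "((y(k := s)) \<circ> \<sigma>) j = (y \<circ> \<sigma>) j" if "j \<in> {1..n}" for y j
      using k that by auto
    have upd': "((y(k := s)) \<circ> \<sigma>) (Suc n) = s" for y by (simp add: k_def)
    have slots_upd: "slots e (Suc n) x (y(k := s) \<circ> \<sigma>) \<longleftrightarrow> slots e n x (y \<circ> \<sigma>) \<and> X < s \<and> s < x n" for y
    proof -
      have "slots e n x (y(k := s) \<circ> \<sigma>) = slots e n x (y \<circ> \<sigma>)" by (intro slots_cong upd n)
      then show ?thesis unfolding slots_Suc[OF n] upd' X_def by blast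
    qed
    show "(\<integral>\<^sup>+v. K s v \<partial>LB {1..n}) = (\<integral>\<^sup>+y. (\<lambda>y. F (\<lambda>i\<in>{1..Suc n}. resid e (Suc n) x (y \<circ> \<sigma>) i) * ennreal (jac e (Suc n) (y \<circ> \<sigma>) / vand (Suc n) x) *
      indicator {y. slots e (Suc n) x (y \<circ> \<sigma>)} y) (y(k := s)) \<partial>LB (\<sigma> ` {1..n}))"
    proof (cases "X < s \<and> s < x n")
      case False
      then show ?thesis by (auto simp: K_def slots_upd)
    next
      case True
      then have s: "X < s" "s < x n" by auto
      define r where "r i = (s - x i) / (X - x i)" for i
      have neg: "s - x i < 0" "X - x i < 0" if "i \<in> {1..n}" for i using xn[OF that] s by auto
      have r: "0 < r i" if "i \<in> {1..n}" for i unfolding r_def using neg[OF that] by (rule divide_neg_neg)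
      have rP: "0 \<le> (\<Prod>i\<in>{1..n}. r i)" using r by (intro prod_nonneg) (auto simp: less_imp_le)
      \<comment> \<open>Here \<open>v\<close> holds the residues of the smaller ratio. The argument
        of \<open>F\<close> rebuilds the residues after the pole \<open>X\<close> and the zero
        \<open>s\<close> are added; the last factor is \<open>G'\<close> times the scaling
        Jacobian.\<close>
      define F' where "F' v = F ((\<lambda>i\<in>{1..n}. r i * v i)(Suc n := (s - X) * (e + (\<Sum>i\<in>{1..n}. v i / (x i - X))))) *
        ennreal ((e + (\<Sum>i\<in>{1..n}. v i / (x i - s))) * (\<Prod>i\<in>{1..n}. r i))" for v :: "nat \<Rightarrow> real"
      have [measurable]: "(\<lambda>v. (\<lambda>i\<in>{1..n}. r i * v i)(Suc n := (s - X) * (e + (\<Sum>i\<in>{1..n}. v i / (x i - X)))))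
        \<in> measurable (LB {1..n}) (LB {1..Suc n})"
        by (rule measurable_fun_upd[OF Un_ins]) measurable
      have measF': "F' \<in> borel_measurable (LB {1..n})" unfolding F'_def by measurable
      have K_scale: "K s (\<lambda>i\<in>{1..n}. r i * v i) * ennreal (\<Prod>i\<in>{1..n}. r i) = F' v * indicator P v" for v
      proof -
        have P: "(\<lambda>i\<in>{1..n}. r i * v i) \<in> P \<longleftrightarrow> v \<in> P"
        proof -
          have "0 < r i * v i \<longleftrightarrow> 0 < v i" if "i \<in> {1..n}" for i using r[OF that] by (simp add: zero_less_mult_iff)
          then show ?thesis by (simp add: P_def)
        qed
        \<comment> \<open>The scaling moves the pole from \<open>s\<close> to \<open>X\<close> in
          \<open>G\<close>, and turns \<open>G'\<close> into the value at \<open>s\<close> of the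
          smaller ratio.\<close>
        have "r i * v i / (x i - s) = v i / (x i - X)" "r i * v i * (x i - X) / (x i - s)^2 = v i / (x i - s)"
          if "i \<in> {1..n}" for i unfolding r_def using neg[OF that]
          by (simp_all add: divide_simps power2_eq_square) (simp_all add: algebra_simps)
        then have "G s (\<lambda>i\<in>{1..n}. r i * v i) = (s - X) * (e + (\<Sum>i\<in>{1..n}. v i / (x i - X)))"
          "G' s (\<lambda>i\<in>{1..n}. r i * v i) = e + (\<Sum>i\<in>{1..n}. v i / (x i - s))"
          by (simp_all add: G_def G'_def)
        then show ?thesis using s rP P
          by (simp add: K_def F'_def ennreal_mult'' mult.assoc split: split_indicator)
      qed
      have "(\<integral>\<^sup>+v. K s v \<partial>LB {1..n}) = (\<integral>\<^sup>+v. F' v * indicator P v \<partial>LB {1..n})"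
      proof -
        have "K s \<in> borel_measurable (LB {1..n})"
          using measurable_compose_Pair1[OF _ measK, of s] by simp
        from nn_integral_LB_scale[of "{1..n}" r "K s", OF finite_atLeastAtMost r this]
        show ?thesis unfolding K_scale .
      qed
      also have "\<dots> = (\<integral>\<^sup>+y. F' (\<lambda>i\<in>{1..n}. resid e n x (y \<circ> \<sigma>) i) * ennreal (jac e n (y \<circ> \<sigma>) / vand n x) *
          indicator {y. slots e n x (y \<circ> \<sigma>)} y \<partial>LB (\<sigma> ` {1..n}))"
        unfolding P_def using Suc.prems(1) dec inj measF' by (intro Suc.IH)
      also have "\<dots> = (\<integral>\<^sup>+y. (\<lambda>y. F (\<lambda>i\<in>{1..Suc n}. resid e (Suc n) x (y \<circ> \<sigma>) i) * ennreal (jac e (Suc n) (y \<circ> \<sigma>) / vand (Suc n) x) *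
        indicator {y. slots e (Suc n) x (y \<circ> \<sigma>)} y) (y(k := s)) \<partial>LB (\<sigma> ` {1..n}))"
      proof (rule nn_integral_cong)
        fix y :: "nat \<Rightarrow> real"
        let ?y = "y(k := s) \<circ> \<sigma>"
        show "F' (\<lambda>i\<in>{1..n}. resid e n x (y \<circ> \<sigma>) i) * ennreal (jac e n (y \<circ> \<sigma>) / vand n x) *
          indicator {y. slots e n x (y \<circ> \<sigma>)} y =
         (\<lambda>y. F (\<lambda>i\<in>{1..Suc n}. resid e (Suc n) x (y \<circ> \<sigma>) i) * ennreal (jac e (Suc n) (y \<circ> \<sigma>) / vand (Suc n) x) *
        indicator {y. slots e (Suc n) x (y \<circ> \<sigma>)} y) (y(k := s))"
        proof (cases "slots e n x (y \<circ> \<sigma>)")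
          case False
          then show ?thesis by (simp add: slots_upd)
        next
          case sl: True
          have y: "resid e n x ?y i = resid e n x (y \<circ> \<sigma>) i" "ratio e n x ?y z = ratio e n x (y \<circ> \<sigma>) z"
            "jac e n ?y = jac e n (y \<circ> \<sigma>)" for i z
            by (rule resid_cong ratio_cong jac_cong, erule upd, rule n)+
          have notin: "X \<notin> x ` {1..n}" "s \<notin> x ` {1..n}" using neg by fastforce+
          have "(\<lambda>i\<in>{1..Suc n}. resid e (Suc n) x ?y i) =
            (\<lambda>i\<in>{1..n}. r i * (\<lambda>i\<in>{1..n}. resid e n x (y \<circ> \<sigma>) i) i)
             (Suc n := (s - X) * (e + (\<Sum>i\<in>{1..n}. (\<lambda>i\<in>{1..n}. resid e n x (y \<circ> \<sigma>) i) i / (x i - X))))"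
          proof
            fix i
            consider "i \<in> {1..n}" | "i = Suc n" | "i \<notin> {1..Suc n}" by fastforce
            then show "(\<lambda>i\<in>{1..Suc n}. resid e (Suc n) x ?y i) i =
            ((\<lambda>i\<in>{1..n}. r i * (\<lambda>i\<in>{1..n}. resid e n x (y \<circ> \<sigma>) i) i)
             (Suc n := (s - X) * (e + (\<Sum>i\<in>{1..n}. (\<lambda>i\<in>{1..n}. resid e n x (y \<circ> \<sigma>) i) i / (x i - X))))) i"
            proof cases
              case 1
              then show ?thesis using resid_Suc[OF n 1, of e x ?y] unfolding upd' y(1) by (simp add: r_def X_def)
            next
              case 2
              then show ?thesis using resid_Suc_last[OF n, of e x ?y] unfolding upd' y(2)
                by (simp add: partial_fractions[OF n inj_x notin(1), symmetric] flip: X_def)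
            qed auto
          qed
          moreover have "ennreal ((e + (\<Sum>i\<in>{1..n}. (\<lambda>i\<in>{1..n}. resid e n x (y \<circ> \<sigma>) i) i / (x i - s))) * (\<Prod>i\<in>{1..n}. r i)) *
            ennreal (jac e n (y \<circ> \<sigma>) / vand n x) = ennreal (jac e (Suc n) ?y / vand (Suc n) x)"
          proof -
            have pf: "e + (\<Sum>i\<in>{1..n}. (\<lambda>i\<in>{1..n}. resid e n x (y \<circ> \<sigma>) i) i / (x i - s)) = ratio e n x (y \<circ> \<sigma>) s"
              using partial_fractions[OF n inj_x notin(2), of e "y \<circ> \<sigma>"] by simp
            \<comment> \<open>The Jacobian factors of this step telescope: the scaling and the new
              factors of \<open>vand\<close> combine to the denominator of the ratio at
              \<open>s\<close>, and its numerator is what \<open>jac\<close> gains.\<close>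
            have "ratio e n x (y \<circ> \<sigma>) s * (\<Prod>i\<in>{1..n}. r i) * (\<Prod>i\<in>{1..n}. \<bar>x i - X\<bar>) =
               ratio e n x (y \<circ> \<sigma>) s * (\<Prod>i\<in>{1..n}. x i - s)"
            proof -
              have "r i * \<bar>x i - X\<bar> = x i - s" if "i \<in> {1..n}" for i
                using neg[OF that] unfolding r_def by (simp add: divide_simps) (simp add: algebra_simps)
              then show ?thesis by (simp add: mult.assoc flip: prod.distrib)
            qed
            also have "\<dots> = ((y \<circ> \<sigma>) 1 - e * s) * (\<Prod>j\<in>{2..n}. (y \<circ> \<sigma>) j - s)"
            proof -
              have "(\<Prod>i\<in>{1..n}. x i - s) \<noteq> 0" using notin(2) by force
              from nonzero_eq_divide_eq[OF this, THEN iffD1, OF refl] show ?thesis unfolding ratio_def .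
            qed
            also have "\<dots> = (?y 1 - e * ?y (Suc n)) * (\<Prod>j\<in>{2..n}. ?y j - ?y (Suc n))"
              using upd upd' n by (simp del: comp_apply fun_upd_apply)
            finally have "ratio e n x (y \<circ> \<sigma>) s * (\<Prod>i\<in>{1..n}. r i) * (jac e n (y \<circ> \<sigma>) / vand n x) * (\<Prod>i\<in>{1..n}. \<bar>x i - X\<bar>) =
              jac e (Suc n) ?y / vand n x"
              by (simp add: jac_Suc[OF n] y(3) mult_ac del: comp_apply fun_upd_apply)
            moreover have "(\<Prod>i\<in>{1..n}. \<bar>x i - X\<bar>) \<noteq> 0" using notin(1) by force
            ultimately have "ratio e n x (y \<circ> \<sigma>) s * (\<Prod>i\<in>{1..n}. r i) * (jac e n (y \<circ> \<sigma>) / vand n x) =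
              jac e (Suc n) ?y / vand (Suc n) x"
              by (simp only: vand_Suc X_def[symmetric] divide_divide_eq_left[symmetric] nonzero_eq_divide_eq not_False_eq_True)
            moreover have "0 \<le> jac e n (y \<circ> \<sigma>) / vand n x"
              using jac_pos[OF n dec sl Suc.prems(1)] vand_pos[OF inj_x] by simp
            ultimately show ?thesis unfolding pf by (simp add: ennreal_mult''[symmetric])
          qed
          ultimately show ?thesis using sl s by (simp add: F'_def slots_upd mult.assoc)
        qed
      qed
      finally show ?thesis .
    qed
  qed
  also have "\<dots> = (\<integral>\<^sup>+y. F (\<lambda>i\<in>{1..Suc n}. resid e (Suc n) x (y \<circ> \<sigma>) i) * ennreal (jac e (Suc n) (y \<circ> \<sigma>) / vand (Suc n) x) *
      indicator {y. slots e (Suc n) x (y \<circ> \<sigma>)} y \<partial>LB (\<sigma> ` {1..Suc n}))"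
    unfolding ins(2) using k by (intro LB.product_nn_integral_insert_rev[symmetric] meas2[unfolded ins(2)]) auto
  finally show ?case .
qed

section \<open>Cauchy weights and the recurrence\<close>

lemma Im_Ln_one_plus_ix: "Im (Ln (1 + \<i> * of_real x)) = arctan x"
proof -
  have "1 + \<i> * of_real x \<noteq> 0" by (simp add: complex_eq_iff)
  then show ?thesis using Arg_eq_Im_Ln arg_conv_arctan[of "1 + \<i> * of_real x"] by simp
qed

text \<open>The second factor is the conjugate of the first, so the weight is the squared modulus of
  \<open>(1 + \<i> * x) powr (- a)\<close>. In exponential form, products of weights become sums of
  logarithms.\<close>

lemma cauchy_weight_eq_exp: "cauchy_weight a x = exp (- 2 * Re (a * Ln (1 + \<i> * of_real x)))"
proof -
  define z where "z = 1 + \<i> * complex_of_real x"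
  have z: "z \<noteq> 0" "Re z > 0" by (simp_all add: z_def complex_eq_iff)
  have cz: "cnj z = 1 - \<i> * complex_of_real x" by (simp add: z_def)
  have nz: "z \<notin> \<real>\<^sub>\<le>\<^sub>0" using z(2) by (auto simp: complex_nonpos_Reals_iff)
  have "cnj z powr (- cnj a) = cnj (z powr (- a))"
    using z nz by (simp add: powr_def cnj_Ln exp_cnj)
  then have "cauchy_weight a x = (cmod (z powr (- a)))\<^sup>2"
    unfolding cauchy_weight_def z_def[symmetric] cz[symmetric] by (simp add: complex_norm_square[symmetric] flip: of_real_power)
  also have "\<dots> = exp (Re (- a * Ln z)) ^ 2" using z by (simp add: powr_def)
  also have "\<dots> = exp (- 2 * Re (a * Ln z))" by (simp add: power2_eq_square flip: exp_add)
  finally show ?thesis by (simp add: z_def)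
qed

lemma cauchy_weight_pos: "0 < cauchy_weight a x"
  by (simp add: cauchy_weight_eq_exp)

lemma borel_measurable_cauchy_weight [measurable]: "cauchy_weight a \<in> borel_measurable borel"
proof -
  have "isCont (\<lambda>x. exp (- 2 * Re (a * Ln (1 + \<i> * of_real x)))) x" for x
    by (intro continuous_intros) (auto simp: complex_nonpos_Reals_iff)
  then show ?thesis unfolding cauchy_weight_eq_exp[abs_def]
    by (intro borel_measurable_continuous_onI continuous_at_imp_continuous_on) auto
qed

text \<open>The base has squared modulus \<open>1 + x\<^sup>2\<close>, and a real shift of the
  exponent affects the modulus alone.\<close>

lemma cauchy_weight_add_of_real:
  "cauchy_weight (a + of_real t) x = cauchy_weight a x * (1 + x\<^sup>2) powr (- t)"
proof -
  have "cmod (1 + \<i> * of_real x) = sqrt (1 + x\<^sup>2)" by (simp add: cmod_def)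
  moreover have "1 + \<i> * of_real x \<noteq> 0" by (simp add: complex_eq_iff)
  moreover have "0 < 1 + x\<^sup>2" by (simp add: add_pos_nonneg)
  ultimately have "Re (Ln (1 + \<i> * of_real x)) = ln (1 + x\<^sup>2) / 2" by (simp add: ln_sqrt)
  with \<open>0 < 1 + x\<^sup>2\<close> show ?thesis
    by (simp add: cauchy_weight_eq_exp powr_def ring_distribs flip: exp_add)
qed

text \<open>
  Since the \<open>x i\<close> separate the \<open>y j\<close>, the alternating sum of their arguments stays in
  \<open>(-pi/2, pi/2)\<close>, so no branch cut is crossed.
\<close>

lemma prod_cauchy_weight_separated:
  fixes x y :: "nat \<Rightarrow> real" and S c :: real
  assumes sep: "\<And>i. i \<in> {1..n} \<Longrightarrow> y (Suc i) < x i \<and> x i < y i" and S: "0 < S"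
    and eq: "(\<Prod>j\<in>{1..Suc n}. 1 + \<i> * of_real (y j)) =
      of_real S * (1 + \<i> * of_real c) * (\<Prod>i\<in>{1..n}. 1 + \<i> * of_real (x i))"
  shows "(\<Prod>j\<in>{1..Suc n}. cauchy_weight a (y j)) =
    S powr (- 2 * Re a) * cauchy_weight a c * (\<Prod>i\<in>{1..n}. cauchy_weight a (x i))"
proof -
  let ?l = "\<lambda>t :: real. Ln (1 + \<i> * of_real t)"
  have ne: "1 + \<i> * complex_of_real t \<noteq> 0" for t by (simp add: complex_eq_iff)
  define w where "w = (\<Sum>j\<in>{1..Suc n}. ?l (y j)) - (\<Sum>i\<in>{1..n}. ?l (x i))"
  have "exp w = (\<Prod>j\<in>{1..Suc n}. 1 + \<i> * of_real (y j)) / (\<Prod>i\<in>{1..n}. 1 + \<i> * of_real (x i))"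
    using ne by (simp add: w_def exp_diff exp_sum del: prod.cl_ivl_Suc sum.cl_ivl_Suc)
  also have "\<dots> = of_real S * (1 + \<i> * of_real c)"
    unfolding eq using ne by (simp add: prod_zero_iff)
  finally have w: "exp w = of_real S * (1 + \<i> * of_real c)" .
  have Im: "Im w = (\<Sum>j\<in>{1..Suc n}. arctan (y j)) - (\<Sum>i\<in>{1..n}. arctan (x i))"
    by (simp add: w_def Im_Ln_one_plus_ix del: sum.cl_ivl_Suc)
  \<comment> \<open>Pairing \<open>x i\<close> with \<open>y i\<close> leaves
    \<open>arctan (y (Suc n))\<close> and gives the lower bound; pairing it with
    \<open>y (Suc i)\<close> below leaves \<open>arctan (y 1)\<close> and gives the upper
    bound.\<close>
  have "Im w = (\<Sum>i\<in>{1..n}. arctan (y i) - arctan (x i)) + arctan (y (Suc n))"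
    unfolding Im by (simp add: sum_subtractf)
  moreover have "0 \<le> (\<Sum>i\<in>{1..n}. arctan (y i) - arctan (x i))"
    using sep by (intro sum_nonneg) (auto simp: arctan_le_iff less_imp_le)
  ultimately have lo: "- (pi / 2) < Im w" using arctan_lbound[of "y (Suc n)"] by linarith
  have "(\<Sum>j\<in>{1..Suc n}. arctan (y j)) = arctan (y 1) + (\<Sum>j\<in>{Suc 1..Suc n}. arctan (y j))"
    by (rule sum.atLeast_Suc_atMost) simp
  also have "(\<Sum>j\<in>{Suc 1..Suc n}. arctan (y j)) = (\<Sum>i\<in>{1..n}. arctan (y (Suc i)))"
    by (rule sum.shift_bounds_cl_Suc_ivl)
  finally have "Im w = arctan (y 1) + (\<Sum>i\<in>{1..n}. arctan (y (Suc i)) - arctan (x i))"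
    unfolding Im by (simp add: sum_subtractf)
  moreover have "(\<Sum>i\<in>{1..n}. arctan (y (Suc i)) - arctan (x i)) \<le> 0"
    using sep by (intro sum_nonpos) (auto simp: arctan_le_iff less_imp_le)
  ultimately have "Im w < pi / 2" using arctan_ubound[of "y 1"] by linarith
  with lo have "w = Ln (exp w)" by (intro Ln_exp[symmetric]) auto
  also have "\<dots> = of_real (ln S) + ?l c"
    unfolding w using S ne by (simp add: Ln_times_of_real Ln_of_real)
  finally have "(\<Sum>j\<in>{1..Suc n}. ?l (y j)) = of_real (ln S) + ?l c + (\<Sum>i\<in>{1..n}. ?l (x i))"
    by (simp add: w_def algebra_simps del: sum.cl_ivl_Suc)
  moreover have prod: "(\<Prod>j\<in>A. cauchy_weight a (t j)) = exp (- 2 * Re (a * (\<Sum>j\<in>A. ?l (t j))))"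
    if "finite A" for t and A :: "nat set"
    using that by (simp add: cauchy_weight_eq_exp sum_distrib_left flip: exp_sum)
  ultimately show ?thesis
    using S by (simp only: prod finite_atLeastAtMost cauchy_weight_eq_exp)
      (simp add: powr_def ring_distribs flip: exp_add)
qed

section \<open>The recurrence as a polynomial identity and its value at \<open>\<i>\<close>\<close>

lemma poly_eqI_cofinite:
  fixes p q :: "'a::{idom, ring_char_0} poly"
  assumes "finite A" and "\<And>z. z \<notin> A \<Longrightarrow> poly p z = poly q z"
  shows "p = q"
proof (rule ccontr)
  assume "p \<noteq> q"
  then have "finite {z. poly (p - q) z = 0}" by (intro poly_roots_finite) simp
  moreover have "- A \<subseteq> {z. poly (p - q) z = 0}" using assms(2) by auto
  ultimately have "finite (- A)" by (rule rev_finite_subset)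
  then show False using assms(1) infinite_UNIV_char_0[where 'a = 'a]
    by (metis Compl_partition finite_Un)
qed

definition root_poly :: "nat set \<Rightarrow> (nat \<Rightarrow> real) \<Rightarrow> real poly" where
  "root_poly A x = (\<Prod>j\<in>A. [:- x j, 1:])"

definition lagrange_poly :: "nat \<Rightarrow> (nat \<Rightarrow> real) \<Rightarrow> (nat \<Rightarrow> real) \<Rightarrow> real poly" where
  "lagrange_poly n x v = (\<Sum>i\<in>{1..n}. smult (v i) (root_poly ({1..n} - {i}) x))"

lemma poly_root_poly: "poly (root_poly A x) z = (\<Prod>j\<in>A. z - x j)"
  by (simp add: root_poly_def poly_prod)

lemma poly_lagrange_poly:
  assumes "z \<notin> x ` {1..n}"
  shows "poly (lagrange_poly n x v) z = - (\<Sum>i\<in>{1..n}. v i / (x i - z)) * (\<Prod>j\<in>{1..n}. z - x j)"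
proof -
  have "v i * (\<Prod>j\<in>{1..n} - {i}. z - x j) = - (v i / (x i - z)) * (\<Prod>j\<in>{1..n}. z - x j)" if "i \<in> {1..n}" for i
  proof -
    have "x i - z \<noteq> 0" using assms that by auto
    moreover have "(\<Prod>j\<in>{1..n}. z - x j) = (z - x i) * (\<Prod>j\<in>{1..n} - {i}. z - x j)"
      using that by (simp add: prod.remove)
    ultimately show ?thesis by (simp add: divide_simps) (simp add: algebra_simps)
  qed
  then show ?thesis
    by (simp add: lagrange_poly_def poly_sum poly_root_poly sum_negf[symmetric] sum_distrib_right del: sum_negf)
qed

lemma prod_split_first:
  fixes f :: "nat \<Rightarrow> 'a::comm_monoid_mult"
  shows "1 \<le> n \<Longrightarrow> prod f {1..n} = f 1 * prod f {2..n}"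
  using prod.atLeast_Suc_atMost[of 1 n f] by (simp add: numeral_2_eq_2)

lemma prod_split_ends:
  fixes f :: "nat \<Rightarrow> 'a::comm_monoid_mult"
  shows "1 \<le> n \<Longrightarrow> prod f {1..Suc n} = f (Suc n) * (f 1 * prod f {2..n})"
  using prod_split_first[of n f] by (simp add: mult.commute)

lemma ratio_times_prod:
  fixes x :: "nat \<Rightarrow> 'a::field"
  assumes "z \<notin> x ` {1..n}" and "1 \<le> n"
  shows "ratio e n x y z * (\<Prod>j\<in>{1..n}. z - x j) = (e * z - y 1) * (\<Prod>j\<in>{2..n}. z - y j)"
proof -
  have "(\<Prod>j\<in>{1..n}. z - x j) = (\<Prod>j\<in>{1..n}. (- 1) * (x j - z))"
    "(\<Prod>j\<in>{2..n}. z - y j) = (\<Prod>j\<in>{2..n}. (- 1) * (y j - z))" by simp_all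
  moreover have "(- 1) ^ n = - ((- 1) ^ (n - 1) :: 'a)" using \<open>1 \<le> n\<close> by (cases n) auto
  moreover have "(\<Prod>j\<in>{1..n}. x j - z) \<noteq> 0" using assms by force
  ultimately show ?thesis
    by (simp only: prod.distrib ratio_def prod_constant card_atLeastAtMost)
      (simp add: divide_simps Suc_diff_le numeral_2_eq_2 algebra_simps)
qed

lemma lagrange_poly_resid_zero:
  assumes "1 \<le> n" "inj_on x {1..n}"
  shows "lagrange_poly n x (resid 0 n x y) = smult (y 1) (root_poly {2..n} y)"
proof (rule poly_eqI_cofinite[where A = "x ` {1..n}"])
  fix z assume z: "z \<notin> x ` {1..n}"
  show "poly (lagrange_poly n x (resid 0 n x y)) z = poly (smult (y 1) (root_poly {2..n} y)) z"
    using partial_fractions[OF assms z, of 0 y] ratio_times_prod[OF z assms(1), of 0 y]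
    by (simp only: poly_lagrange_poly[OF z] poly_smult poly_root_poly) simp
qed simp

text \<open>Both sides are the leading coefficient of the numerator. In the induction,
  \<open>(s - x i) / (X - x i) + (s - X) / (x i - X) = 1\<close>, so a new pole and zero leave the
  sum unchanged.\<close>

lemma sum_resid_zero:
  assumes "1 \<le> n" "inj_on x {1..n}"
  shows "(\<Sum>i\<in>{1..n}. resid 0 n x y i) = y 1"
  using assms
proof (induction n rule: nat_induct_at_least)
  case base
  then show ?case by (simp add: resid_def)
next
  case (Suc n)
  have inj: "inj_on x {1..n}" using Suc.prems by (auto simp: inj_on_def)
  have X: "x (Suc n) \<notin> x ` {1..n}" by (auto dest!: inj_onD[OF Suc.prems(1)])
  have "(\<Sum>i\<in>{1..Suc n}. resid 0 (Suc n) x y i) =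
    (\<Sum>i\<in>{1..n}. (y (Suc n) - x i) / (x (Suc n) - x i) * resid 0 n x y i) +
    (y (Suc n) - x (Suc n)) * (\<Sum>i\<in>{1..n}. resid 0 n x y i / (x i - x (Suc n)))"
    using Suc.hyps partial_fractions[OF Suc.hyps inj X, of 0 y] by (simp add: resid_Suc resid_Suc_last)
  also have "\<dots> = (\<Sum>i\<in>{1..n}. (y (Suc n) - x i) / (x (Suc n) - x i) * resid 0 n x y i +
      (y (Suc n) - x (Suc n)) * (resid 0 n x y i / (x i - x (Suc n))))"
    by (simp add: sum.distrib sum_distrib_left)
  also have "\<dots> = (\<Sum>i\<in>{1..n}. resid 0 n x y i)"
  proof (rule sum.cong)
    fix i assume "i \<in> {1..n}"
    then have "x i \<noteq> x (Suc n)" using X by (metis image_eqI)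
    then have "x i - x (Suc n) \<noteq> 0" "x (Suc n) - x i \<noteq> 0" by simp_all
    then show "(y (Suc n) - x i) / (x (Suc n) - x i) * resid 0 n x y i +
      (y (Suc n) - x (Suc n)) * (resid 0 n x y i / (x i - x (Suc n))) = resid 0 n x y i"
      by (simp add: divide_simps) (simp add: algebra_simps)
  qed simp
  finally show ?case using Suc.IH[OF inj] by simp
qed

text \<open>The rational identity \<open>recurrence_ratio\<close> multiplied by the denominator: the
  step of the recurrence, in coordinates \<open>v\<close> and \<open>c\<close>, produces exactly the
  zeros \<open>y\<close>.\<close>

lemma recurrence_root_poly:
  fixes x y :: "nat \<Rightarrow> real"
  assumes n: "1 \<le> n" and inj: "inj_on x {1..n}" and s: "y (Suc n) \<notin> x ` {1..n}"
    and v: "\<And>i. i \<in> {1..n} \<Longrightarrow> v i = (x i - y (Suc n)) / (1 + x i ^ 2) * resid 1 n x y i"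
    and S: "S = (\<Sum>i\<in>{1..n}. v i)"
    and c: "c * (1 + S) = y (Suc n) + (\<Sum>i\<in>{1..n}. v i * (1 + x i ^ 2) / (x i - y (Suc n))) - (\<Sum>i\<in>{1..n}. v i * x i)"
  shows "smult (1 + S) ([:- c, 1:] * root_poly {1..n} x) - [:1, 0, 1:] * lagrange_poly n x v = root_poly {1..Suc n} y"
proof (rule poly_eqI_cofinite[where A = "x ` {1..n}"])
  fix z assume z: "z \<notin> x ` {1..n}"
  have sq: "1 + x i ^ 2 \<noteq> 0" for i using zero_le_power2[of "x i"] by linarith
  have "(\<Prod>j\<in>{1..Suc n}. z - y j) = (z - y (Suc n)) * ((1 * z - y 1) * (\<Prod>j\<in>{2..n}. z - y j))"
    by (simp only: prod_split_ends[OF n] mult_1)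
  also have "\<dots> = (z - y (Suc n)) * ratio 1 n x y z * (\<Prod>j\<in>{1..n}. z - x j)"
    using ratio_times_prod[OF z n, of 1 y] by (simp only: mult.assoc)
  also have "\<dots> = ((1 + S) * (z - c) + (1 + z ^ 2) * (\<Sum>i\<in>{1..n}. v i / (x i - z))) * (\<Prod>j\<in>{1..n}. z - x j)"
    by (simp only: recurrence_ratio[OF n inj z s sq v S c, symmetric])
  also have "\<dots> = poly (smult (1 + S) ([:- c, 1:] * root_poly {1..n} x) - [:1, 0, 1:] * lagrange_poly n x v) z"
    by (simp add: poly_root_poly poly_lagrange_poly[OF z] algebra_simps power2_eq_square)
  finally show "poly (smult (1 + S) ([:- c, 1:] * root_poly {1..n} x) - [:1, 0, 1:] * lagrange_poly n x v) z =
    poly (root_poly {1..Suc n} y) z" by (simp add: poly_root_poly)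
qed simp

text \<open>At \<open>z = \<i>\<close> the factor \<open>1 + z ^ 2\<close> removes the second term
  of the recurrence. This is the input to the transformation of the Cauchy weights.\<close>

lemma recurrence_at_i:
  fixes x y :: "nat \<Rightarrow> real"
  assumes n: "1 \<le> n" and inj: "inj_on x {1..n}" and s: "y (Suc n) \<notin> x ` {1..n}"
    and v: "\<And>i. i \<in> {1..n} \<Longrightarrow> v i = (x i - y (Suc n)) / (1 + x i ^ 2) * resid 1 n x y i"
    and S: "S = (\<Sum>i\<in>{1..n}. v i)"
    and c: "c * (1 + S) = y (Suc n) + (\<Sum>i\<in>{1..n}. v i * (1 + x i ^ 2) / (x i - y (Suc n))) - (\<Sum>i\<in>{1..n}. v i * x i)"
  shows "(\<Prod>j\<in>{1..Suc n}. 1 + \<i> * complex_of_real (y j)) =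
      of_real (1 + S) * (1 + \<i> * of_real c) * (\<Prod>i\<in>{1..n}. 1 + \<i> * of_real (x i))"
proof -
  let ?X = "\<lambda>i. complex_of_real (x i)" and ?Y = "\<lambda>i. complex_of_real (y i)"
  have inj': "inj_on ?X {1..n}" by (rule inj_onI) (rule inj_onD[OF inj], simp_all only: of_real_eq_iff)
  have ni: "\<i> \<notin> ?X ` {1..n}" by (auto simp: complex_eq_iff)
  have s': "?Y (Suc n) \<notin> ?X ` {1..n}" using s by auto
  have sq: "1 + ?X i ^ 2 \<noteq> 0" for i
  proof -
    have "1 + x i ^ 2 \<noteq> 0" using zero_le_power2[of "x i"] by linarith
    then have "complex_of_real (1 + x i ^ 2) \<noteq> 0" by (simp only: of_real_eq_0_iff not_False_eq_True)
    then show ?thesis by (simp only: of_real_add of_real_1 of_real_power not_False_eq_True)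
  qed
  have v': "complex_of_real (v i) = (?X i - ?Y (Suc n)) / (1 + ?X i ^ 2) * resid 1 n ?X ?Y i"
    if "i \<in> {1..n}" for i
    unfolding v[OF that] resid_def by simp
  have S': "complex_of_real S = (\<Sum>i\<in>{1..n}. complex_of_real (v i))" by (simp add: S)
  have c': "of_real c * (1 + of_real S) = ?Y (Suc n) +
      (\<Sum>i\<in>{1..n}. complex_of_real (v i) * (1 + ?X i ^ 2) / (?X i - ?Y (Suc n))) -
      (\<Sum>i\<in>{1..n}. complex_of_real (v i) * ?X i)"
    using arg_cong[OF c, of complex_of_real] by simp
  have "of_real (1 + S) * (\<i> - of_real c) = (\<i> - ?Y (Suc n)) * ratio 1 n ?X ?Y \<i>"
    using recurrence_ratio[OF n inj' ni s' sq v' S' c'] by simp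
  then have "of_real (1 + S) * (\<i> - of_real c) * (\<Prod>i\<in>{1..n}. \<i> - ?X i) =
      (\<i> - ?Y (Suc n)) * (ratio 1 n ?X ?Y \<i> * (\<Prod>i\<in>{1..n}. \<i> - ?X i))"
    by (simp only: mult.assoc)
  also have "\<dots> = (\<Prod>j\<in>{1..Suc n}. \<i> - ?Y j)"
    by (simp only: ratio_times_prod[OF ni n] prod_split_ends[OF n] mult_1)
  finally have *: "of_real (1 + S) * (\<i> - of_real c) * (\<Prod>i\<in>{1..n}. \<i> - ?X i) = (\<Prod>j\<in>{1..Suc n}. \<i> - ?Y j)" .
  \<comment> \<open>Both sides consist of \<open>n + 1\<close> such factors, so the same power of
    \<open>\<i>\<close> cancels.\<close>
  have i: "\<i> - complex_of_real t = \<i> * (1 + \<i> * of_real t)" for t by (simp add: algebra_simps)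
  have "\<i> ^ Suc n * (of_real (1 + S) * (1 + \<i> * of_real c) * (\<Prod>i\<in>{1..n}. 1 + \<i> * ?X i)) =
    \<i> ^ Suc n * (\<Prod>j\<in>{1..Suc n}. 1 + \<i> * ?Y j)"
    using * unfolding i prod.distrib prod_constant by (simp add: mult_ac)
  then show ?thesis by simp
qed

section \<open>Interlacing zeros\<close>

lemma poly_borel_measurableI:
  assumes "\<And>i. (\<lambda>w. coeff (f w) i) \<in> borel_measurable N"
  shows "f \<in> measurable N poly_borel"
  unfolding poly_borel_def
proof (rule measurable_vimage_algebra2)
  show "(\<lambda>w. coeff (f w)) \<in> measurable N (\<Pi>\<^sub>M i\<in>UNIV. borel)"
    using assms by (intro measurable_PiM_single') auto
qed simp

lemma measurable_coeff [measurable (raw)]: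
  assumes [measurable]: "f \<in> measurable N poly_borel"
  shows "(\<lambda>w. coeff (f w) i) \<in> borel_measurable N"
proof -
  have "coeff \<in> measurable poly_borel (\<Pi>\<^sub>M i\<in>UNIV. borel)"
    unfolding poly_borel_def by (rule measurable_vimage_algebra1) (auto simp: space_PiM)
  then have "(\<lambda>p. coeff p i) \<in> borel_measurable poly_borel"
    by (rule measurable_compose) (rule measurable_component_singleton, simp)
  from measurable_compose[OF assms this] show ?thesis .
qed

lemma space_poly_borel [simp]: "space poly_borel = UNIV"
  by (simp add: poly_borel_def)

lemma measurable_poly_add [measurable (raw)]:
  "f \<in> measurable N poly_borel \<Longrightarrow> g \<in> measurable N poly_borel \<Longrightarrow> (\<lambda>w. f w + g w) \<in> measurable N poly_borel"
  by (rule poly_borel_measurableI) (simp, measurable)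

lemma measurable_poly_diff [measurable (raw)]:
  "f \<in> measurable N poly_borel \<Longrightarrow> g \<in> measurable N poly_borel \<Longrightarrow> (\<lambda>w. f w - g w) \<in> measurable N poly_borel"
  by (rule poly_borel_measurableI) (simp, measurable)

lemma measurable_poly_mult [measurable (raw)]:
  "f \<in> measurable N poly_borel \<Longrightarrow> g \<in> measurable N poly_borel \<Longrightarrow> (\<lambda>w. f w * g w) \<in> measurable N poly_borel"
  by (rule poly_borel_measurableI) (simp add: coeff_mult, measurable)

lemma measurable_poly_smult [measurable (raw)]:
  "f \<in> borel_measurable N \<Longrightarrow> g \<in> measurable N poly_borel \<Longrightarrow> (\<lambda>w. smult (f w) (g w)) \<in> measurable N poly_borel"
  by (rule poly_borel_measurableI) (simp, measurable)

lemma measurable_linear_poly [measurable (raw)]: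
  "f \<in> borel_measurable N \<Longrightarrow> (\<lambda>w. [:f w, c:]) \<in> measurable N poly_borel"
  by (rule poly_borel_measurableI) (simp add: coeff_pCons split: nat.split)

lemma measurable_poly_sum [measurable (raw)]:
  "(\<And>i. i \<in> A \<Longrightarrow> f i \<in> measurable N poly_borel) \<Longrightarrow> (\<lambda>w. \<Sum>i\<in>A. f i w) \<in> measurable N poly_borel"
  by (rule poly_borel_measurableI) (simp add: coeff_sum)

lemma measurable_poly_prod [measurable (raw)]:
  assumes "\<And>i. i \<in> A \<Longrightarrow> f i \<in> measurable N poly_borel"
  shows "(\<lambda>w. \<Prod>i\<in>A. f i w) \<in> measurable N poly_borel"
  using assms
proof (induction A rule: infinite_finite_induct)
  case (insert a A)
  then have [measurable]: "f a \<in> measurable N poly_borel" "(\<lambda>w. \<Prod>i\<in>A. f i w) \<in> measurable N poly_borel" by auto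
  show ?case using insert.hyps by simp
qed simp_all

lemma measurable_root_poly [measurable (raw)]:
  "(\<And>i. i \<in> A \<Longrightarrow> (\<lambda>w. x w i) \<in> borel_measurable N) \<Longrightarrow> (\<lambda>w. root_poly A (x w)) \<in> measurable N poly_borel"
  unfolding root_poly_def by (intro measurable_poly_prod measurable_linear_poly borel_measurable_uminus)

lemma measurable_lagrange_poly [measurable (raw)]:
  "(\<And>i. i \<in> {1..n} \<Longrightarrow> (\<lambda>w. v w i) \<in> borel_measurable N) \<Longrightarrow> (\<lambda>w. lagrange_poly n x (v w)) \<in> measurable N poly_borel"
  unfolding lagrange_poly_def
  by (intro measurable_poly_sum measurable_poly_smult measurable_const) simp_all

section \<open>Interlacing configurations in residue coordinates\<close>

definition interlace :: "nat \<Rightarrow> (nat \<Rightarrow> real) \<Rightarrow> (nat \<Rightarrow> real) \<Rightarrow> bool" where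
  "interlace n x y \<longleftrightarrow> (\<forall>i\<in>{1..<n}. x (Suc i) < y i \<and> y i < x i)"

definition cross :: "nat \<Rightarrow> (nat \<Rightarrow> real) \<Rightarrow> (nat \<Rightarrow> real) \<Rightarrow> real" where
  "cross n x y = (\<Prod>i\<in>{1..n}. \<Prod>j\<in>{1..<n}. \<bar>x i - y j\<bar>)"

lemma interlace_imp_decreasing: "interlace n x y \<Longrightarrow> \<forall>i\<in>{1..<n}. x (Suc i) < x i"
  by (force simp: interlace_def)

lemma interlace_imp_decreasing_inner: "interlace n x y \<Longrightarrow> \<forall>i\<in>{1..<n - 1}. y (Suc i) < y i"
proof
  fix i assume a: "interlace n x y" "i \<in> {1..<n - 1}"
  then have "Suc i \<in> {1..<n}" "i \<in> {1..<n}" by auto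
  then have "y (Suc i) < x (Suc i)" "x (Suc i) < y i" using a(1) unfolding interlace_def by blast+
  then show "y (Suc i) < y i" by simp
qed

text \<open>Every unordered pair of indices is counted twice.\<close>

lemma prod_others: "(\<Prod>i\<in>{1..n}. \<Prod>j\<in>{1..n} - {i}. \<bar>x j - x i\<bar>) = (vand n x)\<^sup>2"
proof (induction n)
  case 0
  then show ?case by (simp add: vand_def)
next
  case (Suc n)
  have "(\<Prod>j\<in>{1..Suc n} - {i}. \<bar>x j - x i\<bar>) = \<bar>x i - x (Suc n)\<bar> * (\<Prod>j\<in>{1..n} - {i}. \<bar>x j - x i\<bar>)"
    if "i \<in> {1..n}" for i
  proof -
    have "{1..Suc n} - {i} = insert (Suc n) ({1..n} - {i})" using that by auto
    then show ?thesis by (simp add: abs_minus_commute)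
  qed
  moreover have "{1..Suc n} - {Suc n} = {1..n}" by auto
  ultimately have "(\<Prod>i\<in>{1..Suc n}. \<Prod>j\<in>{1..Suc n} - {i}. \<bar>x j - x i\<bar>) =
    (\<Prod>i\<in>{1..n}. \<bar>x i - x (Suc n)\<bar> * (\<Prod>j\<in>{1..n} - {i}. \<bar>x j - x i\<bar>)) * (\<Prod>j\<in>{1..n}. \<bar>x j - x (Suc n)\<bar>)"
    by (simp del: atLeastAtMost_iff)
  then show ?case unfolding vand_Suc prod.distrib Suc.IH by (simp add: power2_eq_square)
qed

lemma prod_abs_resid:
  fixes x :: "nat \<Rightarrow> real"
  shows "(\<Prod>i\<in>{1..n}. \<bar>resid e n x y i\<bar>) =
    (\<Prod>i\<in>{1..n}. \<bar>y 1 - e * x i\<bar>) * (\<Prod>i\<in>{1..n}. \<Prod>j\<in>{2..n}. \<bar>y j - x i\<bar>) / (vand n x)\<^sup>2"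
  unfolding resid_def prod_others[symmetric] by (simp add: abs_mult abs_prod prod.distrib prod_dividef)

lemma prod_shift: "prod f {2..n} = (\<Prod>j\<in>{1..<n}. f (Suc j))"
  by (rule prod.reindex_bij_witness[of _ Suc "\<lambda>j. j - 1"]) auto

lemma prod_shift_less: "prod f {2..<Suc k} = (\<Prod>j\<in>{1..<k}. f (Suc j))"
  by (rule prod.reindex_bij_witness[of _ Suc "\<lambda>j. j - 1"]) auto

lemma vand_eq_decreasing:
  assumes "\<forall>i\<in>{1..<n}. x (Suc i) < x i"
  shows "vand n x = (\<Prod>k\<in>{1..n}. \<Prod>j\<in>{1..<k}. x j - x k)"
  unfolding vand_def
proof (intro prod.cong refl)
  fix k j assume "k \<in> {1..n}" "j \<in> {1..<k}"
  then have "x k < x j" using decreasing_less[OF assms, of j k] by simp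
  then show "\<bar>x j - x k\<bar> = x j - x k" by simp
qed

lemma jac_zero_eq_vand:
  assumes "1 \<le> n" "\<forall>i\<in>{1..<n - 1}. y (Suc i) < y i" "Y 1 = S" "\<And>j. 1 \<le> j \<Longrightarrow> Y (Suc j) = y j"
  shows "jac 0 n Y = S ^ (n - 1) * vand (n - 1) y"
proof -
  have "jac 0 n Y = (\<Prod>k\<in>{1..<n}. S * (\<Prod>j\<in>{1..<k}. y j - y k))"
    unfolding jac_def prod_shift prod_shift_less using assms(3,4) by (intro prod.cong) simp_all
  also have "{1..<n} = {1..n - 1}" using assms(1) by auto
  finally show ?thesis unfolding vand_eq_decreasing[OF assms(2)] by (simp add: prod.distrib)
qed

lemma jac_one_eq_vand:
  assumes "1 \<le> n" "\<forall>i\<in>{1..<n}. y (Suc i) < y i"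
  shows "jac 1 n y = vand n y"
proof -
  have "(\<Prod>j\<in>{1..<k}. y j - y k) = (y 1 - y k) * (\<Prod>j\<in>{2..<k}. y j - y k)" if "k \<in> {2..n}" for k
    using prod.atLeast_Suc_lessThan[of 1 k "\<lambda>j. y j - y k"] that by (simp add: numeral_2_eq_2)
  then show ?thesis unfolding vand_eq_decreasing[OF assms(2)] prod_split_first[OF assms(1)] jac_def by simp
qed

lemma nn_integral_interlacing:
  fixes x :: "nat \<Rightarrow> real" and d :: real
  assumes n: "1 \<le> n" and dec: "\<forall>i\<in>{1..<n}. x (Suc i) < x i" and [measurable]: "\<Psi> \<in> borel_measurable (LB {1..n})"
  shows "(\<integral>\<^sup>+y. \<integral>\<^sup>+S. ennreal (S powr (n * d - 1) * cross n x y powr (d - 1) * vand (n - 1) y) *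
      \<Psi> (\<lambda>i\<in>{1..n}. resid 0 n x (y(0 := S) \<circ> (\<lambda>j. j - 1)) i) *
      indicator {0<..} S * indicator {y. interlace n x y} y \<partial>lborel \<partial>LB {1..<n}) =
    ennreal (vand n x powr (2 * d - 1)) *
      (\<integral>\<^sup>+v. ennreal ((\<Prod>i\<in>{1..n}. v i) powr (d - 1)) * \<Psi> v * indicator {v. \<forall>i\<in>{1..n}. 0 < v i} v \<partial>LB {1..n})"
proof -
  \<comment> \<open>The leading coefficient \<open>S\<close> gets index 0, so the inner zeros keep
    their indices \<open>1, \<dots>, n - 1\<close>.\<close>
  define \<sigma> :: "nat \<Rightarrow> nat" where "\<sigma> j = j - 1" for j
  have inj: "inj_on \<sigma> {1..n}" by (auto simp: \<sigma>_def inj_on_def)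
  have im: "\<sigma> ` {1..n} = insert 0 {1..<n}"
  proof (intro subset_antisym subsetI)
    fix j assume "j \<in> insert 0 {1..<n}"
    then show "j \<in> \<sigma> ` {1..n}" using n by (intro image_eqI[of _ _ "Suc j"]) (auto simp: \<sigma>_def)
  qed (auto simp: \<sigma>_def)
  have vp: "0 < vand n x" by (intro vand_pos inj_on_decreasing dec)
  define F where "F v = ennreal (vand n x powr (2 * d - 1)) * (ennreal ((\<Prod>i\<in>{1..n}. v i) powr (d - 1)) * \<Psi> v)" for v
  have measF [measurable]: "F \<in> borel_measurable (LB {1..n})" unfolding F_def by measurable
  define G where "G Y = F (\<lambda>i\<in>{1..n}. resid 0 n x (Y \<circ> \<sigma>) i) * ennreal (jac 0 n (Y \<circ> \<sigma>) / vand n x) *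
    indicator {Y. slots 0 n x (Y \<circ> \<sigma>)} Y" for Y
  have [measurable]: "(\<lambda>Y. (Y \<circ> \<sigma>) j) \<in> borel_measurable (LB (\<sigma> ` {1..n}))" if "j \<in> {1..n}" for j
    using that by simp
  have measG: "G \<in> borel_measurable (LB (\<sigma> ` {1..n}))" unfolding G_def using n by measurable
  have "ennreal (vand n x powr (2 * d - 1)) *
      (\<integral>\<^sup>+v. ennreal ((\<Prod>i\<in>{1..n}. v i) powr (d - 1)) * \<Psi> v * indicator {v. \<forall>i\<in>{1..n}. 0 < v i} v \<partial>LB {1..n}) =
    (\<integral>\<^sup>+v. F v * indicator {v. \<forall>i\<in>{1..n}. 0 < v i} v \<partial>LB {1..n})"
    unfolding F_def by (subst nn_integral_cmult[symmetric]) (measurable, simp only: mult.assoc)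
  also have "\<dots> = (\<integral>\<^sup>+Y. G Y \<partial>LB (\<sigma> ` {1..n}))"
    unfolding G_def by (intro nn_integral_residues n dec inj measF) simp
  also have "\<dots> = (\<integral>\<^sup>+y. \<integral>\<^sup>+S. G (y(0 := S)) \<partial>lborel \<partial>LB {1..<n})"
    unfolding im by (intro LB.product_nn_integral_insert measG[unfolded im]) auto
  also have "\<dots> = (\<integral>\<^sup>+y. \<integral>\<^sup>+S. ennreal (S powr (n * d - 1) * cross n x y powr (d - 1) * vand (n - 1) y) *
      \<Psi> (\<lambda>i\<in>{1..n}. resid 0 n x (y(0 := S) \<circ> (\<lambda>j. j - 1)) i) *
      indicator {0<..} S * indicator {y. interlace n x y} y \<partial>lborel \<partial>LB {1..<n})"
  proof (intro nn_integral_cong)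
    fix y :: "nat \<Rightarrow> real" and S :: real
    define Y where "Y = y(0 := S) \<circ> \<sigma>"
    have Y: "Y 1 = S" "\<And>j. 1 \<le> j \<Longrightarrow> Y (Suc j) = y j" by (auto simp: Y_def \<sigma>_def)
    have Y_alt: "y(0 := S) \<circ> (\<lambda>j. j - 1) = Y" by (simp add: Y_def \<sigma>_def fun_eq_iff)
    have slots: "slots 0 n x Y \<longleftrightarrow> 0 < S \<and> interlace n x y"
    proof -
      have "(\<forall>j\<in>{2..n}. x j < Y j \<and> Y j < x (j - 1)) \<longleftrightarrow> (\<forall>j\<in>{1..<n}. x (Suc j) < Y (Suc j) \<and> Y (Suc j) < x j)" (is "?L \<longleftrightarrow> ?R")
      proof
        assume ?R
        show ?L
        proof
          fix j assume "j \<in> {2..n}"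
          then have "j - 1 \<in> {1..<n}" "Suc (j - 1) = j" by auto
          with \<open>?R\<close> show "x j < Y j \<and> Y j < x (j - 1)" by metis
        qed
      next
        assume L: ?L
        show ?R
        proof
          fix j assume "j \<in> {1..<n}"
          then show "x (Suc j) < Y (Suc j) \<and> Y (Suc j) < x j" using bspec[OF L, of "Suc j"] by simp
        qed
      qed
      then show ?thesis unfolding slots_def interlace_def using Y by auto
    qed
    show "G (y(0 := S)) = ennreal (S powr (n * d - 1) * cross n x y powr (d - 1) * vand (n - 1) y) *
      \<Psi> (\<lambda>i\<in>{1..n}. resid 0 n x (y(0 := S) \<circ> (\<lambda>j. j - 1)) i) *
      indicator {0<..} S * indicator {y. interlace n x y} y"
    proof (cases "slots 0 n x Y")
      case False
      then show ?thesis unfolding G_def Y_def[symmetric] using slots by (auto split: split_indicator simp flip: Y_def)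
    next
      case True
      then have S: "0 < S" and il: "interlace n x y" using slots by auto
      have yd: "\<forall>i\<in>{1..<n - 1}. y (Suc i) < y i" by (rule interlace_imp_decreasing_inner[OF il])
      have vy: "0 < vand (n - 1) y" by (intro vand_pos inj_on_decreasing yd)
      have cr: "0 < cross n x y"
      proof -
        have "x i \<noteq> y j" if ij: "i \<in> {1..n}" "j \<in> {1..<n}" for i j
        proof -
          have b: "x (Suc j) < y j" "y j < x j" using il ij(2) unfolding interlace_def by blast+
          show ?thesis
          proof (cases "i \<le> j")
            case True
            then have "x j \<le> x i" using decreasing_less[OF dec, of i j] ij by (cases "i = j") auto
            then show ?thesis using b by simp
          next
            case False
            then have "x i \<le> x (Suc j)" using decreasing_less[OF dec, of "Suc j" i] ij by (cases "i = Suc j") auto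
            then show ?thesis using b by simp
          qed
        qed
        then show ?thesis unfolding cross_def by (intro prod_pos) auto
      qed
      have "(\<Prod>i\<in>{1..n}. resid 0 n x Y i) = (\<Prod>i\<in>{1..n}. \<bar>resid 0 n x Y i\<bar>)"
        using resid_pos[OF n dec True order_refl] by (intro prod.cong refl) (metis abs_of_pos)
      also have "\<dots> = S ^ n * cross n x y / (vand n x)\<^sup>2"
        using S unfolding prod_abs_resid cross_def prod_shift Y(1)
        by (simp add: Y(2) abs_minus_commute)
      finally have pr: "(\<Prod>i\<in>{1..n}. resid 0 n x Y i) = S ^ n * cross n x y / (vand n x)\<^sup>2" .
      \<comment> \<open>The exponent of \<open>S\<close> is
        \<open>n (d - 1) + (n - 1) = n d - 1\<close>; that of \<open>vand n x\<close> is
        \<open>(2 d - 1) - 2 (d - 1) - 1 = 0\<close>.\<close>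
      have "vand n x powr (2 * d - 1) * (S ^ n * cross n x y / (vand n x)\<^sup>2) powr (d - 1) * (S ^ (n - 1) * vand (n - 1) y / vand n x) =
        S powr (n * d - 1) * cross n x y powr (d - 1) * vand (n - 1) y"
      proof -
        define l where "l = ln (vand n x)"
        define s where "s = ln S"
        have e: "vand n x = exp l" "S = exp s" using vp S by (auto simp: l_def s_def)
        have "S ^ n * cross n x y / (vand n x)\<^sup>2 = exp (n * s - 2 * l) * cross n x y"
          unfolding e by (simp add: exp_diff exp_double exp_of_nat_mult)
        then have "(S ^ n * cross n x y / (vand n x)\<^sup>2) powr (d - 1) = exp ((n * s - 2 * l) * (d - 1)) * cross n x y powr (d - 1)"
          using cr by (simp add: powr_mult exp_powr_real)
        moreover have "S ^ (n - 1) = exp ((n - 1) * s)" unfolding e by (simp add: exp_of_nat_mult)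
        moreover have "S powr (n * d - 1) = exp ((n * d - 1) * s)" unfolding e by (simp add: powr_def)
        moreover have "vand n x powr (2 * d - 1) = exp ((2 * d - 1) * l)" unfolding e by (simp add: powr_def)
        moreover have "real (n - 1) = real n - 1" using n by simp
        moreover have "exp (l * 2) = exp l * exp l" by (simp flip: exp_add)
        ultimately show ?thesis
          by (simp add: e(1) exp_diff exp_add algebra_simps)
      qed
      moreover have jacY: "jac 0 n Y = S ^ (n - 1) * vand (n - 1) y"
        by (rule jac_zero_eq_vand[OF n yd, where Y = Y]) (fact Y)+
      ultimately have eq: "ennreal (vand n x powr (2 * d - 1)) * ennreal ((\<Prod>i\<in>{1..n}. resid 0 n x Y i) powr (d - 1)) * ennreal (jac 0 n Y / vand n x) =
         ennreal (S powr (n * d - 1) * cross n x y powr (d - 1) * vand (n - 1) y)"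
        unfolding pr jacY using vp vy S by (simp flip: ennreal_mult')
      have restr: "(\<Prod>i\<in>{1..n}. (\<lambda>i\<in>{1..n}. resid 0 n x Y i) i) = (\<Prod>i\<in>{1..n}. resid 0 n x Y i)" by simp
      have ind: "indicator {Y. slots 0 n x (Y \<circ> \<sigma>)} (y(0 := S)) = (1 :: ennreal)"
        "indicator {0<..} S = (1 :: ennreal)" "indicator {y. interlace n x y} y = (1 :: ennreal)"
        using True S il by (simp_all add: Y_def)
      show ?thesis
        unfolding G_def F_def ind Y_alt Y_def[symmetric] restr eq[symmetric] by (simp only: mult_1_right) (simp only: mult_ac)
    qed
  qed
  finally show ?thesis ..
qed

lemma interlace_Suc_iff:
  "1 \<le> n \<Longrightarrow> interlace (Suc n) y x \<longleftrightarrow> slots 1 n x y \<and> y (Suc n) < x n"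
proof
  assume n: "1 \<le> n" and a: "slots 1 n x y \<and> y (Suc n) < x n"
  show "interlace (Suc n) y x" unfolding interlace_def
  proof
    fix i assume i: "i \<in> {1..<Suc n}"
    have "x i < y i" using a i by (cases "i = 1") (auto simp: slots_def)
    moreover have "y (Suc i) < x i"
    proof (cases "i = n")
      case False
      then have "Suc i \<in> {2..n}" using i by auto
      then have "y (Suc i) < x (Suc i - 1)" using a unfolding slots_def by blast
      then show ?thesis by simp
    qed (use a in simp)
    ultimately show "y (Suc i) < x i \<and> x i < y i" by simp
  qed
next
  assume n: "1 \<le> n" and a: "interlace (Suc n) y x"
  then have b: "y (Suc i) < x i" "x i < y i" if "i \<in> {1..n}" for i
    using that unfolding interlace_def by auto
  have "x j < y j \<and> y j < x (j - 1)" if "j \<in> {2..n}" for j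
  proof -
    have "j - 1 \<in> {1..n}" "j \<in> {1..n}" "Suc (j - 1) = j" using that by auto
    then show ?thesis using b(2)[of j] b(1)[of "j - 1"] by simp
  qed
  then show "slots 1 n x y \<and> y (Suc n) < x n" using b[of 1] b[of n] n by (auto simp: slots_def)
qed

section \<open>The beta law in the variable \<open>S\<close> and the density factor of one
  step\<close>

lemma Beta_real_pos: "0 < a \<Longrightarrow> 0 < b \<Longrightarrow> 0 < Beta a (b :: real)"
  by (simp add: Beta_def Gamma_real_pos)

text \<open>With \<open>b = 1 / (1 + S)\<close> the beta law becomes the beta prime law of
  \<open>S = 1 / b - 1\<close>, the leading coefficient that residue coordinates call for.\<close>

lemma nn_integral_beta_density:
  fixes f :: "real \<Rightarrow> ennreal"
  assumes "0 < \<alpha>" "0 < \<beta>" and [measurable]: "f \<in> borel_measurable borel"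
  shows "(\<integral>\<^sup>+b. ennreal (beta_density \<alpha> \<beta> b) * f b \<partial>lborel) = ennreal (1 / Beta \<alpha> \<beta>) *
    (\<integral>\<^sup>+S. ennreal (S powr (\<beta> - 1) * (1 + S) powr (- \<alpha> - \<beta>)) * f (1 / (1 + S)) * indicator {0<..} S \<partial>lborel)"
proof -
  define F where "F b = ennreal (beta_density \<alpha> \<beta> b) * f b" for b
  have [measurable]: "F \<in> borel_measurable borel" unfolding F_def beta_density_def by measurable
  \<comment> \<open>The substitution rule asks for a nonnegative derivative, while \<open>b\<close>
    decreases in \<open>S\<close>; hence the detour through \<open>1 - b\<close>.\<close>
  define g where "g S = S / (1 + S)" for S :: real
  define g' where "g' S = 1 / (1 + S)\<^sup>2" for S :: real
  have [measurable]: "g \<in> borel_measurable borel" "g' \<in> borel_measurable borel"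
    unfolding g_def g'_def by measurable
  have img: "g ` einterval 0 \<infinity> = {0<..<1}"
  proof (intro subset_antisym subsetI)
    fix u :: real assume "u \<in> {0<..<1}"
    then show "u \<in> g ` einterval 0 \<infinity>"
      by (intro image_eqI[of _ _ "u / (1 - u)"]) (auto simp: g_def einterval_def zero_ereal_def field_simps)
  qed (auto simp: g_def einterval_def zero_ereal_def)
  have "(\<integral>\<^sup>+b. F b \<partial>lborel) = (\<integral>\<^sup>+u. F (1 + (- 1) * u) \<partial>lborel)"
    by (subst nn_integral_real_affine[where c = "- 1" and t = 1]) auto
  also have "\<dots> = (\<integral>\<^sup>+u. F (1 - u) * indicator (g ` einterval 0 \<infinity>) u \<partial>lborel)"
    unfolding img by (intro nn_integral_cong) (auto simp: F_def beta_density_def split: split_indicator)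
  also have "\<dots> = (\<integral>\<^sup>+S. F (1 - g S) * ennreal (g' S) * indicator (einterval 0 \<infinity>) S \<partial>lborel)"
  proof (rule nn_integral_substitution_open_interval)
    fix S assume "S \<in> einterval 0 \<infinity>"
    then have S: "0 < S" by (simp add: einterval_def zero_ereal_def)
    then show "(g has_real_derivative g' S) (at S)"
      unfolding g_def g'_def by (auto intro!: derivative_eq_intros simp: field_simps power2_eq_square)
    show "0 \<le> g' S" by (simp add: g'_def)
  next
    show "continuous_on (einterval 0 \<infinity>) g'" unfolding g'_def
      by (intro continuous_intros) (auto simp: einterval_def zero_ereal_def)
  qed auto
  also have "\<dots> = (\<integral>\<^sup>+S. ennreal (1 / Beta \<alpha> \<beta>) * (ennreal (S powr (\<beta> - 1) * (1 + S) powr (- \<alpha> - \<beta>)) * f (1 / (1 + S)) * indicator {0<..} S) \<partial>lborel)"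
  proof (rule nn_integral_cong)
    fix S :: real
    show "F (1 - g S) * ennreal (g' S) * indicator (einterval 0 \<infinity>) S =
      ennreal (1 / Beta \<alpha> \<beta>) * (ennreal (S powr (\<beta> - 1) * (1 + S) powr (- \<alpha> - \<beta>)) * f (1 / (1 + S)) * indicator {0<..} S)"
    proof (cases "0 < S")
      case True
      have g: "1 - g S = 1 / (1 + S)" using True by (simp add: g_def field_simps)
      have b: "0 < 1 / (1 + S)" "1 / (1 + S) < 1" "1 - 1 / (1 + S) = S / (1 + S)" using True by (auto simp: field_simps)
      have "beta_density \<alpha> \<beta> (1 / (1 + S)) * g' S =
        1 / Beta \<alpha> \<beta> * (S powr (\<beta> - 1) * (1 + S) powr (- \<alpha> - \<beta>))"
      proof -
        define l where "l = ln (1 + S)"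
        have l: "1 + S = exp l" using True by (simp add: l_def)
        have "(1 / (1 + S)) powr (\<alpha> - 1) = exp (- l * (\<alpha> - 1))" unfolding l by (simp add: powr_def ln_div)
        moreover have "(S / (1 + S)) powr (\<beta> - 1) = S powr (\<beta> - 1) * exp (- l * (\<beta> - 1))"
        proof -
          have "S / (1 + S) = S * exp (- l)" unfolding l by (simp add: exp_minus divide_inverse)
          then show ?thesis using True by (simp add: powr_mult exp_powr_real)
        qed
        moreover have "(1 + S) powr (- \<alpha> - \<beta>) = exp (l * (- \<alpha> - \<beta>))" unfolding l by (simp add: powr_def mult.commute)
        moreover have "g' S = exp (- 2 * l)" unfolding g'_def l by (simp add: exp_minus exp_double inverse_eq_divide flip: power2_eq_square)
        ultimately show ?thesis using b
          by (simp add: beta_density_def mult_ac flip: exp_add) (simp add: algebra_simps)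
      qed
      moreover have "0 \<le> g' S" "0 < 1 / Beta \<alpha> \<beta>" using Beta_real_pos[OF assms(1,2)] by (auto simp: g'_def)
      ultimately have eq: "ennreal (beta_density \<alpha> \<beta> (1 / (1 + S))) * ennreal (g' S) =
        ennreal (1 / Beta \<alpha> \<beta>) * ennreal (S powr (\<beta> - 1) * (1 + S) powr (- \<alpha> - \<beta>))"
        by (simp only: ennreal_mult''[symmetric] ennreal_mult'[symmetric] less_imp_le)
      have ind: "indicator (einterval 0 \<infinity>) S = (1 :: ennreal)" "indicator {0<..} S = (1 :: ennreal)"
        using True by (simp_all add: einterval_def zero_ereal_def)
      have "F (1 - g S) * ennreal (g' S) = (ennreal (beta_density \<alpha> \<beta> (1 / (1 + S))) * ennreal (g' S)) * f (1 / (1 + S))"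
        unfolding F_def g by (simp only: mult_ac)
      then show ?thesis unfolding eq ind mult_1_right by (simp only: mult.assoc)
    qed (auto simp: einterval_def zero_ereal_def)
  qed
  also have "\<dots> = ennreal (1 / Beta \<alpha> \<beta>) * (\<integral>\<^sup>+S. ennreal (S powr (\<beta> - 1) * (1 + S) powr (- \<alpha> - \<beta>)) * f (1 / (1 + S)) * indicator {0<..} S \<partial>lborel)"
    by (intro nn_integral_cmult) measurable
  finally show ?thesis unfolding F_def .
qed

text \<open>The exponent count for \<open>step_density\<close>, with its letters and with
  \<open>T = 1 + S\<close>. Once the powers are written as exponentials, a linear identity between
  exponents remains.\<close>

lemma step_exponents:
  fixes V A B C Q u T w r d :: real
  assumes "0 < V" "0 < A" "0 < B" "0 < C" "0 < Q" "0 < u" "0 < T"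
  shows "V powr (2 * d - 1) * (A / B * (C / V\<^sup>2)) powr (d - 1) * T powr (1 - 2 * r) * w * (Q / A / T) * (A / B) * (u / V) =
    (C * A) powr (d - 1) * (u * Q) * (T powr (- 2 * r) * w * B powr (- d))"
proof -
  define v a b c t where "v = ln V" and "a = ln A" and "b = ln B" and "c = ln C" and "t = ln T"
  have e: "V = exp v" "A = exp a" "B = exp b" "C = exp c" "T = exp t"
    using assms by (simp_all add: v_def a_def b_def c_def t_def)
  have "A / B * (C / V\<^sup>2) = exp (a - b + c - 2 * v)"
    unfolding e by (simp add: exp_diff exp_add exp_double)
  then have p1: "(A / B * (C / V\<^sup>2)) powr (d - 1) = exp ((a - b + c - 2 * v) * (d - 1))"
    by (simp only: exp_powr_real)
  have "C * A = exp (c + a)" unfolding e by (simp add: exp_add)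
  then have p2: "(C * A) powr (d - 1) = exp ((c + a) * (d - 1))" by (simp only: exp_powr_real)
  have p3: "V powr (2 * d - 1) = exp (v * (2 * d - 1))" "T powr (1 - 2 * r) = exp (t * (1 - 2 * r))"
    "T powr (- 2 * r) = exp (t * (- 2 * r))" "B powr (- d) = exp (b * (- d))"
    unfolding e by (simp_all only: exp_powr_real)
  have p4: "Q / A / T = Q * exp (- a - t)" "A / B = exp (a - b)" "u / V = u * exp (- v)"
    unfolding e by (simp_all add: exp_diff exp_minus divide_inverse)
  have "V powr (2 * d - 1) * (A / B * (C / V\<^sup>2)) powr (d - 1) * T powr (1 - 2 * r) * w * (Q / A / T) * (A / B) * (u / V) =
    (w * Q * u) * exp (v * (2 * d - 1) + (a - b + c - 2 * v) * (d - 1) + t * (1 - 2 * r) + (- a - t) + (a - b) + (- v))"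
    unfolding p1 p3 p4(1) p4(3) unfolding p4(2) exp_add by (simp only: mult_ac)
  also have "v * (2 * d - 1) + (a - b + c - 2 * v) * (d - 1) + t * (1 - 2 * r) + (- a - t) + (a - b) + (- v) =
    (c + a) * (d - 1) + t * (- 2 * r) + b * (- d)" by (simp add: algebra_simps)
  also have "(w * Q * u) * exp \<dots> = (C * A) powr (d - 1) * (u * Q) * (T powr (- 2 * r) * w * B powr (- d))"
    unfolding p2 p3 exp_add by (simp only: mult_ac)
  finally show ?thesis .
qed

text \<open>On the left stand, in order, the residue coordinates of the old pair, the laws of
  \<open>b\<close> and \<open>c\<close>, the derivative of \<open>c\<close> in the smallest new
  zero, the scaling from \<open>v\<close> to the residues with \<open>e = 1\<close>, and the
  Jacobian from these residues to the zeros \<open>y\<close>. All powers of \<open>vand n x\<close>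
  cancel. The factors \<open>1 + x i ^ 2\<close> combine to the power \<open>- d\<close>, which
  turns the weights with parameter \<open>a\<close> at the \<open>x i\<close> into those with
  parameter \<open>a - of_real d\<close>.\<close>

lemma step_density:
  fixes x y v :: "nat \<Rightarrow> real"
  assumes n: "1 \<le> n" and il: "interlace (Suc n) y x"
    and v: "\<And>i. i \<in> {1..n} \<Longrightarrow> v i = (x i - y (Suc n)) / (1 + x i ^ 2) * resid 1 n x y i"
    and S: "S = (\<Sum>i\<in>{1..n}. v i)"
    and c: "c * (1 + S) = y (Suc n) + (\<Sum>i\<in>{1..n}. v i * (1 + x i ^ 2) / (x i - y (Suc n))) - (\<Sum>i\<in>{1..n}. v i * x i)"
  shows "vand n x powr (2 * d - 1) * (\<Prod>i\<in>{1..n}. v i) powr (d - 1) * (1 + S) powr (1 - 2 * Re a) * cauchy_weight a c *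
      ((1 + (\<Sum>i\<in>{1..n}. v i * (1 + x i ^ 2) / (x i - y (Suc n))^2)) / (1 + S)) *
      (\<Prod>i\<in>{1..n}. (x i - y (Suc n)) / (1 + x i ^ 2)) * (jac 1 n y / vand n x) =
    cross (Suc n) y x powr (d - 1) * vand (Suc n) y * (\<Prod>j\<in>{1..Suc n}. cauchy_weight a (y j)) /
      (\<Prod>i\<in>{1..n}. cauchy_weight (a - of_real d) (x i))"
proof -
  define s where "s = y (Suc n)"
  have sl: "slots 1 n x y" "s < x n" using il n by (auto simp: interlace_Suc_iff s_def)
  have sep: "y (Suc i) < x i \<and> x i < y i" if "i \<in> {1..n}" for i
    using il that unfolding interlace_def by auto
  have dec: "\<forall>i\<in>{1..<n}. x (Suc i) < x i" using interlace_imp_decreasing_inner[OF il] by simp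
  have ydec: "\<forall>i\<in>{1..<Suc n}. y (Suc i) < y i" by (rule interlace_imp_decreasing[OF il])
  note inj = inj_on_decreasing[OF dec]
  have xs: "0 < x i - s" if "i \<in> {1..n}" for i
    using slots_factor_pos(3)[OF dec sl(1) _ sl(2) n that] by simp
  have ys: "0 < y j - s" if "j \<in> {1..n}" for j
    using decreasing_less[OF ydec, of j "Suc n"] that by (simp add: s_def)
  have s_notin: "s \<notin> x ` {1..n}" using xs by force
  have sq: "0 < 1 + x i ^ 2" for i by (simp add: add_pos_nonneg)
  have rp: "0 < resid 1 n x y i" if "i \<in> {1..n}" for i using resid_pos[OF n dec sl(1) _ that] by simp
  have vp: "0 < v i" if "i \<in> {1..n}" for i
    unfolding v[OF that] using xs[OF that] rp[OF that] sq[of i] by (simp add: s_def)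
  have Sp: "0 < 1 + S" unfolding S using vp by (intro add_pos_nonneg sum_nonneg) (auto simp: less_imp_le)
  define V A B C Q u where "V = vand n x" and "A = (\<Prod>i\<in>{1..n}. x i - s)" and "B = (\<Prod>i\<in>{1..n}. 1 + x i ^ 2)"
    and "C = (\<Prod>i\<in>{1..n}. \<Prod>j\<in>{1..n}. \<bar>y j - x i\<bar>)" and "Q = (\<Prod>j\<in>{1..n}. y j - s)" and "u = vand n y"
  have ydec': "\<forall>i\<in>{1..<n}. y (Suc i) < y i" using ydec by simp
  have ne: "y j \<noteq> x i" if "i \<in> {1..n}" "j \<in> {1..n}" for i j
  proof (cases "j \<le> i")
    case True
    then have "y i \<le> y j" using decreasing_less[OF ydec, of j i] that by (cases "i = j") auto
    then show ?thesis using sep[OF that(1)] by simp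
  next
    case False
    then have "y j \<le> y (Suc i)" using decreasing_less[OF ydec, of "Suc i" j] that by (cases "j = Suc i") auto
    then show ?thesis using sep[OF that(1)] by simp
  qed
  have pos: "0 < V" "0 < A" "0 < B" "0 < C" "0 < Q" "0 < u"
    unfolding V_def A_def B_def C_def Q_def u_def using xs ys sq ne
    by (auto intro!: vand_pos inj prod_pos inj_on_decreasing[OF ydec'])
  have "(\<Prod>i\<in>{1..n}. v i) = (\<Prod>i\<in>{1..n}. (x i - s) / (1 + x i ^ 2) * \<bar>resid 1 n x y i\<bar>)"
    using v rp by (intro prod.cong) (auto simp: s_def abs_of_pos)
  also have "\<dots> = A / B * ((\<Prod>i\<in>{1..n}. \<bar>y 1 - 1 * x i\<bar>) * (\<Prod>i\<in>{1..n}. \<Prod>j\<in>{2..n}. \<bar>y j - x i\<bar>) / V\<^sup>2)"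
    unfolding prod.distrib prod_abs_resid V_def A_def B_def by (simp add: prod_dividef)
  also have "(\<Prod>i\<in>{1..n}. \<bar>y 1 - 1 * x i\<bar>) * (\<Prod>i\<in>{1..n}. \<Prod>j\<in>{2..n}. \<bar>y j - x i\<bar>) = C"
  proof -
    have "(\<Prod>j\<in>{1..n}. \<bar>y j - x i\<bar>) = \<bar>y 1 - 1 * x i\<bar> * (\<Prod>j\<in>{2..n}. \<bar>y j - x i\<bar>)" for i
      by (subst prod_split_first[OF n]) simp
    then show ?thesis by (simp only: C_def prod.distrib)
  qed
  finally have 1: "(\<Prod>i\<in>{1..n}. v i) = A / B * (C / V\<^sup>2)" .
  \<comment> \<open>Up to the factor \<open>1 + S\<close>, the derivative of \<open>c\<close> in
    \<open>s\<close> is the partial fraction expansion of \<open>ratio\<close> at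
    \<open>s\<close>.\<close>
  have "v i * (1 + x i ^ 2) / (x i - s)^2 = resid 1 n x y i / (x i - s)" if "i \<in> {1..n}" for i
    unfolding v[OF that] using xs[OF that] sq[of i] by (simp add: s_def power2_eq_square)
  then have "1 + (\<Sum>i\<in>{1..n}. v i * (1 + x i ^ 2) / (x i - s)^2) = ratio 1 n x y s"
    using partial_fractions[OF n inj s_notin, of 1 y] by simp
  also have "\<dots> = Q / A" unfolding ratio_def Q_def A_def prod_split_first[OF n, of "\<lambda>j. y j - s"] by simp
  finally have 2: "1 + (\<Sum>i\<in>{1..n}. v i * (1 + x i ^ 2) / (x i - s)^2) = Q / A" .
  have 3: "(\<Prod>i\<in>{1..n}. (x i - s) / (1 + x i ^ 2)) = A / B" by (simp add: A_def B_def prod_dividef)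
  have 4: "jac 1 n y = u" unfolding u_def by (rule jac_one_eq_vand[OF n ydec'])
  have "(\<Prod>j\<in>{1..n}. \<bar>y j - s\<bar>) = Q" unfolding Q_def using ys by (intro prod.cong) (auto simp: abs_of_pos)
  then have 5: "vand (Suc n) y = u * Q" by (simp add: vand_Suc u_def s_def)
  have "(\<Prod>j\<in>{1..n}. \<bar>s - x j\<bar>) = A" unfolding A_def using xs by (intro prod.cong) (auto simp: abs_if)
  moreover have "{1..<Suc n} = {1..n}" by auto
  moreover have "(\<Prod>i\<in>{1..n}. \<Prod>j\<in>{1..n}. \<bar>y i - x j\<bar>) = C" unfolding C_def by (rule prod.swap)
  ultimately have 6: "cross (Suc n) y x = C * A" unfolding cross_def s_def by simp
  have 7: "(\<Prod>j\<in>{1..Suc n}. cauchy_weight a (y j)) =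
      (1 + S) powr (- 2 * Re a) * cauchy_weight a c * (\<Prod>i\<in>{1..n}. cauchy_weight a (x i))"
    by (rule prod_cauchy_weight_separated[OF sep Sp recurrence_at_i[OF n inj s_notin[unfolded s_def] v S c]])
  have "cauchy_weight a (x i) = cauchy_weight (a - of_real d) (x i) * (1 + (x i)\<^sup>2) powr (- d)" for i
    using cauchy_weight_add_of_real[of "a - of_real d" d "x i"] by simp
  moreover have "(\<Prod>i\<in>{1..n}. (1 + (x i)\<^sup>2) powr (- d)) = B powr (- d)"
    unfolding B_def by (rule prod_powr_distrib[symmetric])
  ultimately have 8: "(\<Prod>i\<in>{1..n}. cauchy_weight a (x i)) = (\<Prod>i\<in>{1..n}. cauchy_weight (a - of_real d) (x i)) * B powr (- d)"
    by (simp only: prod.distrib)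
  have W: "(\<Prod>i\<in>{1..n}. cauchy_weight (a - of_real d) (x i)) \<noteq> 0"
    using cauchy_weight_pos[of "a - of_real d"] by (simp add: less_imp_neq[symmetric])
  show ?thesis
    unfolding s_def[symmetric] 1 2 3 4 5 6 7 8 V_def[symmetric] step_exponents[OF pos Sp] using W by simp
qed

section \<open>One step of the recurrence\<close>

text \<open>The zeros \<open>x\<close> stay fixed. The old pair \<open>(y, S)\<close> is absorbed
  into residues \<open>v\<close>, and \<open>c\<close> is exchanged for the smallest new zero
  \<open>s\<close>. At fixed \<open>s\<close>, the rescaled \<open>v\<close> are the residues with
  \<open>e = 1\<close> whose zeros are the remaining \<open>n\<close> new ones. On the right
  \<open>y\<close> denotes the new zeros.\<close>

lemma nn_integral_step:
  fixes x :: "nat \<Rightarrow> real" and d :: real and a :: complex and \<Phi> :: "real poly \<Rightarrow> ennreal"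
  assumes n: "1 \<le> n" and dec: "\<forall>i\<in>{1..<n}. x (Suc i) < x i" and \<Phi> [measurable]: "\<Phi> \<in> borel_measurable poly_borel"
  shows "(\<integral>\<^sup>+y. \<integral>\<^sup>+S. \<integral>\<^sup>+c. ennreal (S powr (n * d - 1) * cross n x y powr (d - 1) * vand (n - 1) y *
        (1 + S) powr (1 - 2 * Re a) * cauchy_weight a c) *
      \<Phi> (smult (1 + S) ([:- c, 1:] * root_poly {1..n} x) - smult S ([:1, 0, 1:] * root_poly {1..<n} y)) *
      (indicator {0<..} S * indicator {y. interlace n x y} y) \<partial>lborel \<partial>lborel \<partial>LB {1..<n}) =
    (\<integral>\<^sup>+y. ennreal (cross (Suc n) y x powr (d - 1) * vand (Suc n) y * (\<Prod>j\<in>{1..Suc n}. cauchy_weight a (y j)) /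
        (\<Prod>i\<in>{1..n}. cauchy_weight (a - of_real d) (x i))) * \<Phi> (root_poly {1..Suc n} y) *
      indicator {y. interlace (Suc n) y x} y \<partial>LB {1..Suc n})"
    (is "?L = (\<integral>\<^sup>+y. ?R y \<partial>LB {1..Suc n})")
proof -
  note inj = inj_on_decreasing[OF dec]
  have xn: "x n \<le> x i" if "i \<in> {1..n}" for i
    using decreasing_less[OF dec, of i n] that by (cases "i = n") auto
  define T where "T v c = smult (1 + (\<Sum>i\<in>{1..n}. v i)) ([:- c, 1:] * root_poly {1..n} x) - [:1, 0, 1:] * lagrange_poly n x v"
    for v and c :: real
  define f where "f v c = ennreal (cauchy_weight a c) * \<Phi> (T v c)" for v and c
  have f_meas [measurable]: "(\<lambda>w. f (g w) (h w)) \<in> borel_measurable N"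
    if g: "g \<in> measurable N (LB {1..n})" and [measurable]: "h \<in> borel_measurable N"
    for g and h and N :: "'b measure"
  proof -
    have gi: "(\<lambda>w. g w i) \<in> borel_measurable N" if "i \<in> {1..n}" for i
      using measurable_compose[OF g measurable_component_singleton[OF that]] by simp
    have "(\<lambda>w. T (g w) (h w)) \<in> measurable N poly_borel" unfolding T_def
      by (intro measurable_poly_diff measurable_poly_smult measurable_poly_mult measurable_lagrange_poly gi
          measurable_linear_poly measurable_const borel_measurable_add borel_measurable_sum borel_measurable_uminus) auto
    from measurable_compose[OF this \<Phi>] show ?thesis unfolding f_def by measurable
  qed
  define \<Psi> where "\<Psi> v = ennreal ((1 + (\<Sum>i\<in>{1..n}. v i)) powr (1 - 2 * Re a)) * (\<integral>\<^sup>+c. f v c \<partial>lborel)" for v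
  have measPsi [measurable]: "\<Psi> \<in> borel_measurable (LB {1..n})" unfolding \<Psi>_def by measurable
  define E where "E v = ennreal (vand n x powr (2 * d - 1)) * (ennreal ((\<Prod>i\<in>{1..n}. v i) powr (d - 1)) *
    ennreal ((1 + (\<Sum>i\<in>{1..n}. v i)) powr (1 - 2 * Re a)))" for v
  have [measurable]: "E \<in> borel_measurable (LB {1..n})" unfolding E_def by measurable
  define P where "P = {v :: nat \<Rightarrow> real. \<forall>i\<in>{1..n}. 0 < v i}"
  have indP: "indicator P = (\<lambda>v. if \<forall>i\<in>{1..n}. 0 < v i then 1 else 0 :: ennreal)"
    by (auto simp: P_def split: split_indicator)
  have [measurable]: "(indicator P :: _ \<Rightarrow> ennreal) \<in> borel_measurable (LB {1..n})" unfolding indP by measurable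
  define w where "w v i = v i * (1 + x i ^ 2)" for v i
  \<comment> \<open>\<open>C s v\<close> is the location \<open>c\<close> for which
    \<open>T v c\<close> vanishes at \<open>s\<close>, and \<open>D s v\<close> is its derivative in
    \<open>s\<close>.\<close>
  define C where "C s v = (s + (\<Sum>i\<in>{1..n}. w v i / (x i - s)) - (\<Sum>i\<in>{1..n}. v i * x i)) / (1 + (\<Sum>i\<in>{1..n}. v i))" for s v
  define D where "D s v = (1 + (\<Sum>i\<in>{1..n}. w v i / (x i - s)^2)) / (1 + (\<Sum>i\<in>{1..n}. v i))" for s v
  have [measurable]: "(\<lambda>p. C (fst p) (snd p)) \<in> borel_measurable (lborel \<Otimes>\<^sub>M LB {1..n})"
    "(\<lambda>p. D (fst p) (snd p)) \<in> borel_measurable (lborel \<Otimes>\<^sub>M LB {1..n})"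
    unfolding C_def D_def w_def by measurable
  define H where "H s v = E v * (f v (C s v) * ennreal (D s v) * indicator {..<x n} s)" for s v
  have measH [measurable]: "(\<lambda>p. H (fst p) (snd p)) \<in> borel_measurable (lborel \<Otimes>\<^sub>M LB {1..n})"
    unfolding H_def by measurable
  have measHP: "case_prod (\<lambda>s v. H s v * indicator P v) \<in> borel_measurable (lborel \<Otimes>\<^sub>M LB {1..n})"
    unfolding split_beta' by measurable
  have "?L = (\<integral>\<^sup>+y. \<integral>\<^sup>+S. ennreal (S powr (n * d - 1) * cross n x y powr (d - 1) * vand (n - 1) y) *
      \<Psi> (\<lambda>i\<in>{1..n}. resid 0 n x (y(0 := S) \<circ> (\<lambda>j. j - 1)) i) *
      indicator {0<..} S * indicator {y. interlace n x y} y \<partial>lborel \<partial>LB {1..<n})"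
  proof (intro nn_integral_cong)
    fix y :: "nat \<Rightarrow> real" and S :: real
    define Y where "Y = y(0 := S) \<circ> (\<lambda>j. j - 1)"
    define v where "v = (\<lambda>i\<in>{1..n}. resid 0 n x Y i)"
    have v_space: "v \<in> space (LB {1..n})" by (simp add: v_def space_PiM)
    have [measurable]: "f v \<in> borel_measurable lborel"
      using f_meas[of "\<lambda>_. v" lborel "\<lambda>c. c"] v_space by simp
    have sum: "(\<Sum>i\<in>{1..n}. v i) = S" using sum_resid_zero[OF n inj, of Y] by (simp add: v_def Y_def)
    have "lagrange_poly n x v = lagrange_poly n x (resid 0 n x Y)"
      unfolding lagrange_poly_def by (simp add: v_def)
    also have "\<dots> = smult S (root_poly {1..<n} y)"
      unfolding lagrange_poly_resid_zero[OF n inj] root_poly_def prod_shift by (simp add: Y_def)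
    finally have T: "T v c = smult (1 + S) ([:- c, 1:] * root_poly {1..n} x) - smult S ([:1, 0, 1:] * root_poly {1..<n} y)" for c
      unfolding T_def sum by (simp add: mult_smult_right)
    let ?A = "S powr (n * d - 1) * cross n x y powr (d - 1) * vand (n - 1) y"
    let ?B = "(1 + S) powr (1 - 2 * Re a)"
    let ?I = "indicator {0<..} S * indicator {y. interlace n x y} y :: ennreal"
    have A: "0 \<le> ?A" by (intro mult_nonneg_nonneg) (auto simp: vand_def prod_nonneg)
    have "(\<integral>\<^sup>+c. ennreal (?A * ?B * cauchy_weight a c) * \<Phi> (T v c) * ?I \<partial>lborel) =
      (\<integral>\<^sup>+c. ennreal ?A * ennreal ?B * ?I * f v c \<partial>lborel)"
    proof (rule nn_integral_cong)
      fix c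
      have "ennreal (?A * ?B * cauchy_weight a c) = ennreal ?A * ennreal ?B * ennreal (cauchy_weight a c)"
        using A cauchy_weight_pos[of a c] by (simp only: ennreal_mult mult_nonneg_nonneg powr_ge_zero less_imp_le)
      then show "ennreal (?A * ?B * cauchy_weight a c) * \<Phi> (T v c) * ?I = ennreal ?A * ennreal ?B * ?I * f v c"
        unfolding f_def by (simp only: mult_ac)
    qed
    also have "\<dots> = ennreal ?A * ennreal ?B * ?I * (\<integral>\<^sup>+c. f v c \<partial>lborel)"
      by (rule nn_integral_cmult) measurable
    also have "\<dots> = ennreal ?A * \<Psi> v * indicator {0<..} S * indicator {y. interlace n x y} y"
      unfolding \<Psi>_def sum by (simp only: mult_ac)
    finally show "(\<integral>\<^sup>+c. ennreal (?A * ?B * cauchy_weight a c) *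
        \<Phi> (smult (1 + S) ([:- c, 1:] * root_poly {1..n} x) - smult S ([:1, 0, 1:] * root_poly {1..<n} y)) * ?I \<partial>lborel) =
      ennreal ?A * \<Psi> (\<lambda>i\<in>{1..n}. resid 0 n x (y(0 := S) \<circ> (\<lambda>j. j - 1)) i) * indicator {0<..} S * indicator {y. interlace n x y} y"
      unfolding T unfolding v_def Y_def .
  qed
  also have "\<dots> = ennreal (vand n x powr (2 * d - 1)) *
      (\<integral>\<^sup>+v. ennreal ((\<Prod>i\<in>{1..n}. v i) powr (d - 1)) * \<Psi> v * indicator P v \<partial>LB {1..n})"
    unfolding P_def by (rule nn_integral_interlacing[OF n dec measPsi])
  also have "\<dots> = (\<integral>\<^sup>+v. ennreal (vand n x powr (2 * d - 1)) * (ennreal ((\<Prod>i\<in>{1..n}. v i) powr (d - 1)) * \<Psi> v * indicator P v) \<partial>LB {1..n})"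
    by (rule nn_integral_cmult[symmetric]) measurable
  also have "\<dots> = (\<integral>\<^sup>+v. \<integral>\<^sup>+s. H s v * indicator P v \<partial>lborel \<partial>LB {1..n})"
  proof (rule nn_integral_cong)
    fix v assume v: "v \<in> space (LB {1..n})"
    have fv: "f v \<in> borel_measurable borel"
      using f_meas[of "\<lambda>_. v" lborel "\<lambda>c. c"] v by simp
    have [measurable]: "(\<lambda>s. f v (C s v) * ennreal (D s v) * indicator {..<x n} s) \<in> borel_measurable lborel"
      using fv unfolding C_def D_def by measurable
    show "ennreal (vand n x powr (2 * d - 1)) * (ennreal ((\<Prod>i\<in>{1..n}. v i) powr (d - 1)) * \<Psi> v * indicator P v) =
      (\<integral>\<^sup>+s. H s v * indicator P v \<partial>lborel)"
    proof (cases "v \<in> P")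
      case False
      then show ?thesis by simp
    next
      case True
      then have vp: "0 < v i" if "i \<in> {1..n}" for i using that by (simp add: P_def)
      have sq: "0 < 1 + x i ^ 2" for i by (simp add: add_pos_nonneg)
      have wp: "0 < w v i" if "i \<in> {1..n}" for i unfolding w_def using vp[OF that] sq by (rule mult_pos_pos)
      have Sp: "0 < 1 + (\<Sum>i\<in>{1..n}. v i)" using vp by (intro add_pos_nonneg sum_nonneg) (auto simp: less_imp_le)
      have "(\<integral>\<^sup>+c. f v c \<partial>lborel) = (\<integral>\<^sup>+s. f v (C s v) * ennreal (D s v) * indicator {..<x n} s \<partial>lborel)"
        unfolding C_def D_def by (intro nn_integral_shift n Sp xn wp fv)
      then have "ennreal (vand n x powr (2 * d - 1)) * (ennreal ((\<Prod>i\<in>{1..n}. v i) powr (d - 1)) * \<Psi> v) =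
        E v * (\<integral>\<^sup>+s. f v (C s v) * ennreal (D s v) * indicator {..<x n} s \<partial>lborel)"
        unfolding \<Psi>_def E_def by (simp only: mult.assoc)
      also have "\<dots> = (\<integral>\<^sup>+s. H s v \<partial>lborel)"
        unfolding H_def by (rule nn_integral_cmult[symmetric]) measurable
      finally show ?thesis using True by simp
    qed
  qed
  also have "\<dots> = (\<integral>\<^sup>+s. \<integral>\<^sup>+v. H s v * indicator P v \<partial>LB {1..n} \<partial>lborel)"
    by (intro nn_integral_LB_swap lborel.sigma_finite_measure_axioms measHP) simp
  also have "\<dots> = (\<integral>\<^sup>+s. \<integral>\<^sup>+y. ?R (y(Suc n := s)) \<partial>LB {1..n} \<partial>lborel)"
  proof (rule nn_integral_cong)
    fix s :: real
    have il: "interlace (Suc n) (y(Suc n := s)) x \<longleftrightarrow> slots 1 n x y \<and> s < x n" for y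
    proof -
      have "slots 1 n x (y(Suc n := s)) = slots 1 n x y" by (intro slots_cong n) auto
      then show ?thesis by (simp add: interlace_Suc_iff[OF n])
    qed
    show "(\<integral>\<^sup>+v. H s v * indicator P v \<partial>LB {1..n}) = (\<integral>\<^sup>+y. ?R (y(Suc n := s)) \<partial>LB {1..n})"
    proof (cases "s < x n")
      case False
      then show ?thesis by (simp add: H_def il)
    next
      case s: True
      define r where "r i = (x i - s) / (1 + x i ^ 2)" for i
      have sq: "0 < 1 + x i ^ 2" for i by (simp add: add_pos_nonneg)
      have r: "0 < r i" if "i \<in> {1..n}" for i
        unfolding r_def using xn[OF that] s sq by (intro divide_pos_pos) auto
      have rP: "0 \<le> (\<Prod>i\<in>{1..n}. r i)" using r by (intro prod_nonneg) (auto simp: less_imp_le)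
      define F where "F v = H s (\<lambda>i\<in>{1..n}. r i * v i) * ennreal (\<Prod>i\<in>{1..n}. r i)" for v :: "nat \<Rightarrow> real"
      have Hs: "H s \<in> borel_measurable (LB {1..n})"
        using measurable_compose_Pair1[OF _ measH, of s] by simp
      have measF: "F \<in> borel_measurable (LB {1..n})"
        unfolding F_def using Hs by measurable
      have "(\<lambda>i\<in>{1..n}. r i * v i) \<in> P \<longleftrightarrow> v \<in> P" for v
      proof -
        have "0 < r i * v i \<longleftrightarrow> 0 < v i" if "i \<in> {1..n}" for i using r[OF that] by (simp add: zero_less_mult_iff)
        then show ?thesis by (simp add: P_def)
      qed
      then have scale: "H s (\<lambda>i\<in>{1..n}. r i * v i) * indicator P (\<lambda>i\<in>{1..n}. r i * v i) * ennreal (\<Prod>i\<in>{1..n}. r i) =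
        F v * indicator P v" for v
        by (simp add: F_def split: split_indicator)
      have HP: "(\<lambda>v. H s v * indicator P v) \<in> borel_measurable (LB {1..n})"
        using Hs by measurable
      have "(\<integral>\<^sup>+v. H s v * indicator P v \<partial>LB {1..n}) = (\<integral>\<^sup>+v. F v * indicator P v \<partial>LB {1..n})"
        using nn_integral_LB_scale[of "{1..n}" r, OF finite_atLeastAtMost r HP] unfolding scale .
      also have "\<dots> = (\<integral>\<^sup>+y. F (\<lambda>i\<in>{1..n}. resid 1 n x (y \<circ> (\<lambda>i. i)) i) * ennreal (jac 1 n (y \<circ> (\<lambda>i. i)) / vand n x) *
          indicator {y. slots 1 n x (y \<circ> (\<lambda>i. i))} y \<partial>LB ((\<lambda>i. i) ` {1..n}))"
        unfolding P_def using n dec measF by (intro nn_integral_residues) auto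
      also have "\<dots> = (\<integral>\<^sup>+y. F (\<lambda>i\<in>{1..n}. resid 1 n x y i) * ennreal (jac 1 n y / vand n x) *
          indicator {y. slots 1 n x y} y \<partial>LB {1..n})"
        by (simp add: comp_def)
      also have "\<dots> = (\<integral>\<^sup>+y. ?R (y(Suc n := s)) \<partial>LB {1..n})"
      proof (rule nn_integral_cong)
        fix y :: "nat \<Rightarrow> real"
        show "F (\<lambda>i\<in>{1..n}. resid 1 n x y i) * ennreal (jac 1 n y / vand n x) * indicator {y. slots 1 n x y} y = ?R (y(Suc n := s))"
        proof (cases "slots 1 n x y")
          case False
          then show ?thesis by (simp add: il)
        next
          case sl: True
          define z where "z = y(Suc n := s)"
          have ilz: "interlace (Suc n) z x" using sl s by (simp add: z_def il)
          have zs: "z (Suc n) = s" by (simp add: z_def)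
          have cong: "resid 1 n x y i = resid 1 n x z i" "jac 1 n y = jac 1 n z" for i
            by (rule resid_cong jac_cong, simp add: z_def, rule n)+
          define v where "v = (\<lambda>i\<in>{1..n}. r i * (\<lambda>i\<in>{1..n}. resid 1 n x y i) i)"
          have v: "v i = (x i - z (Suc n)) / (1 + x i ^ 2) * resid 1 n x z i" if "i \<in> {1..n}" for i
            using that by (simp add: v_def r_def zs cong(1))
          have vp: "0 \<le> v i" if "i \<in> {1..n}" for i
            using r[OF that] resid_pos[OF n dec sl _ that] that by (simp add: v_def)
          define S where "S = (\<Sum>i\<in>{1..n}. v i)"
          have S0: "0 \<le> S" unfolding S_def using vp by (rule sum_nonneg)
          then have Sp: "0 < 1 + S" by simp
          define c where "c = C s v"
          have c: "c * (1 + S) = z (Suc n) + (\<Sum>i\<in>{1..n}. v i * (1 + x i ^ 2) / (x i - z (Suc n))) - (\<Sum>i\<in>{1..n}. v i * x i)"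
            unfolding c_def C_def w_def S_def[symmetric] zs using Sp by simp
          have notin: "z (Suc n) \<notin> x ` {1..n}" using xn s zs by force
          have T: "T v c = root_poly {1..Suc n} z"
            unfolding T_def S_def[symmetric] by (rule recurrence_root_poly[OF n inj notin v S_def c])
          have Dp: "0 \<le> D s v" unfolding D_def S_def[symmetric] w_def using vp S0 sq
            by (intro divide_nonneg_nonneg add_nonneg_nonneg sum_nonneg mult_nonneg_nonneg) (auto simp: less_imp_le)
          have Jp: "0 \<le> jac 1 n z / vand n x"
            using jac_pos[OF n dec sl] vand_pos[OF inj] by (simp add: cong(2)[symmetric])
          have "F (\<lambda>i\<in>{1..n}. resid 1 n x y i) * ennreal (jac 1 n y / vand n x) =
            (ennreal (vand n x powr (2 * d - 1)) * ennreal ((\<Prod>i\<in>{1..n}. v i) powr (d - 1)) * ennreal ((1 + S) powr (1 - 2 * Re a)) *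
              ennreal (cauchy_weight a c) * ennreal (D s v) * ennreal (\<Prod>i\<in>{1..n}. r i) * ennreal (jac 1 n z / vand n x)) * \<Phi> (root_poly {1..Suc n} z)"
            unfolding F_def v_def[symmetric] H_def E_def f_def c_def[symmetric] T S_def[symmetric] cong(2)
            using s by simp (simp only: mult_ac)
          also have "ennreal (vand n x powr (2 * d - 1)) * ennreal ((\<Prod>i\<in>{1..n}. v i) powr (d - 1)) * ennreal ((1 + S) powr (1 - 2 * Re a)) *
              ennreal (cauchy_weight a c) * ennreal (D s v) * ennreal (\<Prod>i\<in>{1..n}. r i) * ennreal (jac 1 n z / vand n x) =
            ennreal (vand n x powr (2 * d - 1) * (\<Prod>i\<in>{1..n}. v i) powr (d - 1) * (1 + S) powr (1 - 2 * Re a) *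
              cauchy_weight a c * D s v * (\<Prod>i\<in>{1..n}. r i) * (jac 1 n z / vand n x))"
            using Dp rP Jp cauchy_weight_pos[of a c]
            by (simp only: ennreal_mult mult_nonneg_nonneg powr_ge_zero less_imp_le)
          also have "vand n x powr (2 * d - 1) * (\<Prod>i\<in>{1..n}. v i) powr (d - 1) * (1 + S) powr (1 - 2 * Re a) *
              cauchy_weight a c * D s v * (\<Prod>i\<in>{1..n}. r i) * (jac 1 n z / vand n x) =
            cross (Suc n) z x powr (d - 1) * vand (Suc n) z * (\<Prod>j\<in>{1..Suc n}. cauchy_weight a (z j)) /
              (\<Prod>i\<in>{1..n}. cauchy_weight (a - of_real d) (x i))"
            using step_density[OF n ilz v S_def c, of d a] unfolding D_def w_def r_def zs S_def[symmetric] .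
          finally have eq: "F (\<lambda>i\<in>{1..n}. resid 1 n x y i) * ennreal (jac 1 n y / vand n x) =
            ennreal (cross (Suc n) z x powr (d - 1) * vand (Suc n) z * (\<Prod>j\<in>{1..Suc n}. cauchy_weight a (z j)) /
              (\<Prod>i\<in>{1..n}. cauchy_weight (a - of_real d) (x i))) * \<Phi> (root_poly {1..Suc n} z)" .
          have ind: "indicator {y. slots 1 n x y} y = (1 :: ennreal)" "indicator {y. interlace (Suc n) y x} z = (1 :: ennreal)"
            using sl ilz by simp_all
          show ?thesis unfolding z_def[symmetric] ind mult_1_right by (rule eq)
        qed
      qed
      finally show ?thesis .
    qed
  qed
  also have "\<dots> = (\<integral>\<^sup>+y. ?R y \<partial>LB {1..Suc n})"
  proof -
    have ins: "{1..Suc n} = insert (Suc n) {1..n}" by auto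
    have "?R \<in> borel_measurable (LB {1..Suc n})"
      unfolding cross_def vand_def interlace_def by measurable
    then show ?thesis unfolding ins by (intro LB.product_nn_integral_insert_rev[symmetric]) auto
  qed
  finally show ?thesis .
qed

section \<open>Unnormalized joint law of consecutive polynomials\<close>

definition joint_density :: "nat \<Rightarrow> complex \<Rightarrow> real \<Rightarrow> (nat \<Rightarrow> real) \<Rightarrow> (nat \<Rightarrow> real) \<Rightarrow> ennreal" where
  "joint_density n a d x y =
     ennreal (vand n x * (\<Prod>j\<in>{1..n}. cauchy_weight a (x j))) *
     (ennreal (cross n x y powr (d - 1) * vand (n - 1) y) * indicator {y. interlace n x y} y)"

lemma vand_nonneg: "0 \<le> vand n x"
  unfolding vand_def by (intro prod_nonneg) auto

lemma measurable_joint_density: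
  "(\<lambda>p. joint_density n a d (fst p) (snd p)) \<in> borel_measurable (LB {1..n} \<Otimes>\<^sub>M LB {1..<n})"
proof -
  have [measurable]: "(\<lambda>p. (snd p) i) \<in> borel_measurable (LB {1..n} \<Otimes>\<^sub>M LB {1..<n})" if "i \<in> {1..n - 1}" for i
    using that by (intro measurable_compose[OF measurable_snd]) auto
  show ?thesis unfolding joint_density_def cross_def vand_def interlace_def by measurable
qed

text \<open>The transition operator of the Markov chain: \<open>F\<close> at the next pair, averaged
  over \<open>b\<close> and \<open>c\<close> while the current pair \<open>p\<close> is held
  fixed.\<close>

definition transition :: "real \<Rightarrow> real \<Rightarrow> complex \<Rightarrow> (real poly \<times> real poly \<Rightarrow> ennreal) \<Rightarrow> real poly \<times> real poly \<Rightarrow> ennreal" where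
  "transition \<alpha> \<beta> a F p = (\<integral>\<^sup>+b. ennreal (beta_density \<alpha> \<beta> b) * (\<integral>\<^sup>+c. ennreal (cauchy_density a c) *
     F (smult (1 / b) ([:- c, 1:] * fst p) + smult (1 - 1 / b) ([:1, 0, 1:] * snd p), fst p) \<partial>lborel) \<partial>lborel)"

lemma measurable_recurrence:
  assumes [measurable]: "b \<in> borel_measurable N" "c \<in> borel_measurable N" "p \<in> measurable N poly_borel" "q \<in> measurable N poly_borel"
  shows "(\<lambda>w. smult (1 / b w) ([:- c w, 1:] * p w) + smult (1 - 1 / b w) ([:1, 0, 1:] * q w)) \<in> measurable N poly_borel"
  by (intro measurable_poly_add measurable_poly_smult measurable_poly_mult measurable_linear_poly measurable_const) auto

lemma borel_measurable_beta_density [measurable]: "beta_density \<alpha> \<beta> \<in> borel_measurable borel"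
  unfolding beta_density_def by measurable

lemma borel_measurable_cauchy_density [measurable]: "cauchy_density a \<in> borel_measurable borel"
  unfolding cauchy_density_def by measurable

lemma measurable_transition:
  assumes F: "F \<in> borel_measurable (poly_borel \<Otimes>\<^sub>M poly_borel)"
  shows "transition \<alpha> \<beta> a F \<in> borel_measurable (poly_borel \<Otimes>\<^sub>M poly_borel)"
proof -
  have [measurable]: "(\<lambda>w. F (smult (1 / b w) ([:- c w, 1:] * p w) + smult (1 - 1 / b w) ([:1, 0, 1:] * q w), p w)) \<in> borel_measurable N"
    if "b \<in> borel_measurable N" "c \<in> borel_measurable N" "p \<in> measurable N poly_borel" "q \<in> measurable N poly_borel"
    for b c p q and N :: "'b measure"
    by (intro measurable_compose[OF _ F] measurable_Pair measurable_recurrence that)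
  show ?thesis unfolding transition_def[abs_def] by measurable
qed

text \<open>The parameters of the beta law are tuned so that its density in \<open>S\<close>
  supplies exactly the powers of \<open>S\<close> and \<open>1 + S\<close> in
  \<open>nn_integral_step\<close>. From left to right \<open>x\<close> changes its role: the outer
  zeros become the inner ones.\<close>

lemma joint_density_step_fixed:
  fixes d :: real and a :: complex and F :: "real poly \<times> real poly \<Rightarrow> ennreal"
  assumes n: "1 \<le> n" and pos: "0 < \<alpha>" "0 < \<beta>" and \<beta>: "\<beta> = n * d" and \<alpha>: "\<alpha> = 2 * Re a - n * d - 1"
    and F: "F \<in> borel_measurable (poly_borel \<Otimes>\<^sub>M poly_borel)"
    and C: "C = Re (Gamma a * Gamma (cnj a)) / (pi * 2 powr (2 * (1 - Re a)) * Gamma (2 * Re a - 1))"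
  shows "(\<integral>\<^sup>+y. joint_density n (a - of_real d) d x y * transition \<alpha> \<beta> a F (root_poly {1..n} x, root_poly {1..<n} y) \<partial>LB {1..<n}) =
    ennreal (1 / Beta \<alpha> \<beta>) * ennreal C *
      (\<integral>\<^sup>+y. joint_density (Suc n) a d y x * F (root_poly {1..Suc n} y, root_poly {1..n} x) \<partial>LB {1..Suc n})"
proof (cases "\<forall>i\<in>{1..<n}. x (Suc i) < x i")
  case False
  then have "\<not> interlace n x y" "\<not> interlace (Suc n) y x" for y
    using interlace_imp_decreasing[of n x y] interlace_imp_decreasing_inner[of "Suc n" y x] by auto
  then show ?thesis by (simp add: joint_density_def)
next
  case dec: True
  define \<Phi> where "\<Phi> p = F (p, root_poly {1..n} x)" for p
  have \<Phi> [measurable]: "\<Phi> \<in> borel_measurable poly_borel" unfolding \<Phi>_def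
    by (intro measurable_compose[OF _ F] measurable_Pair measurable_const) auto
  define Q where "Q S c y = smult (1 + S) ([:- c, 1:] * root_poly {1..n} x) - smult S ([:1, 0, 1:] * root_poly {1..<n} y)"
    for S c :: real and y
  have Q_meas: "(\<lambda>w. \<Phi> (Q (S w) (c w) (y w))) \<in> borel_measurable N"
    if [measurable]: "S \<in> borel_measurable N" "c \<in> borel_measurable N" and y: "\<And>i. i \<in> {1..<n} \<Longrightarrow> (\<lambda>w. y w i) \<in> borel_measurable N"
    for S c y and N :: "'b measure"
    unfolding Q_def by (intro measurable_compose[OF _ \<Phi>] measurable_poly_diff measurable_poly_smult measurable_poly_mult
        measurable_root_poly measurable_linear_poly measurable_const y) auto
  define W where "W = (\<Prod>j\<in>{1..n}. cauchy_weight (a - of_real d) (x j))"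
  have W: "0 < W" unfolding W_def by (intro prod_pos) (auto simp: cauchy_weight_pos)
  define h where "h y S c = ennreal (S powr (n * d - 1) * cross n x y powr (d - 1) * vand (n - 1) y *
        (1 + S) powr (1 - 2 * Re a) * cauchy_weight a c) * \<Phi> (Q S c y) *
      (indicator {0<..} S * indicator {y. interlace n x y} y)" for y S c
  have h_meas: "(\<lambda>w. h (fst (fst w)) (snd (fst w)) (snd w)) \<in> borel_measurable ((LB {1..<n} \<Otimes>\<^sub>M lborel) \<Otimes>\<^sub>M lborel)"
  proof -
    have c1 [measurable]: "(\<lambda>w. (fst (fst w)) i) \<in> borel_measurable ((LB {1..<n} \<Otimes>\<^sub>M lborel) \<Otimes>\<^sub>M (lborel :: real measure))" if "i \<in> {1..<n}" for i
      using that by measurable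
    have c2 [measurable]: "(\<lambda>w. (fst (fst w)) i) \<in> borel_measurable ((LB {1..<n} \<Otimes>\<^sub>M lborel) \<Otimes>\<^sub>M (lborel :: real measure))" if "i \<in> {1..n - 1}" for i
      using c1[of i] that n by auto
    have [measurable]: "(\<lambda>w. \<Phi> (Q (snd (fst w)) (snd w) (fst (fst w)))) \<in> borel_measurable ((LB {1..<n} \<Otimes>\<^sub>M lborel) \<Otimes>\<^sub>M lborel)"
      by (intro Q_meas c1) measurable
    show ?thesis unfolding h_def cross_def vand_def interlace_def by measurable
  qed
  have key: "ennreal (cross n x y powr (d - 1) * vand (n - 1) y) * indicator {y. interlace n x y} y *
      transition \<alpha> \<beta> a F (root_poly {1..n} x, root_poly {1..<n} y) =
    ennreal (1 / Beta \<alpha> \<beta>) * ennreal C * (\<integral>\<^sup>+S. \<integral>\<^sup>+c. h y S c \<partial>lborel \<partial>lborel)" if y: "y \<in> space (LB {1..<n})" for y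
  proof -
    define q where "q = root_poly {1..<n} y"
    define g where "g b = (\<integral>\<^sup>+c. ennreal (cauchy_density a c) *
      \<Phi> (smult (1 / b) ([:- c, 1:] * root_poly {1..n} x) + smult (1 - 1 / b) ([:1, 0, 1:] * q)) \<partial>lborel)" for b
    have [measurable]: "(\<lambda>w. \<Phi> (smult (1 / b w) ([:- c w, 1:] * root_poly {1..n} x) + smult (1 - 1 / b w) ([:1, 0, 1:] * q))) \<in> borel_measurable N"
      if "b \<in> borel_measurable N" "c \<in> borel_measurable N" for b c and N :: "'b measure"
      by (intro measurable_compose[OF _ \<Phi>] measurable_recurrence that measurable_const) auto
    have [measurable]: "g \<in> borel_measurable borel" unfolding g_def by measurable
    have [measurable]: "(\<lambda>w. \<Phi> (Q (S w) (c w) y)) \<in> borel_measurable N"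
      if "S \<in> borel_measurable N" "c \<in> borel_measurable N" for S c and N :: "'b measure"
      by (intro Q_meas that) auto
    let ?I = "indicator {y. interlace n x y} y :: ennreal"
    let ?A = "cross n x y powr (d - 1) * vand (n - 1) y"
    have g: "ennreal ?A * ?I * (ennreal (S powr (\<beta> - 1) * (1 + S) powr (- \<alpha> - \<beta>)) * g (1 / (1 + S)) * indicator {0<..} S) =
      ennreal C * (\<integral>\<^sup>+c. h y S c \<partial>lborel)" for S
    proof (cases "0 < S")
      case False
      then show ?thesis by (simp add: h_def)
    next
      case S: True
      \<comment> \<open>At \<open>b = 1 / (1 + S)\<close> the coefficients \<open>1 / b\<close> and
        \<open>1 - 1 / b\<close> of the recurrence are \<open>1 + S\<close> and
        \<open>- S\<close>.\<close>
      have e: "1 / (1 / (1 + S)) = 1 + S" "1 - (1 + S) = - S" by simp_all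
      have ab: "- \<alpha> - \<beta> = 1 - 2 * Re a" "\<beta> - 1 = n * d - 1" by (simp_all add: \<alpha> \<beta>)
      have "g (1 / (1 + S)) = (\<integral>\<^sup>+c. ennreal C * (ennreal (cauchy_weight a c) * \<Phi> (Q S c y)) \<partial>lborel)"
        unfolding g_def e
      proof (rule nn_integral_cong)
        fix c
        have "ennreal (cauchy_density a c) = ennreal C * ennreal (cauchy_weight a c)"
          using cauchy_weight_pos[of a c] unfolding cauchy_density_def C[symmetric] by (simp only: ennreal_mult'' less_imp_le)
        moreover have "smult (1 + S) ([:- c, 1:] * root_poly {1..n} x) + smult (- S) ([:1, 0, 1:] * q) = Q S c y"
          unfolding Q_def q_def smult_minus_left by (rule add_uminus_conv_diff)
        ultimately show "ennreal (cauchy_density a c) * \<Phi> (smult (1 + S) ([:- c, 1:] * root_poly {1..n} x) + smult (- S) ([:1, 0, 1:] * q)) =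
          ennreal C * (ennreal (cauchy_weight a c) * \<Phi> (Q S c y))" by (simp only: mult.assoc)
      qed
      also have "\<dots> = ennreal C * (\<integral>\<^sup>+c. ennreal (cauchy_weight a c) * \<Phi> (Q S c y) \<partial>lborel)"
        by (rule nn_integral_cmult) measurable
      finally have "ennreal ?A * ?I * (ennreal (S powr (\<beta> - 1) * (1 + S) powr (- \<alpha> - \<beta>)) * g (1 / (1 + S)) * indicator {0<..} S) =
        ennreal C * (ennreal ?A * ennreal (S powr (\<beta> - 1) * (1 + S) powr (- \<alpha> - \<beta>)) * (indicator {0<..} S * ?I) *
          (\<integral>\<^sup>+c. ennreal (cauchy_weight a c) * \<Phi> (Q S c y) \<partial>lborel))"
        by (simp only: mult_ac)
      also have "ennreal ?A * ennreal (S powr (\<beta> - 1) * (1 + S) powr (- \<alpha> - \<beta>)) * (indicator {0<..} S * ?I) *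
          (\<integral>\<^sup>+c. ennreal (cauchy_weight a c) * \<Phi> (Q S c y) \<partial>lborel) =
        (\<integral>\<^sup>+c. ennreal ?A * ennreal (S powr (\<beta> - 1) * (1 + S) powr (- \<alpha> - \<beta>)) * (indicator {0<..} S * ?I) *
          (ennreal (cauchy_weight a c) * \<Phi> (Q S c y)) \<partial>lborel)"
        by (rule nn_integral_cmult[symmetric]) measurable
      also have "\<dots> = (\<integral>\<^sup>+c. h y S c \<partial>lborel)"
      proof (rule nn_integral_cong)
        fix c
        have "S powr (n * d - 1) * cross n x y powr (d - 1) * vand (n - 1) y * (1 + S) powr (1 - 2 * Re a) * cauchy_weight a c =
          ?A * (S powr (\<beta> - 1) * (1 + S) powr (- \<alpha> - \<beta>)) * cauchy_weight a c" unfolding ab by (simp only: mult_ac)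
        also have "ennreal \<dots> = ennreal ?A * ennreal (S powr (\<beta> - 1) * (1 + S) powr (- \<alpha> - \<beta>)) * ennreal (cauchy_weight a c)"
          using cauchy_weight_pos[of a c] vand_nonneg[of "n - 1" y]
          by (simp only: ennreal_mult mult_nonneg_nonneg powr_ge_zero less_imp_le)
        finally show "ennreal ?A * ennreal (S powr (\<beta> - 1) * (1 + S) powr (- \<alpha> - \<beta>)) * (indicator {0<..} S * ?I) *
          (ennreal (cauchy_weight a c) * \<Phi> (Q S c y)) = h y S c"
          unfolding h_def by (simp only: mult_ac)
      qed
      finally show ?thesis .
    qed
    have "transition \<alpha> \<beta> a F (root_poly {1..n} x, q) = (\<integral>\<^sup>+b. ennreal (beta_density \<alpha> \<beta> b) * g b \<partial>lborel)"
      unfolding transition_def g_def \<Phi>_def by simp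
    also have "\<dots> = ennreal (1 / Beta \<alpha> \<beta>) *
      (\<integral>\<^sup>+S. ennreal (S powr (\<beta> - 1) * (1 + S) powr (- \<alpha> - \<beta>)) * g (1 / (1 + S)) * indicator {0<..} S \<partial>lborel)"
      by (intro nn_integral_beta_density pos) measurable
    finally have "ennreal ?A * ?I * transition \<alpha> \<beta> a F (root_poly {1..n} x, q) = ennreal (1 / Beta \<alpha> \<beta>) * (ennreal ?A * ?I *
      (\<integral>\<^sup>+S. ennreal (S powr (\<beta> - 1) * (1 + S) powr (- \<alpha> - \<beta>)) * g (1 / (1 + S)) * indicator {0<..} S \<partial>lborel))"
      by (simp only: mult_ac)
    also have "ennreal ?A * ?I * (\<integral>\<^sup>+S. ennreal (S powr (\<beta> - 1) * (1 + S) powr (- \<alpha> - \<beta>)) * g (1 / (1 + S)) * indicator {0<..} S \<partial>lborel) =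
      (\<integral>\<^sup>+S. ennreal C * (\<integral>\<^sup>+c. h y S c \<partial>lborel) \<partial>lborel)"
      unfolding g[symmetric] by (rule nn_integral_cmult[symmetric]) measurable
    also have "\<dots> = ennreal C * (\<integral>\<^sup>+S. \<integral>\<^sup>+c. h y S c \<partial>lborel \<partial>lborel)"
      unfolding h_def by (rule nn_integral_cmult) measurable
    finally show ?thesis unfolding q_def by (simp only: mult.assoc)
  qed
  have "(\<integral>\<^sup>+y. joint_density n (a - of_real d) d x y * transition \<alpha> \<beta> a F (root_poly {1..n} x, root_poly {1..<n} y) \<partial>LB {1..<n}) =
    (\<integral>\<^sup>+y. ennreal (vand n x * W) * (ennreal (1 / Beta \<alpha> \<beta>) * ennreal C) * (\<integral>\<^sup>+S. \<integral>\<^sup>+c. h y S c \<partial>lborel \<partial>lborel) \<partial>LB {1..<n})"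
    unfolding joint_density_def W_def[symmetric] by (intro nn_integral_cong) (simp only: mult.assoc key[unfolded mult.assoc])
  also have "\<dots> = ennreal (vand n x * W) * (ennreal (1 / Beta \<alpha> \<beta>) * ennreal C) * (\<integral>\<^sup>+y. \<integral>\<^sup>+S. \<integral>\<^sup>+c. h y S c \<partial>lborel \<partial>lborel \<partial>LB {1..<n})"
  proof (rule nn_integral_cmult)
    have "(\<lambda>w. \<integral>\<^sup>+c. h (fst w) (snd w) c \<partial>lborel) \<in> borel_measurable (LB {1..<n} \<Otimes>\<^sub>M lborel)"
      by (rule lborel.borel_measurable_nn_integral) (use h_meas in \<open>simp add: split_beta'\<close>)
    then show "(\<lambda>y. \<integral>\<^sup>+S. \<integral>\<^sup>+c. h y S c \<partial>lborel \<partial>lborel) \<in> borel_measurable (LB {1..<n})"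
      by (intro lborel.borel_measurable_nn_integral) (simp add: split_beta')
  qed
  also have "(\<integral>\<^sup>+y. \<integral>\<^sup>+S. \<integral>\<^sup>+c. h y S c \<partial>lborel \<partial>lborel \<partial>LB {1..<n}) =
    (\<integral>\<^sup>+y. ennreal (cross (Suc n) y x powr (d - 1) * vand (Suc n) y * (\<Prod>j\<in>{1..Suc n}. cauchy_weight a (y j)) / W) *
      \<Phi> (root_poly {1..Suc n} y) * indicator {y. interlace (Suc n) y x} y \<partial>LB {1..Suc n})"
    unfolding h_def Q_def W_def by (rule nn_integral_step[OF n dec \<Phi>])
  also have "ennreal (vand n x * W) * (ennreal (1 / Beta \<alpha> \<beta>) * ennreal C) * \<dots> = ennreal (1 / Beta \<alpha> \<beta>) * ennreal C * (ennreal (vand n x * W) *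
    (\<integral>\<^sup>+y. ennreal (cross (Suc n) y x powr (d - 1) * vand (Suc n) y * (\<Prod>j\<in>{1..Suc n}. cauchy_weight a (y j)) / W) *
      \<Phi> (root_poly {1..Suc n} y) * indicator {y. interlace (Suc n) y x} y \<partial>LB {1..Suc n}))"
    by (simp only: mult_ac)
  also have "ennreal (vand n x * W) *
    (\<integral>\<^sup>+y. ennreal (cross (Suc n) y x powr (d - 1) * vand (Suc n) y * (\<Prod>j\<in>{1..Suc n}. cauchy_weight a (y j)) / W) *
      \<Phi> (root_poly {1..Suc n} y) * indicator {y. interlace (Suc n) y x} y \<partial>LB {1..Suc n}) =
    (\<integral>\<^sup>+y. ennreal (vand n x * W) * (ennreal (cross (Suc n) y x powr (d - 1) * vand (Suc n) y * (\<Prod>j\<in>{1..Suc n}. cauchy_weight a (y j)) / W) *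
      \<Phi> (root_poly {1..Suc n} y) * indicator {y. interlace (Suc n) y x} y) \<partial>LB {1..Suc n})"
  proof (rule nn_integral_cmult[symmetric])
    have [measurable]: "(\<lambda>y. \<Phi> (root_poly {1..Suc n} y)) \<in> borel_measurable (LB {1..Suc n})"
      by (intro measurable_compose[OF _ \<Phi>] measurable_root_poly) measurable
    show "(\<lambda>y. ennreal (cross (Suc n) y x powr (d - 1) * vand (Suc n) y * (\<Prod>j\<in>{1..Suc n}. cauchy_weight a (y j)) / W) *
      \<Phi> (root_poly {1..Suc n} y) * indicator {y. interlace (Suc n) y x} y) \<in> borel_measurable (LB {1..Suc n})"
      unfolding cross_def vand_def interlace_def by measurable
  qed
  also have "\<dots> = (\<integral>\<^sup>+y. joint_density (Suc n) a d y x * F (root_poly {1..Suc n} y, root_poly {1..n} x) \<partial>LB {1..Suc n})"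
  proof (rule nn_integral_cong)
    fix y
    let ?P = "\<Prod>j\<in>{1..Suc n}. cauchy_weight a (y j)"
    have P: "0 < ?P" by (intro prod_pos) (auto simp: cauchy_weight_pos)
    have "ennreal (vand n x * W) * ennreal (cross (Suc n) y x powr (d - 1) * vand (Suc n) y * ?P / W) =
      ennreal (vand n x * W * (cross (Suc n) y x powr (d - 1) * vand (Suc n) y * ?P / W))"
      using W vand_nonneg[of n x] by (simp only: ennreal_mult' mult_nonneg_nonneg less_imp_le)
    also have "vand n x * W * (cross (Suc n) y x powr (d - 1) * vand (Suc n) y * ?P / W) =
      vand (Suc n) y * ?P * (cross (Suc n) y x powr (d - 1) * vand n x)"
      using W by (simp del: prod.cl_ivl_Suc)
    also have "ennreal \<dots> = ennreal (vand (Suc n) y * ?P) * ennreal (cross (Suc n) y x powr (d - 1) * vand n x)"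
      using P vand_nonneg[of "Suc n" y] by (simp only: ennreal_mult' mult_nonneg_nonneg less_imp_le)
    finally show "ennreal (vand n x * W) * (ennreal (cross (Suc n) y x powr (d - 1) * vand (Suc n) y * ?P / W) *
      \<Phi> (root_poly {1..Suc n} y) * indicator {y. interlace (Suc n) y x} y) =
      joint_density (Suc n) a d y x * F (root_poly {1..Suc n} y, root_poly {1..n} x)"
      unfolding joint_density_def \<Phi>_def diff_Suc_1
      by (simp only: mult.assoc[symmetric]) (simp only: mult_ac indicator_def mem_Collect_eq)
  qed
  finally show ?thesis .
qed

lemma joint_density_step:
  fixes d :: real and a :: complex and F :: "real poly \<times> real poly \<Rightarrow> ennreal"
  assumes n: "1 \<le> n" and pos: "0 < \<alpha>" "0 < \<beta>" and \<beta>: "\<beta> = n * d" and \<alpha>: "\<alpha> = 2 * Re a - n * d - 1"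
    and F: "F \<in> borel_measurable (poly_borel \<Otimes>\<^sub>M poly_borel)"
    and C: "C = Re (Gamma a * Gamma (cnj a)) / (pi * 2 powr (2 * (1 - Re a)) * Gamma (2 * Re a - 1))"
  shows "(\<integral>\<^sup>+x. \<integral>\<^sup>+y. joint_density n (a - of_real d) d x y * transition \<alpha> \<beta> a F (root_poly {1..n} x, root_poly {1..<n} y) \<partial>LB {1..<n} \<partial>LB {1..n}) =
    ennreal (1 / Beta \<alpha> \<beta>) * ennreal C *
      (\<integral>\<^sup>+x. \<integral>\<^sup>+y. joint_density (Suc n) a d x y * F (root_poly {1..Suc n} x, root_poly {1..<Suc n} y) \<partial>LB {1..<Suc n} \<partial>LB {1..Suc n})"
proof -
  have S: "{1..<Suc n} = {1..n}" by auto
  have RP: "(\<lambda>p. F (root_poly {1..Suc n} (fst p), root_poly {1..n} (snd p))) \<in> borel_measurable (LB {1..Suc n} \<Otimes>\<^sub>M LB {1..n})"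
    by (intro measurable_compose[OF _ F] measurable_Pair measurable_root_poly) measurable
  have "(\<lambda>p. joint_density (Suc n) a d (fst p) (snd p) * F (root_poly {1..Suc n} (fst p), root_poly {1..n} (snd p)))
    \<in> borel_measurable (LB {1..Suc n} \<Otimes>\<^sub>M LB {1..n})"
    using measurable_joint_density[of "Suc n" a d] RP unfolding S by measurable
  then have meas: "(\<lambda>(x, y). joint_density (Suc n) a d x y * F (root_poly {1..Suc n} x, root_poly {1..n} y))
    \<in> borel_measurable (LB {1..Suc n} \<Otimes>\<^sub>M LB {1..n})" by (simp add: split_beta')
  interpret N1: sigma_finite_measure "LB {1..Suc n}" by (rule sigma_finite_LB) simp
  have "(\<integral>\<^sup>+x. \<integral>\<^sup>+y. joint_density n (a - of_real d) d x y * transition \<alpha> \<beta> a F (root_poly {1..n} x, root_poly {1..<n} y) \<partial>LB {1..<n} \<partial>LB {1..n}) =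
    (\<integral>\<^sup>+x. ennreal (1 / Beta \<alpha> \<beta>) * ennreal C *
      (\<integral>\<^sup>+y. joint_density (Suc n) a d y x * F (root_poly {1..Suc n} y, root_poly {1..n} x) \<partial>LB {1..Suc n}) \<partial>LB {1..n})"
    by (intro nn_integral_cong joint_density_step_fixed assms)
  also have "\<dots> = ennreal (1 / Beta \<alpha> \<beta>) * ennreal C * (\<integral>\<^sup>+x.
      (\<integral>\<^sup>+y. joint_density (Suc n) a d y x * F (root_poly {1..Suc n} y, root_poly {1..n} x) \<partial>LB {1..Suc n}) \<partial>LB {1..n})"
    using measurable_pair_swap[OF meas]
    by (intro nn_integral_cmult N1.borel_measurable_nn_integral) (simp add: split_beta')
  also have "(\<integral>\<^sup>+x. (\<integral>\<^sup>+y. joint_density (Suc n) a d y x * F (root_poly {1..Suc n} y, root_poly {1..n} x) \<partial>LB {1..Suc n}) \<partial>LB {1..n}) =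
    (\<integral>\<^sup>+x. \<integral>\<^sup>+y. joint_density (Suc n) a d x y * F (root_poly {1..Suc n} x, root_poly {1..n} y) \<partial>LB {1..n} \<partial>LB {1..Suc n})"
    by (rule nn_integral_LB_swap[OF _ N1.sigma_finite_measure_axioms meas]) simp
  finally show ?thesis unfolding S .
qed

text \<open>In residue coordinates the dependence on \<open>x\<close> is a bare factor
  \<open>vand n x powr (2 * d - 1)\<close>; the remaining integral is a constant \<open>K\<close>,
  left unevaluated. One more \<open>vand n x\<close> from the joint density completes the exponent
  \<open>2 * d\<close>.\<close>

lemma joint_density_marginal:
  fixes d :: real and a :: complex
  assumes n: "1 \<le> n"
  shows "\<exists>K. \<forall>x. (\<integral>\<^sup>+y. joint_density n a d x y \<partial>LB {1..<n}) = K * ennreal (zeros_weight n a d x)"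
proof -
  \<comment> \<open>chosen so that the auxiliary leading coefficient \<open>S\<close> integrates to \<open>1\<close>\<close>
  define \<Psi> where "\<Psi> v = ennreal ((\<Sum>i\<in>{1..n}. v i) powr (1 - n * d)) * indicator {1<..<2} (\<Sum>i\<in>{1..n}. v i)" for v :: "nat \<Rightarrow> real"
  have \<Psi>: "\<Psi> \<in> borel_measurable (LB {1..n})" unfolding \<Psi>_def by measurable
  define K where "K = (\<integral>\<^sup>+v. ennreal ((\<Prod>i\<in>{1..n}. v i) powr (d - 1)) * \<Psi> v * indicator {v. \<forall>i\<in>{1..n}. 0 < v i} v \<partial>LB {1..n})"
  have "(\<integral>\<^sup>+y. joint_density n a d x y \<partial>LB {1..<n}) = K * ennreal (zeros_weight n a d x)" for x
  proof (cases "\<forall>i\<in>{1..<n}. x (Suc i) < x i")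
    case False
    then have "\<not> interlace n x y" for y using interlace_imp_decreasing[of n x y] by auto
    moreover from False obtain i where "i \<in> {1..<n}" "\<not> x (Suc i) < x i" by auto
    then have "i \<in> {1..n}" "Suc i \<in> {1..n}" "i < Suc i" "\<not> x (Suc i) < x i" by auto
    then have "\<not> (\<forall>j\<in>{1..n}. \<forall>k\<in>{1..n}. j < k \<longrightarrow> x k < x j)" by blast
    ultimately show ?thesis unfolding zeros_weight_def joint_density_def
      by (simp only: if_False indicator_simps mem_Collect_eq) simp
  next
    case dec: True
    note inj = inj_on_decreasing[OF dec]
    define A where "A y = ennreal (cross n x y powr (d - 1) * vand (n - 1) y) * indicator {y. interlace n x y} y" for y
    have [measurable]: "(\<lambda>y. y i) \<in> borel_measurable (LB {1..<n})" if "i \<in> {1..n - 1}" for i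
      using that n by (intro measurable_component_singleton[THEN measurable_compose]) auto
    have [measurable]: "(\<lambda>y. y i) \<in> borel_measurable (LB {1..<n})" if "i \<in> {1..<n}" for i
      using that by (intro measurable_component_singleton[THEN measurable_compose]) auto
    have [measurable]: "A \<in> borel_measurable (LB {1..<n})"
      unfolding A_def cross_def vand_def interlace_def by measurable
    have "(\<integral>\<^sup>+y. A y \<partial>LB {1..<n}) = (\<integral>\<^sup>+y. \<integral>\<^sup>+S. ennreal (S powr (n * d - 1) * cross n x y powr (d - 1) * vand (n - 1) y) *
      \<Psi> (\<lambda>i\<in>{1..n}. resid 0 n x (y(0 := S) \<circ> (\<lambda>j. j - 1)) i) *
      indicator {0<..} S * indicator {y. interlace n x y} y \<partial>lborel \<partial>LB {1..<n})"
    proof (rule nn_integral_cong)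
      fix y
      have "ennreal (S powr (n * d - 1) * cross n x y powr (d - 1) * vand (n - 1) y) *
        \<Psi> (\<lambda>i\<in>{1..n}. resid 0 n x (y(0 := S) \<circ> (\<lambda>j. j - 1)) i) *
        indicator {0<..} S * indicator {y. interlace n x y} y = A y * indicator {1<..<2} S" for S
      proof (cases "S \<in> {1<..<2}")
        case True
        then have S: "0 < S" by simp
        have sum: "(\<Sum>i\<in>{1..n}. (\<lambda>i\<in>{1..n}. resid 0 n x (y(0 := S) \<circ> (\<lambda>j. j - 1)) i) i) = S"
          using sum_resid_zero[OF n inj, of "y(0 := S) \<circ> (\<lambda>j. j - 1)"] by simp
        have "ennreal (S powr (n * d - 1) * cross n x y powr (d - 1) * vand (n - 1) y) * ennreal (S powr (1 - n * d)) =
          ennreal (S powr (n * d - 1) * cross n x y powr (d - 1) * vand (n - 1) y * S powr (1 - n * d))"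
          by (simp add: ennreal_mult'')
        also have "S powr (n * d - 1) * cross n x y powr (d - 1) * vand (n - 1) y * S powr (1 - n * d) =
          (S powr (n * d - 1) * S powr (1 - n * d)) * (cross n x y powr (d - 1) * vand (n - 1) y)" by (simp only: mult_ac)
        also have "S powr (n * d - 1) * S powr (1 - n * d) = 1" using S by (simp flip: powr_add)
        finally show ?thesis unfolding \<Psi>_def sum A_def using True S by (simp add: mult.assoc[symmetric])
      next
        case False
        have sum: "(\<Sum>i\<in>{1..n}. (\<lambda>i\<in>{1..n}. resid 0 n x (y(0 := S) \<circ> (\<lambda>j. j - 1)) i) i) = S"
          using sum_resid_zero[OF n inj, of "y(0 := S) \<circ> (\<lambda>j. j - 1)"] by simp
        then show ?thesis unfolding \<Psi>_def sum using False by simp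
      qed
      then show "A y = (\<integral>\<^sup>+S. ennreal (S powr (n * d - 1) * cross n x y powr (d - 1) * vand (n - 1) y) *
        \<Psi> (\<lambda>i\<in>{1..n}. resid 0 n x (y(0 := S) \<circ> (\<lambda>j. j - 1)) i) *
        indicator {0<..} S * indicator {y. interlace n x y} y \<partial>lborel)"
        by (simp add: nn_integral_cmult)
    qed
    also have "\<dots> = ennreal (vand n x powr (2 * d - 1)) * K"
      unfolding K_def by (rule nn_integral_interlacing[OF n dec \<Psi>])
    finally have A: "(\<integral>\<^sup>+y. A y \<partial>LB {1..<n}) = ennreal (vand n x powr (2 * d - 1)) * K" .
    let ?W = "\<Prod>j\<in>{1..n}. cauchy_weight a (x j)"
    have W: "0 < ?W" by (intro prod_pos) (auto simp: cauchy_weight_pos)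
    have V: "0 < vand n x" by (rule vand_pos[OF inj])
    have "(\<integral>\<^sup>+y. joint_density n a d x y \<partial>LB {1..<n}) = ennreal (vand n x * ?W) * (\<integral>\<^sup>+y. A y \<partial>LB {1..<n})"
      unfolding joint_density_def A_def[symmetric] by (rule nn_integral_cmult) measurable
    also have "\<dots> = K * (ennreal (vand n x * ?W) * ennreal (vand n x powr (2 * d - 1)))"
      unfolding A by (simp only: mult_ac)
    also have "ennreal (vand n x * ?W) * ennreal (vand n x powr (2 * d - 1)) = ennreal (vand n x * ?W * vand n x powr (2 * d - 1))"
      by (simp add: ennreal_mult'')
    also have "vand n x * ?W * vand n x powr (2 * d - 1) = zeros_weight n a d x"
    proof -
      have "\<forall>j\<in>{1..n}. \<forall>k\<in>{1..n}. j < k \<longrightarrow> x k < x j" using decreasing_less[OF dec] by auto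
      moreover have "(\<Prod>k\<in>{1..n}. \<Prod>j\<in>{1..<k}. \<bar>x j - x k\<bar> powr (2 * d)) = vand n x powr (2 * d)"
        unfolding vand_def by (simp only: prod_powr_distrib)
      moreover have "vand n x powr (2 * d) = vand n x * vand n x powr (2 * d - 1)"
        using V by (simp add: powr_diff)
      ultimately show ?thesis unfolding zeros_weight_def by simp
    qed
    finally show ?thesis .
  qed
  then show ?thesis by blast
qed

section \<open>The random recurrence\<close>

text \<open>\<open>P\<^sub>n\<close> depends only on variables with index below \<open>n\<close>;
  independence of the next \<open>b\<close> and \<open>c\<close> from the past rests on
  this.\<close>

lemma rec_poly_cong:
  "(\<And>i. i < n \<Longrightarrow> b i = b' i \<and> c i = c' i) \<Longrightarrow> rec_poly b c n = rec_poly b' c' n"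
proof (induction n rule: less_induct)
  case (less n)
  consider "n = 0" | "n = 1" | m where "n = Suc (Suc m)" by (metis One_nat_def not0_implies_Suc)
  then show ?case
  proof cases
    case 3
    have "rec_poly b c m = rec_poly b' c' m" "rec_poly b c (Suc m) = rec_poly b' c' (Suc m)"
      using less 3 by auto
    then show ?thesis using less.prems[of "Suc m"] 3 by simp
  qed (use less.prems[of 0] in auto)
qed

lemma measurable_rec_poly:
  assumes "\<And>i. i < n \<Longrightarrow> (\<lambda>w. b w i) \<in> borel_measurable N" "\<And>i. i < n \<Longrightarrow> (\<lambda>w. c w i) \<in> borel_measurable N"
  shows "(\<lambda>w. rec_poly (b w) (c w) n) \<in> measurable N poly_borel"
  using assms
proof (induction n rule: less_induct)
  case (less n)
  consider "n = 0" | "n = 1" | m where "n = Suc (Suc m)" by (metis One_nat_def not0_implies_Suc)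
  then show ?case
  proof cases
    case 1
    then show ?thesis by simp
  next
    case 2
    then have "(\<lambda>w. b w 0) \<in> borel_measurable N" "(\<lambda>w. c w 0) \<in> borel_measurable N" using less.prems by auto
    then show ?thesis unfolding 2 One_nat_def rec_poly.simps
      by (intro measurable_poly_smult measurable_poly_mult measurable_linear_poly measurable_const
          borel_measurable_divide borel_measurable_uminus) auto
  next
    case 3
    have "(\<lambda>w. rec_poly (b w) (c w) m) \<in> measurable N poly_borel" "(\<lambda>w. rec_poly (b w) (c w) (Suc m)) \<in> measurable N poly_borel"
      using less 3 by auto
    moreover have "(\<lambda>w. b w (Suc m)) \<in> borel_measurable N" "(\<lambda>w. c w (Suc m)) \<in> borel_measurable N"
      using less.prems 3 by auto
    ultimately show ?thesis unfolding 3 rec_poly.simps by (intro measurable_recurrence)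
  qed
qed

section \<open>Independence and the Markov property\<close>

lemma (in prob_space) nn_integral_indep_var:
  assumes indep: "indep_var S X T Y" and f: "f \<in> borel_measurable (S \<Otimes>\<^sub>M T)"
  shows "(\<integral>\<^sup>+\<omega>. f (X \<omega>, Y \<omega>) \<partial>M) = (\<integral>\<^sup>+\<omega>. (\<integral>\<^sup>+\<omega>'. f (X \<omega>, Y \<omega>') \<partial>M) \<partial>M)"
proof -
  have X: "X \<in> measurable M S" and Y: "Y \<in> measurable M T"
    and eq: "distr M S X \<Otimes>\<^sub>M distr M T Y = distr M (S \<Otimes>\<^sub>M T) (\<lambda>x. (X x, Y x))"
    using indep unfolding indep_var_distribution_eq by auto
  interpret D: prob_space "distr M T Y" by (rule prob_space_distr[OF Y])
  have f': "f \<in> borel_measurable (distr M S X \<Otimes>\<^sub>M distr M T Y)"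
    using f by (simp cong: measurable_cong_sets)
  have "(\<integral>\<^sup>+\<omega>. f (X \<omega>, Y \<omega>) \<partial>M) = (\<integral>\<^sup>+p. f p \<partial>(distr M S X \<Otimes>\<^sub>M distr M T Y))"
    unfolding eq using X Y f by (subst nn_integral_distr) auto
  also have "\<dots> = (\<integral>\<^sup>+x. \<integral>\<^sup>+y. f (x, y) \<partial>distr M T Y \<partial>distr M S X)"
    by (rule D.nn_integral_fst[OF f', symmetric])
  also have "\<dots> = (\<integral>\<^sup>+\<omega>. \<integral>\<^sup>+y. f (X \<omega>, y) \<partial>distr M T Y \<partial>M)"
    using D.borel_measurable_nn_integral_fst[OF f'] X by (intro nn_integral_distr) auto
  also have "\<dots> = (\<integral>\<^sup>+\<omega>. (\<integral>\<^sup>+\<omega>'. f (X \<omega>, Y \<omega>') \<partial>M) \<partial>M)"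
  proof (rule nn_integral_cong)
    fix \<omega> assume "\<omega> \<in> space M"
    then have "X \<omega> \<in> space S" using X by (rule measurable_space[rotated])
    then show "(\<integral>\<^sup>+y. f (X \<omega>, y) \<partial>distr M T Y) = (\<integral>\<^sup>+\<omega>'. f (X \<omega>, Y \<omega>') \<partial>M)"
      using Y measurable_compose_Pair1[OF _ f] by (intro nn_integral_distr) auto
  qed
  finally show ?thesis .
qed

text \<open>The current pair is a function of the past variables, which are independent of
  \<open>(b n, c n)\<close>. Hence \<open>b n\<close> and \<open>c n\<close> can be integrated out
  with the pair held fixed.\<close>

lemma (in prob_space) recurrence_transition:
  assumes indep: "indep_vars (\<lambda>_. borel) (case_sum b c) UNIV"
    and b: "distributed M lborel (b n) (beta_density \<alpha> \<beta>)" and c: "distributed M lborel (c n) (cauchy_density a)"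
    and F: "F \<in> borel_measurable (poly_borel \<Otimes>\<^sub>M poly_borel)" and n: "1 \<le> n"
  defines "P \<equiv> \<lambda>k \<omega>. rec_poly (\<lambda>i. b i \<omega>) (\<lambda>i. c i \<omega>) k"
  shows "(\<integral>\<^sup>+\<omega>. F (P (Suc n) \<omega>, P n \<omega>) \<partial>M) = (\<integral>\<^sup>+\<omega>. transition \<alpha> \<beta> a F (P n \<omega>, P (n - 1) \<omega>) \<partial>M)"
proof -
  \<comment> \<open>The indices of the past: \<open>Inl\<close> for the \<open>b i\<close> and
    \<open>Inr\<close> for the \<open>c i\<close>, matching \<open>case_sum b c\<close>.\<close>
  define A :: "(nat + nat) set" where "A = Inl ` {..<n} \<union> Inr ` {..<n}"
  define X where "X = case_sum b c"
  have ind: "indep_vars (\<lambda>_. borel) X UNIV" unfolding X_def by (rule indep)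
  define R where "R k u = rec_poly (\<lambda>i. u (Inl i)) (\<lambda>i. u (Inr i)) k" for k and u :: "nat + nat \<Rightarrow> real"
  define Z where "Z u = (R n u, R (n - 1) u)" for u
  have R: "R k \<in> measurable (\<Pi>\<^sub>M i\<in>A. borel) poly_borel" if "k \<le> n" for k
    unfolding R_def using that by (intro measurable_rec_poly measurable_component_singleton) (auto simp: A_def)
  have Z: "Z \<in> measurable (\<Pi>\<^sub>M i\<in>A. borel) (poly_borel \<Otimes>\<^sub>M poly_borel)"
    unfolding Z_def by (intro measurable_Pair R) auto
  have PR: "P k \<omega> = R k (\<lambda>i\<in>A. X i \<omega>)" if "k \<le> n" for k \<omega>
    unfolding P_def R_def using that by (intro rec_poly_cong) (auto simp: A_def X_def)
  define f where "f p = F (smult (1 / fst (snd p)) ([:- snd (snd p), 1:] * fst (fst p)) +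
    smult (1 - 1 / fst (snd p)) ([:1, 0, 1:] * snd (fst p)), fst (fst p))" for p
  have f: "f \<in> borel_measurable ((poly_borel \<Otimes>\<^sub>M poly_borel) \<Otimes>\<^sub>M (borel \<Otimes>\<^sub>M borel))"
    unfolding f_def by (intro measurable_compose[OF _ F] measurable_Pair measurable_recurrence) measurable
  define V where "V v = (v (Inl n), v (Inr n))" for v :: "nat + nat \<Rightarrow> real"
  have V: "V \<in> measurable (\<Pi>\<^sub>M i\<in>{Inl n, Inr n}. borel) (borel \<Otimes>\<^sub>M borel)"
    unfolding V_def by (intro measurable_Pair measurable_component_singleton) auto
  have i1: "indep_var (\<Pi>\<^sub>M i\<in>A. borel) (\<lambda>\<omega>. \<lambda>i\<in>A. X i \<omega>) (\<Pi>\<^sub>M i\<in>{Inl n, Inr n}. borel) (\<lambda>\<omega>. \<lambda>i\<in>{Inl n, Inr n}. X i \<omega>)"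
    by (rule indep_var_restrict[OF ind]) (auto simp: A_def)
  have ZX: "Z (\<lambda>i\<in>A. X i \<omega>) = (P n \<omega>, P (n - 1) \<omega>)" for \<omega> by (simp add: Z_def PR)
  have VX: "V (\<lambda>i\<in>{Inl n, Inr n}. X i \<omega>) = (b n \<omega>, c n \<omega>)" for \<omega> by (simp add: V_def X_def)
  have f2: "(\<lambda>p. f (Z (fst p), V (snd p))) \<in> borel_measurable ((\<Pi>\<^sub>M i\<in>A. borel) \<Otimes>\<^sub>M (\<Pi>\<^sub>M i\<in>{Inl n, Inr n}. borel))"
    by (intro measurable_compose[OF _ f] measurable_Pair measurable_compose[OF measurable_fst Z] measurable_compose[OF measurable_snd V])
  have "indep_var (\<Pi>\<^sub>M i\<in>{Inl n}. borel) (\<lambda>\<omega>. \<lambda>i\<in>{Inl n}. X i \<omega>) (\<Pi>\<^sub>M i\<in>{Inr n}. borel) (\<lambda>\<omega>. \<lambda>i\<in>{Inr n}. X i \<omega>)"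
    by (rule indep_var_restrict[OF ind]) auto
  then have "indep_var borel ((\<lambda>u. u (Inl n)) \<circ> (\<lambda>\<omega>. \<lambda>i\<in>{Inl n}. X i \<omega>)) borel ((\<lambda>u. u (Inr n)) \<circ> (\<lambda>\<omega>. \<lambda>i\<in>{Inr n}. X i \<omega>))"
    by (rule indep_var_compose) simp_all
  then
  have i2: "indep_var borel (b n) borel (c n)" by (simp add: comp_def X_def)
  have "(\<integral>\<^sup>+\<omega>. F (P (Suc n) \<omega>, P n \<omega>) \<partial>M) = (\<integral>\<^sup>+\<omega>. f ((P n \<omega>, P (n - 1) \<omega>), (b n \<omega>, c n \<omega>)) \<partial>M)"
  proof -
    obtain m where "n = Suc m" using n by (cases n) auto
    then show ?thesis by (simp add: f_def P_def)
  qed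
  also have "\<dots> = (\<integral>\<^sup>+\<omega>. \<integral>\<^sup>+\<omega>'. f ((P n \<omega>, P (n - 1) \<omega>), (b n \<omega>', c n \<omega>')) \<partial>M \<partial>M)"
    using nn_integral_indep_var[OF i1 f2] by (simp only: fst_conv snd_conv ZX VX)
  also have "\<dots> = (\<integral>\<^sup>+\<omega>. transition \<alpha> \<beta> a F (P n \<omega>, P (n - 1) \<omega>) \<partial>M)"
  proof (rule nn_integral_cong)
    fix \<omega>
    define z where "z = (P n \<omega>, P (n - 1) \<omega>)"
    have fz: "(\<lambda>q. f (z, q)) \<in> borel_measurable (borel \<Otimes>\<^sub>M borel)"
      by (rule measurable_compose_Pair1[OF _ f]) (simp add: space_pair_measure)
    have "(\<integral>\<^sup>+\<omega>'. f (z, (b n \<omega>', c n \<omega>')) \<partial>M) = (\<integral>\<^sup>+\<omega>'. \<integral>\<^sup>+\<omega>''. f (z, (b n \<omega>', c n \<omega>'')) \<partial>M \<partial>M)"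
      by (rule nn_integral_indep_var[OF i2 fz])
    also have "\<dots> = (\<integral>\<^sup>+\<omega>'. \<integral>\<^sup>+t. ennreal (cauchy_density a t) * f (z, (b n \<omega>', t)) \<partial>lborel \<partial>M)"
      using measurable_compose_Pair1[OF _ fz] by (intro nn_integral_cong distributed_nn_integral[OF c, symmetric]) auto
    also have "\<dots> = (\<integral>\<^sup>+s. ennreal (beta_density \<alpha> \<beta> s) * (\<integral>\<^sup>+t. ennreal (cauchy_density a t) * f (z, (s, t)) \<partial>lborel) \<partial>lborel)"
    proof (rule distributed_nn_integral[OF b, symmetric])
      have [measurable]: "(\<lambda>p. f (z, p)) \<in> borel_measurable (lborel \<Otimes>\<^sub>M lborel)"
        using fz by (simp cong: measurable_cong_sets)
      show "(\<lambda>s. \<integral>\<^sup>+t. ennreal (cauchy_density a t) * f (z, (s, t)) \<partial>lborel) \<in> borel_measurable lborel"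
        by measurable
    qed
    also have "\<dots> = transition \<alpha> \<beta> a F z" unfolding transition_def f_def by simp
    finally show "(\<integral>\<^sup>+\<omega>'. f ((P n \<omega>, P (n - 1) \<omega>), (b n \<omega>', c n \<omega>')) \<partial>M) = transition \<alpha> \<beta> a F (P n \<omega>, P (n - 1) \<omega>)"
      unfolding z_def .
  qed
  finally show ?thesis .
qed

text \<open>Induction along the Markov chain: the hypothesis for \<open>n\<close> is applied to
  \<open>transition\<close> of \<open>F\<close>, so it must hold for all \<open>F\<close>. The
  unspecified \<open>K\<close> absorbs the constants of the beta and Cauchy densities.\<close>

lemma joint_law:
  fixes d :: real and \<gamma> :: complex and b c :: "nat \<Rightarrow> 'w \<Rightarrow> real"
  assumes d: "d > 0" and \<gamma>: "Re \<gamma> > 1 / 2" and M: "prob_space M"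
    and b0: "\<And>\<omega>. \<omega> \<in> space M \<Longrightarrow> b 0 \<omega> = 1"
    and b: "\<And>n. n \<ge> 1 \<Longrightarrow>
           distributed M lborel (b n) (beta_density (2 * Re \<gamma> + real n * d - 1) (real n * d))"
    and c: "\<And>n. distributed M lborel (c n) (cauchy_density (\<gamma> + of_real (real n * d)))"
    and indep: "prob_space.indep_vars M (\<lambda>_. borel) (case_sum b c) UNIV" and n: "1 \<le> n"
  defines "P \<equiv> \<lambda>k \<omega>. rec_poly (\<lambda>i. b i \<omega>) (\<lambda>i. c i \<omega>) k"
  shows "\<exists>K. \<forall>F\<in>borel_measurable (poly_borel \<Otimes>\<^sub>M poly_borel). (\<integral>\<^sup>+\<omega>. F (P n \<omega>, P (n - 1) \<omega>) \<partial>M) =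
    K * (\<integral>\<^sup>+x. \<integral>\<^sup>+y. joint_density n (\<gamma> + of_real ((real n - 1) * d)) d x y * F (root_poly {1..n} x, root_poly {1..<n} y)
      \<partial>LB {1..<n} \<partial>LB {1..n})"
  using n
proof (induction n rule: nat_induct_at_least)
  case base
  interpret prob_space M by (rule M)
  define C where "C = Re (Gamma \<gamma> * Gamma (cnj \<gamma>)) / (pi * 2 powr (2 * (1 - Re \<gamma>)) * Gamma (2 * Re \<gamma> - 1))"
  have "(\<integral>\<^sup>+\<omega>. F (P 1 \<omega>, P (1 - 1) \<omega>) \<partial>M) =
    ennreal C * (\<integral>\<^sup>+x. \<integral>\<^sup>+y. joint_density 1 (\<gamma> + of_real ((real 1 - 1) * d)) d x y * F (root_poly {1..1} x, root_poly {1..<1} y)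
      \<partial>LB {1..<1} \<partial>LB {1..1})" if F: "F \<in> borel_measurable (poly_borel \<Otimes>\<^sub>M poly_borel)" for F
  proof -
    define f where "f t = ennreal (cauchy_weight \<gamma> t) * F ([:- t, 1:], 1)" for t
    have Ft [measurable]: "(\<lambda>t. F ([:- t, 1:], 1)) \<in> borel_measurable borel"
      by (intro measurable_compose[OF _ F] measurable_Pair measurable_linear_poly measurable_const) auto
    have f [measurable]: "f \<in> borel_measurable borel" unfolding f_def by measurable
    have "(\<integral>\<^sup>+\<omega>. F (P 1 \<omega>, P (1 - 1) \<omega>) \<partial>M) = (\<integral>\<^sup>+\<omega>. F ([:- c 0 \<omega>, 1:], 1) \<partial>M)"
      by (intro nn_integral_cong) (simp add: P_def b0)
    also have "\<dots> = (\<integral>\<^sup>+t. ennreal (cauchy_density \<gamma> t) * F ([:- t, 1:], 1) \<partial>lborel)"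
      using distributed_nn_integral[OF c[of 0], of "\<lambda>t. F ([:- t, 1:], 1)"] Ft by simp
    also have "\<dots> = (\<integral>\<^sup>+t. ennreal C * f t \<partial>lborel)"
    proof (rule nn_integral_cong)
      fix t
      have "ennreal (cauchy_density \<gamma> t) = ennreal C * ennreal (cauchy_weight \<gamma> t)"
        using cauchy_weight_pos[of \<gamma> t] unfolding cauchy_density_def C_def[symmetric] by (simp only: ennreal_mult'' less_imp_le)
      then show "ennreal (cauchy_density \<gamma> t) * F ([:- t, 1:], 1) = ennreal C * f t" by (simp only: f_def mult.assoc)
    qed
    also have "\<dots> = ennreal C * (\<integral>\<^sup>+t. f t \<partial>lborel)" by (rule nn_integral_cmult) measurable
    also have "(\<integral>\<^sup>+t. f t \<partial>lborel) = (\<integral>\<^sup>+x. f (x 1) \<partial>LB {1})"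
      by (intro LB.product_nn_integral_singleton[symmetric]) measurable
    \<comment> \<open>The inner integral is over a one-point space, and \<open>cross\<close> and
      both Vandermonde factors are empty products, so only the weight of the single zero
      \<open>c 0\<close> remains.\<close>
    also have "\<dots> = (\<integral>\<^sup>+x. \<integral>\<^sup>+y. joint_density 1 (\<gamma> + of_real ((real 1 - 1) * d)) d x y * F (root_poly {1..1} x, root_poly {1..<1} y)
      \<partial>LB {1..<1} \<partial>LB {1..1})"
      by (simp add: PiM_empty nn_integral_count_space_finite joint_density_def vand_def cross_def interlace_def root_poly_def f_def)
    finally show ?thesis .
  qed
  then show ?case by blast
next
  case (Suc n)
  interpret prob_space M by (rule M)
  obtain K where K: "\<And>F. F \<in> borel_measurable (poly_borel \<Otimes>\<^sub>M poly_borel) \<Longrightarrow> (\<integral>\<^sup>+\<omega>. F (P n \<omega>, P (n - 1) \<omega>) \<partial>M) =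
    K * (\<integral>\<^sup>+x. \<integral>\<^sup>+y. joint_density n (\<gamma> + of_real ((real n - 1) * d)) d x y * F (root_poly {1..n} x, root_poly {1..<n} y)
      \<partial>LB {1..<n} \<partial>LB {1..n})" using Suc.IH by blast
  define a where "a = \<gamma> + of_real (real n * d)"
  define \<alpha> \<beta> where "\<alpha> = 2 * Re \<gamma> + real n * d - 1" and "\<beta> = real n * d"
  define C where "C = Re (Gamma a * Gamma (cnj a)) / (pi * 2 powr (2 * (1 - Re a)) * Gamma (2 * Re a - 1))"
  have nd: "0 < real n * d" using d Suc.hyps by simp
  have pos: "0 < \<alpha>" "0 < \<beta>" using nd \<gamma> by (simp_all add: \<alpha>_def \<beta>_def)
  have \<alpha>: "\<alpha> = 2 * Re a - real n * d - 1" by (simp add: \<alpha>_def a_def)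
  have a': "\<gamma> + of_real ((real n - 1) * d) = a - of_real d" by (simp add: a_def algebra_simps)
  have a'': "\<gamma> + of_real ((real (Suc n) - 1) * d) = a" by (simp add: a_def)
  have "(\<integral>\<^sup>+\<omega>. F (P (Suc n) \<omega>, P (Suc n - 1) \<omega>) \<partial>M) =
    K * (ennreal (1 / Beta \<alpha> \<beta>) * ennreal C) * (\<integral>\<^sup>+x. \<integral>\<^sup>+y. joint_density (Suc n) (\<gamma> + of_real ((real (Suc n) - 1) * d)) d x y *
      F (root_poly {1..Suc n} x, root_poly {1..<Suc n} y) \<partial>LB {1..<Suc n} \<partial>LB {1..Suc n})"
    if F: "F \<in> borel_measurable (poly_borel \<Otimes>\<^sub>M poly_borel)" for F
  proof -
    have "(\<integral>\<^sup>+\<omega>. F (P (Suc n) \<omega>, P n \<omega>) \<partial>M) = (\<integral>\<^sup>+\<omega>. transition \<alpha> \<beta> a F (P n \<omega>, P (n - 1) \<omega>) \<partial>M)"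
      unfolding P_def \<alpha>_def \<beta>_def a_def
      by (rule recurrence_transition[OF indep b[OF Suc.hyps] c F Suc.hyps])
    also have "\<dots> = K * (\<integral>\<^sup>+x. \<integral>\<^sup>+y. joint_density n (a - of_real d) d x y * transition \<alpha> \<beta> a F (root_poly {1..n} x, root_poly {1..<n} y)
      \<partial>LB {1..<n} \<partial>LB {1..n})"
      unfolding a'[symmetric] by (intro K measurable_transition F)
    also have "\<dots> = K * (ennreal (1 / Beta \<alpha> \<beta>) * ennreal C *
      (\<integral>\<^sup>+x. \<integral>\<^sup>+y. joint_density (Suc n) a d x y * F (root_poly {1..Suc n} x, root_poly {1..<Suc n} y) \<partial>LB {1..<Suc n} \<partial>LB {1..Suc n}))"
      by (simp only: joint_density_step[OF Suc.hyps pos \<beta>_def \<alpha> F C_def])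
    finally show ?thesis unfolding a'' diff_Suc_1 by (simp only: mult.assoc)
  qed
  then show ?case by blast
qed

lemma borel_measurable_zeros_weight [measurable]: "zeros_weight n a d \<in> borel_measurable (LB {1..n})"
proof -
  have "(\<lambda>x. \<Prod>k\<in>{1..n}. \<Prod>j\<in>{1..<k}. \<bar>x j - x k\<bar> powr (2 * d)) \<in> borel_measurable (LB {1..n})"
  proof (intro borel_measurable_prod)
    fix k j assume "k \<in> {1..n}" "j \<in> {1..<k}"
    then have "j \<in> {1..n}" "k \<in> {1..n}" by auto
    then have [measurable]: "(\<lambda>x. x j) \<in> borel_measurable (LB {1..n})" "(\<lambda>x. x k) \<in> borel_measurable (LB {1..n})" by simp_all
    show "(\<lambda>x. \<bar>x j - x k\<bar> powr (2 * d)) \<in> borel_measurable (LB {1..n})" by measurable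
  qed
  then show ?thesis unfolding zeros_weight_def[abs_def] by measurable
qed

theorem theorem5:
  fixes d :: real and \<gamma> :: complex
    and M :: "'w measure"
    and b c :: "nat \<Rightarrow> 'w \<Rightarrow> real"
  assumes "d > 0" and "Re \<gamma> > 1 / 2"
    and "prob_space M"
    and "\<And>\<omega>. \<omega> \<in> space M \<Longrightarrow> b 0 \<omega> = 1"
    and "\<And>n. n \<ge> 1 \<Longrightarrow>
           distributed M lborel (b n) (beta_density (2 * Re \<gamma> + real n * d - 1) (real n * d))"
    and "\<And>n. distributed M lborel (c n) (cauchy_density (\<gamma> + of_real (real n * d)))"
    and "prob_space.indep_vars M (\<lambda>_. borel) (case_sum b c) UNIV"
  shows "\<forall>n\<ge>1.
           (\<lambda>\<omega>. rec_poly (\<lambda>k. b k \<omega>) (\<lambda>k. c k \<omega>) n) \<in> measurable M poly_borel \<and>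
           distr M poly_borel (\<lambda>\<omega>. rec_poly (\<lambda>k. b k \<omega>) (\<lambda>k. c k \<omega>) n) =
             rand_poly_law n (\<gamma> + of_real ((real n - 1) * d)) d"
proof (intro allI impI conjI)
  fix n :: nat assume n: "1 \<le> n"
  interpret prob_space M by fact
  define P where "P k \<omega> = rec_poly (\<lambda>i. b i \<omega>) (\<lambda>i. c i \<omega>) k" for k \<omega>
  define a where "a = \<gamma> + of_real ((real n - 1) * d)"
  \<comment> \<open>\<open>b 0\<close> is constant and has no density, so measurability is read off
    the independence assumption.\<close>
  have bm: "b i \<in> borel_measurable M" for i
    using indep_vars_def2[of "\<lambda>_. borel" "case_sum b c" UNIV] assms(7) by (metis UNIV_I old.sum.simps(5))
  have cm: "c i \<in> borel_measurable M" for i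
    using distributed_measurable[OF assms(6)[of i]] by simp
  show "(\<lambda>\<omega>. rec_poly (\<lambda>k. b k \<omega>) (\<lambda>k. c k \<omega>) n) \<in> measurable M poly_borel"
    by (intro measurable_rec_poly bm cm)
  then have P: "P n \<in> measurable M poly_borel" by (simp add: P_def[abs_def])
  obtain K where K: "\<And>F. F \<in> borel_measurable (poly_borel \<Otimes>\<^sub>M poly_borel) \<Longrightarrow> (\<integral>\<^sup>+\<omega>. F (P n \<omega>, P (n - 1) \<omega>) \<partial>M) =
    K * (\<integral>\<^sup>+x. \<integral>\<^sup>+y. joint_density n a d x y * F (root_poly {1..n} x, root_poly {1..<n} y) \<partial>LB {1..<n} \<partial>LB {1..n})"
    using joint_law[OF assms n] unfolding P_def a_def by blast
  obtain L where L: "\<And>x. (\<integral>\<^sup>+y. joint_density n a d x y \<partial>LB {1..<n}) = L * ennreal (zeros_weight n a d x)"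
    using joint_density_marginal[OF n] by blast
  have rp [measurable]: "root_poly {1..n} \<in> measurable (LB {1..n}) poly_borel"
    by (intro measurable_root_poly) simp
  have law: "(\<integral>\<^sup>+\<omega>. f (P n \<omega>) \<partial>M) = K * L * (\<integral>\<^sup>+x. ennreal (zeros_weight n a d x) * f (root_poly {1..n} x) \<partial>LB {1..n})"
    if f [measurable]: "f \<in> borel_measurable poly_borel" for f
  proof -
    have "(\<lambda>p. f (fst p)) \<in> borel_measurable (poly_borel \<Otimes>\<^sub>M poly_borel)" by measurable
    from K[OF this] have "(\<integral>\<^sup>+\<omega>. f (P n \<omega>) \<partial>M) =
      K * (\<integral>\<^sup>+x. \<integral>\<^sup>+y. joint_density n a d x y * f (root_poly {1..n} x) \<partial>LB {1..<n} \<partial>LB {1..n})" by simp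
    also have "(\<integral>\<^sup>+x. \<integral>\<^sup>+y. joint_density n a d x y * f (root_poly {1..n} x) \<partial>LB {1..<n} \<partial>LB {1..n}) =
      (\<integral>\<^sup>+x. L * (ennreal (zeros_weight n a d x) * f (root_poly {1..n} x)) \<partial>LB {1..n})"
    proof (rule nn_integral_cong)
      fix x assume "x \<in> space (LB {1..n})"
      then have "joint_density n a d x \<in> borel_measurable (LB {1..<n})"
        using measurable_compose_Pair1[OF _ measurable_joint_density[of n a d], of x] by simp
      then show "(\<integral>\<^sup>+y. joint_density n a d x y * f (root_poly {1..n} x) \<partial>LB {1..<n}) =
        L * (ennreal (zeros_weight n a d x) * f (root_poly {1..n} x))"
        by (simp only: nn_integral_multc L mult.assoc)
    qed
    also have "\<dots> = L * (\<integral>\<^sup>+x. ennreal (zeros_weight n a d x) * f (root_poly {1..n} x) \<partial>LB {1..n})"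
      by (rule nn_integral_cmult) measurable
    finally show ?thesis by (simp only: mult.assoc)
  qed
  \<comment> \<open>The law tested on the constant 1. A product equal to 1 has no factor 0 or
    \<open>\<top>\<close>, so the normalization integral is positive and finite and determines
    \<open>K * L\<close>.\<close>
  have norm: "K * L * zeros_norm n a d = 1"
    using law[of "\<lambda>_. 1"] by (simp add: zeros_norm_def emeasure_space_1)
  then have "zeros_norm n a d \<noteq> 0" "zeros_norm n a d \<noteq> \<top>"
    by (auto simp: ennreal_mult_top split: if_splits)
  then have "K * L = 1 / zeros_norm n a d"
    unfolding norm[symmetric] by (simp add: ennreal_mult_divide_eq)
  have "distr M poly_borel (P n) = distr (zeros_measure n a d) poly_borel (root_poly {1..n})"
  proof (rule measure_eqI)
    fix A assume "A \<in> sets (distr M poly_borel (P n))"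
    then have A [measurable]: "A \<in> sets poly_borel" by simp
    have "emeasure (distr M poly_borel (P n)) A = (\<integral>\<^sup>+p. indicator A p \<partial>distr M poly_borel (P n))" by simp
    also have "\<dots> = (\<integral>\<^sup>+\<omega>. indicator A (P n \<omega>) \<partial>M)" using P by (intro nn_integral_distr) auto
    also have "\<dots> = 1 / zeros_norm n a d * (\<integral>\<^sup>+x. ennreal (zeros_weight n a d x) * indicator A (root_poly {1..n} x) \<partial>LB {1..n})"
      unfolding \<open>K * L = _\<close>[symmetric] by (intro law) measurable
    also have "\<dots> = (\<integral>\<^sup>+x. 1 / zeros_norm n a d * (ennreal (zeros_weight n a d x) * indicator A (root_poly {1..n} x)) \<partial>LB {1..n})"
      by (rule nn_integral_cmult[symmetric]) measurable
    also have "\<dots> = (\<integral>\<^sup>+x. ennreal (zeros_weight n a d x) / zeros_norm n a d * indicator A (root_poly {1..n} x) \<partial>LB {1..n})"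
      by (simp add: divide_ennreal_def mult_ac)
    also have "\<dots> = (\<integral>\<^sup>+x. indicator A (root_poly {1..n} x) \<partial>zeros_measure n a d)"
      unfolding zeros_measure_def by (intro nn_integral_density[symmetric]) measurable
    also have "\<dots> = (\<integral>\<^sup>+p. indicator A p \<partial>distr (zeros_measure n a d) poly_borel (root_poly {1..n}))"
      by (intro nn_integral_distr[symmetric]) (simp_all add: zeros_measure_def)
    also have "\<dots> = emeasure (distr (zeros_measure n a d) poly_borel (root_poly {1..n})) A" by simp
    finally show "emeasure (distr M poly_borel (P n)) A = emeasure (distr (zeros_measure n a d) poly_borel (root_poly {1..n})) A" .
  qed simp
  then show "distr M poly_borel (\<lambda>\<omega>. rec_poly (\<lambda>k. b k \<omega>) (\<lambda>k. c k \<omega>) n) = rand_poly_law n (\<gamma> + of_real ((real n - 1) * d)) d"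
    unfolding rand_poly_law_def P_def[abs_def] a_def root_poly_def[abs_def] .
qed

end
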